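(* Let $\mathcal{M}$ be the toric degeneration of a toric variety $M$ with Delzant polytope $P\subset\mathbb{R}^n$ determined by a rational piecewise linear function $f$ on $P$ (the extremal function), with $\hat P$ Delzant and integral. Then the geodesic ray induced by $\mathcal{M}$ has initial direction equal to $f$ in the polytope representation; that is, if $u_t$, $t\ge 0$, is the polytope representation of the induced geodesic ray, then $\frac{\partial u_t}{\partial t}\big|_{t=0}=f$ on $P$.
   Context: Toric degeneration. $P\subset\mathbb{R}^n$ is the Delzant polytope of the toric variety $M$, $f$ is a rational piecewise linear (convex) function on $P$, $K>\max f$, and $\hat P=\{(x,y):x\in P,\ 0\le y\le K-f(x)\}\subset\mathbb{R}^{n+1}$, assumed Delzant and integral. $\hat P$ determines a toric variety $\hat{\mathcal{M}}$ with a positive line bundle whose sections $s_p$ correspond to integral points $p\in\hat P$ ($s_{p_1}s_{p_2}=s_{p_3}s_{p_4}$ whenever $p_1+p_2=p_3+p_4$), and $\hat{\mathcal{M}}\subset P^N$ via $[s_p]_p$. The map $\pi:\hat{\mathcal{M}}\to P^1$ is $x\mapsto[s_p(x):s_q(x)]$ for $p=(d,k)$, $q=(d,k+1)$, and the $\mathbb{C}^*$-action sends $s_{(d,k)}$ to $\lambda^k s_{(d,k)}$, covering $\lambda\circ[x:y]=[x:\lambda y]$. The toric degeneration is $\mathcal{M}=\hat{\mathcal{M}}\setminus\pi^{-1}([1:0])$ (with the direction $\lambda\to\infty$, i.e. the central fibre lies over $[0:1]$); $M$ is identified with the fibre over $[1:1]$, and the open torus orbit of $M$ with $\mathbb{C}^n/2\pi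 i\mathbb{Z}^n$, with real coordinates $y\in\mathbb{R}^n$ (real parts), so that $|s_{(d,k)}|$ becomes $e^{d\cdot y}$. Algebraic ray: $h_{0,t}(y)=\frac12\log\sum_{(d,k)\in\hat P\cap\mathbb{Z}^{n+1}}e^{2kt}e^{2d\cdot y}-Kt$, i.e. the pullback to $M$, by the $\mathbb{C}^*$-action with $\lambda=e^t$, of the Fubini-Study potential (normalized by a function of $t$ alone). Induced geodesic ray: the geodesic ray of torus-invariant potentials $h_t(y)$, $t\ge0$, from a given torus-invariant initial K\"ahler potential $h_0$ in the class of $M$ with moment polytope $P$, obtained from the $C^{1,1}$ solution $\psi$ of the homogeneous complex Monge-Amp\`ere equation $(\Omega+\sqrt{-1}\partial\bar\partial\psi)^{n+1}=0$ on the part of $\mathcal{M}$ over the disc $\{[x:y]:|x|\le|y|\}$ ($\Omega$ the Fubini-Study form), with the $S^1$- and torus-invariant boundary data determined by $h_0$; so $h_t-h_{0,t}$ is the pullback of $\frac12\psi$ and is uniformly bounded (up to the stated normalization). Polytope representation: $u_t$ is the Legendre transform of $h_t$, $u_t(x)+h_t(y)=x\cdot y$ at $x=\frac{\partial h_t}{\partial y}$, a function on $P$. *)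

theory Defs
  imports "HOL-Analysis.Analysis"
begin

section \<open>Delzant polytopes and rational piecewise linear functions\<close>

text \<open>
  \<open>\<real>\<^sup>n\<close> is \<open>real ^ 'n\<close> and \<open>\<real>\<^sup>n\<^sup>+\<^sup>1\<close> is \<open>(real ^ 'n) \<times> real\<close>; in both cases
  \<open>lattice\<close> below is the standard integral lattice.
\<close>

definition lattice :: "'a::euclidean_space set" where
  "lattice = {x. \<forall>b\<in>Basis. x \<bullet> b \<in> \<int>}"

definition lattice_basis :: "'a::euclidean_space set \<Rightarrow> bool" where
  "lattice_basis U \<longleftrightarrow> finite U \<and> U \<subseteq> lattice \<and> independent U \<and>
     (\<forall>x\<in>lattice. \<exists>c :: 'a \<Rightarrow> int. x = (\<Sum>a\<in>U. of_int (c a) *\<^sub>R a))"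

text \<open>
  Near the vertex \<open>v\<close> the polytope is a copy of the standard orthant under an integral
  affine isomorphism; the members of \<open>U\<close> are the primitive generators of the edges at \<open>v\<close>.
\<close>

definition delzant_frame :: "'a::euclidean_space set \<Rightarrow> 'a \<Rightarrow> 'a set \<Rightarrow> bool" where
  "delzant_frame P v U \<longleftrightarrow> v extreme_point_of P \<and> lattice_basis U \<and>
     (\<exists>r>0. P \<inter> ball v r =
        {v + (\<Sum>a\<in>U. c a *\<^sub>R a) | c :: 'a \<Rightarrow> real. \<forall>a\<in>U. 0 \<le> c a} \<inter> ball v r)"

definition delzant :: "'a::euclidean_space set \<Rightarrow> bool" where
  "delzant P \<longleftrightarrow> polytope P \<and> P \<noteq> {} \<and>
     (\<forall>v. v extreme_point_of P \<longrightarrow> (\<exists>U. delzant_frame P v U))"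

definition integral_polytope :: "'a::euclidean_space set \<Rightarrow> bool" where
  "integral_polytope P \<longleftrightarrow> polytope P \<and> (\<forall>v. v extreme_point_of P \<longrightarrow> v \<in> lattice)"

definition rational_piecewise_linear_on ::
    "'a::euclidean_space set \<Rightarrow> ('a \<Rightarrow> real) \<Rightarrow> bool" where
  "rational_piecewise_linear_on P f \<longleftrightarrow>
     (\<exists>\<C>. finite \<C> \<and> (\<forall>C\<in>\<C>. polytope C) \<and> \<Union>\<C> = P \<and>
        (\<forall>C\<in>\<C>. \<exists>a b. (\<forall>i\<in>Basis. a \<bullet> i \<in> \<rat>) \<and> b \<in> \<rat> \<and> (\<forall>x\<in>C. f x = a \<bullet> x + b)))"

definition hat_polytope ::
    "'a set \<Rightarrow> ('a \<Rightarrow> real) \<Rightarrow> real \<Rightarrow> ('a \<times> real) set" where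
  "hat_polytope P f K = {(x, y). x \<in> P \<and> 0 \<le> y \<and> y \<le> K - f x}"


section \<open>Projective toric varieties\<close>

definition lattice_points :: "'a::euclidean_space set \<Rightarrow> 'a set" where
  "lattice_points P = P \<inter> lattice"

text \<open>
  A vector of homogeneous coordinates \<open>(s\<^sub>p)\<close> is a function \<open>s\<close> on \<open>'a\<close>
  vanishing off the lattice points; a point of projective space is the set of all
  nonzero multiples of such a vector.
\<close>

definition proj_class :: "('a \<Rightarrow> complex) \<Rightarrow> ('a \<Rightarrow> complex) set" where
  "proj_class s = {\<lambda>p. c * s p | c. c \<noteq> 0}"

text \<open>A point of the open torus orbit has logarithmic coordinate \<open>y + \<i> \<theta>\<close>.\<close>

definition torus_vec ::
    "'a::euclidean_space set \<Rightarrow> 'a \<Rightarrow> 'a \<Rightarrow> 'a \<Rightarrow> complex" where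
  "torus_vec P y \<theta> = (\<lambda>p. if p \<in> lattice_points P then exp (Complex (p \<bullet> y) (p \<bullet> \<theta>)) else 0)"

definition torus_point ::
    "'a::euclidean_space set \<Rightarrow> 'a \<Rightarrow> 'a \<Rightarrow> ('a \<Rightarrow> complex) set" where
  "torus_point P y \<theta> = proj_class (torus_vec P y \<theta>)"

text \<open>The closure of the torus orbit, taken on the affine cone (topology of \<open>\<complex>\<^sup>N\<^sup>+\<^sup>1\<close>).\<close>

definition toric_variety :: "'a::euclidean_space set \<Rightarrow> ('a \<Rightarrow> complex) set set" where
  "toric_variety P =
     proj_class ` (closure {\<lambda>p. c * torus_vec P y \<theta> p | c y \<theta>. True} - {\<lambda>_. 0})"

text \<open>
  The holomorphic chart \<open>\<complex>\<^sup>m \<rightarrow> toric_variety P\<close> at a vertex \<open>v\<close>: with edge generators \<open>u i\<close>,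
  it is \<open>z \<mapsto> [\<Prod>i. z\<^sub>i ^ m\<^sub>i]\<^sub>p\<close> where \<open>p = v + (\<Sum>i. m\<^sub>i u\<^sub>i)\<close>.  For a Delzant polytope with
  integral vertices these charts form a holomorphic atlas.
\<close>

definition chart_exponent :: "'a::euclidean_space \<Rightarrow> ('m::finite \<Rightarrow> 'a) \<Rightarrow> 'a \<Rightarrow> 'm \<Rightarrow> nat" where
  "chart_exponent v u p = (THE m. p = v + (\<Sum>i\<in>UNIV. real (m i) *\<^sub>R u i))"

definition chart_vec ::
    "'a::euclidean_space set \<Rightarrow> 'a \<Rightarrow> ('m::finite \<Rightarrow> 'a) \<Rightarrow> complex ^ 'm \<Rightarrow> 'a \<Rightarrow> complex" where
  "chart_vec P v u z =
     (\<lambda>p. if p \<in> lattice_points P then \<Prod>i\<in>UNIV. (z $ i) ^ chart_exponent v u p i else 0)"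

definition chart_point ::
    "'a::euclidean_space set \<Rightarrow> 'a \<Rightarrow> ('m::finite \<Rightarrow> 'a) \<Rightarrow> complex ^ 'm \<Rightarrow> ('a \<Rightarrow> complex) set" where
  "chart_point P v u z = proj_class (chart_vec P v u z)"

definition chart_frame :: "'a::euclidean_space set \<Rightarrow> 'a \<Rightarrow> ('m::finite \<Rightarrow> 'a) \<Rightarrow> bool" where
  "chart_frame P v u \<longleftrightarrow> inj u \<and> delzant_frame P v (range u)"

text \<open>Action of the compact torus on the projective toric variety.\<close>

definition torus_rotation ::
    "'a::euclidean_space \<Rightarrow> ('a \<Rightarrow> complex) set \<Rightarrow> ('a \<Rightarrow> complex) set" where
  "torus_rotation \<theta> X = (\<lambda>s p. cis (p \<bullet> \<theta>) * s p) ` X"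

text \<open>
  Local potential of the Fubini-Study form
  \<open>\<Omega> = \<i> \<partial> \<partial>bar log (\<Sum>p. |s\<^sub>p|\<^sup>2)\<close>, evaluated on a nonvanishing local holomorphic lift.
\<close>

definition fs_potential :: "'a::euclidean_space set \<Rightarrow> ('a \<Rightarrow> complex) \<Rightarrow> real" where
  "fs_potential P s = ln (\<Sum>p\<in>lattice_points P. (cmod (s p))\<^sup>2)"


section \<open>Regularity and complex Hessians\<close>

definition has_hessian ::
    "('v::real_normed_vector \<Rightarrow> real) \<Rightarrow> ('v \<Rightarrow> 'v \<Rightarrow> real) \<Rightarrow> 'v \<Rightarrow> bool" where
  "has_hessian g B z \<longleftrightarrow> (\<exists>G r. r > 0 \<and>
      (\<forall>x\<in>ball z r. (g has_derivative G x) (at x)) \<and>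
      (\<forall>a. ((\<lambda>x. G x a) has_derivative (\<lambda>b. B b a)) (at z)))"

text \<open>
  The matrix of \<open>\<partial>\<^sup>2 g / \<partial> z\<^sub>i \<partial> zbar\<^sub>j\<close>, where
  \<open>\<partial>/\<partial> z\<^sub>i = (\<partial>/\<partial> x\<^sub>i - \<i> \<partial>/\<partial> y\<^sub>i) / 2\<close> and \<open>\<partial>/\<partial> zbar\<^sub>j = (\<partial>/\<partial> x\<^sub>j + \<i> \<partial>/\<partial> y\<^sub>j) / 2\<close>,
  in terms of the real Hessian \<open>B\<close> of \<open>g\<close>.
\<close>

definition complex_hessian ::
    "(complex ^ 'm \<Rightarrow> complex ^ 'm \<Rightarrow> real) \<Rightarrow> complex ^ 'm ^ 'm" where
  "complex_hessian B = (\<chi> i j.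
     Complex ((B (axis i 1) (axis j 1) + B (axis i \<i>) (axis j \<i>)) / 4)
             ((B (axis i 1) (axis j \<i>) - B (axis i \<i>) (axis j 1)) / 4))"

definition hermitian_form :: "complex ^ 'm::finite ^ 'm \<Rightarrow> complex ^ 'm \<Rightarrow> real" where
  "hermitian_form H \<xi> = Re (\<Sum>i\<in>UNIV. \<Sum>j\<in>UNIV. \<xi> $ i * H $ i $ j * cnj (\<xi> $ j))"

definition positive_semidefinite :: "complex ^ 'm::finite ^ 'm \<Rightarrow> bool" where
  "positive_semidefinite H \<longleftrightarrow> (\<forall>\<xi>. 0 \<le> hermitian_form H \<xi>)"

definition positive_definite :: "complex ^ 'm::finite ^ 'm \<Rightarrow> bool" where
  "positive_definite H \<longleftrightarrow> (\<forall>\<xi>. \<xi> \<noteq> 0 \<longrightarrow> 0 < hermitian_form H \<xi>)"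

text \<open>Continuous differentiability of order \<open>k\<close>, and smoothness, on the whole space.\<close>

primrec k_times_cont_diff :: "nat \<Rightarrow> ('v::real_normed_vector \<Rightarrow> real) \<Rightarrow> bool" where
  "k_times_cont_diff 0 g = continuous_on UNIV g"
| "k_times_cont_diff (Suc k) g =
     (\<exists>G. (\<forall>x. (g has_derivative G x) (at x)) \<and> (\<forall>a. k_times_cont_diff k (\<lambda>x. G x a)))"

definition smooth :: "('v::real_normed_vector \<Rightarrow> real) \<Rightarrow> bool" where
  "smooth g \<longleftrightarrow> (\<forall>k. k_times_cont_diff k g)"

text \<open>\<open>C\<^sup>1\<^sup>,\<^sup>1\<close> up to the boundary of the (relatively closed) domain \<open>R\<close>.\<close>

definition C11_on :: "'v::real_normed_vector set \<Rightarrow> ('v \<Rightarrow> real) \<Rightarrow> bool" where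
  "C11_on R g \<longleftrightarrow> (\<exists>G :: 'v \<Rightarrow> 'v \<Rightarrow>\<^sub>L real.
      (\<forall>z\<in>R. (g has_derivative blinfun_apply (G z)) (at z within R)) \<and>
      (\<forall>z\<in>R. \<exists>r>0. \<exists>L. L-lipschitz_on (R \<inter> ball z r) G))"


section \<open>The toric degeneration\<close>

text \<open>
  \<open>Q\<close> is a polytope in \<open>\<real>\<^sup>n \<times> \<real>\<close>.  \<open>lies_over Q X x y\<close> means that \<open>\<pi>(X) = [x : y]\<close>, where
  \<open>\<pi> = [s\<^sub>(\<^sub>d\<^sub>,\<^sub>k\<^sub>) : s\<^sub>(\<^sub>d\<^sub>,\<^sub>k\<^sub>+\<^sub>1\<^sub>)]\<close> for any \<open>d\<close>, \<open>k\<close> for which the two coordinates do not both vanish at \<open>X\<close>.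
\<close>

definition lies_over ::
    "('a::euclidean_space \<times> real) set \<Rightarrow> ('a \<times> real \<Rightarrow> complex) set \<Rightarrow> complex \<Rightarrow> complex \<Rightarrow> bool"
where
  "lies_over Q X x y \<longleftrightarrow> (x, y) \<noteq> (0, 0) \<and>
     (\<exists>s\<in>X. \<exists>d k. (d, k) \<in> lattice_points Q \<and> (d, k + 1) \<in> lattice_points Q \<and>
        x = s (d, k) \<and> y = s (d, k + 1))"

definition toric_degeneration ::
    "('a::euclidean_space \<times> real) set \<Rightarrow> ('a \<times> real \<Rightarrow> complex) set set" where
  "toric_degeneration Q = toric_variety Q - {X. \<exists>x. lies_over Q X x 0}"

definition degeneration_over_disc ::
    "('a::euclidean_space \<times> real) set \<Rightarrow> ('a \<times> real \<Rightarrow> complex) set set" where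
  "degeneration_over_disc Q =
     {X \<in> toric_degeneration Q. \<exists>x y. lies_over Q X x y \<and> cmod x \<le> cmod y}"

definition cstar_action ::
    "complex \<Rightarrow> ('a \<times> real \<Rightarrow> complex) set \<Rightarrow> ('a \<times> real \<Rightarrow> complex) set" where
  "cstar_action lam X = (\<lambda>s (d, k). lam ^ nat \<lfloor>k\<rfloor> * s (d, k)) ` X"

text \<open>
  Identification of \<open>M = toric_variety P\<close> with the fibre over \<open>[1 : 1]\<close>,
  where \<open>s\<^sub>(\<^sub>d\<^sub>,\<^sub>k\<^sub>)\<close> does not depend on \<open>k\<close>.
\<close>

definition fibre_vec ::
    "('a::euclidean_space \<times> real) set \<Rightarrow> ('a \<Rightarrow> complex) \<Rightarrow> 'a \<times> real \<Rightarrow> complex" where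
  "fibre_vec Q s = (\<lambda>(d, k). if (d, k) \<in> lattice_points Q then s d else 0)"

definition fibre_embedding ::
    "('a::euclidean_space \<times> real) set \<Rightarrow> ('a \<Rightarrow> complex) set \<Rightarrow> ('a \<times> real \<Rightarrow> complex) set" where
  "fibre_embedding Q X = fibre_vec Q ` X"


section \<open>Geodesic rays\<close>

definition algebraic_ray ::
    "('a::euclidean_space \<times> real) set \<Rightarrow> real \<Rightarrow> real \<Rightarrow> 'a \<Rightarrow> real" where
  "algebraic_ray Q K t y =
     1/2 * ln (\<Sum>(d, k)\<in>lattice_points Q. exp (2 * k * t) * exp (2 * (d \<bullet> y))) - K * t"

text \<open>
  \<open>h0\<close> is a torus invariant Kaehler potential on \<open>M\<close> (written on the open orbit in the real
  logarithmic coordinate) in the class of the Fubini-Study form restricted to the fibre over \<open>[1 : 1]\<close>: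
  \<open>2 * (h0 - algebraic_ray Q K 0)\<close> extends to a smooth function \<open>\<phi>\<close> on \<open>M\<close> with
  \<open>\<Omega> + \<i> \<partial> \<partial>bar \<phi> > 0\<close>.  The value of \<open>K\<close> is irrelevant at \<open>t = 0\<close>.
  In particular \<open>h0 - algebraic_ray Q K 0\<close> is bounded, so the moment polytope of \<open>h0\<close> is \<open>P\<close>.
\<close>

definition toric_kaehler_potential ::
    "(real ^ 'n) set \<Rightarrow> ((real ^ 'n) \<times> real) set \<Rightarrow> real \<Rightarrow> (real ^ 'n \<Rightarrow> real) \<Rightarrow> bool" where
  "toric_kaehler_potential P Q K h0 \<longleftrightarrow>
     (\<exists>\<phi>. (\<forall>y \<theta>. \<phi> (torus_point P y \<theta>) = 2 * (h0 y - algebraic_ray Q K 0 y)) \<and>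
       (\<forall>v. \<forall>u :: 'n \<Rightarrow> real ^ 'n. chart_frame P v u \<longrightarrow>
          smooth (\<lambda>z. \<phi> (chart_point P v u z)) \<and>
          (\<forall>z. \<exists>B. has_hessian
                (\<lambda>z. fs_potential Q (fibre_vec Q (chart_vec P v u z)) + \<phi> (chart_point P v u z)) B z \<and>
              positive_definite (complex_hessian B))))"

text \<open>
  \<open>\<psi>\<close> is the torus invariant \<open>C\<^sup>1\<^sup>,\<^sup>1\<close> solution of \<open>(\<Omega> + \<i> \<partial> \<partial>bar \<psi>)\<^sup>n\<^sup>+\<^sup>1 = 0\<close>,
  \<open>\<Omega> + \<i> \<partial> \<partial>bar \<psi> \<ge> 0\<close>, on the part of the degeneration over the disc.  In a chart the top power is
  \<open>(n+1)!\<close> times the determinant of the complex Hessian of a local potential; its coefficients are only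
  defined almost everywhere.  The torus here is that of the total space, its last factor being the circle in
  the \<open>\<complex>\<^sup>*\<close> acting on the degeneration.  The boundary values are prescribed on the dense set of points
  \<open>e\<^sup>i\<^sup>\<alpha> \<circ> x\<close> with \<open>x\<close> in the open orbit of \<open>M\<close>, which determines them by continuity.
\<close>

definition hcma_solution ::
    "(real ^ 'n) set \<Rightarrow> ((real ^ 'n) \<times> real) set \<Rightarrow> real \<Rightarrow> (real ^ 'n \<Rightarrow> real) \<Rightarrow>
      (((real ^ 'n) \<times> real \<Rightarrow> complex) set \<Rightarrow> real) \<Rightarrow> bool" where
  "hcma_solution P Q K h0 \<psi> \<longleftrightarrow>
     (\<forall>X\<in>degeneration_over_disc Q. \<forall>\<theta>. \<psi> (torus_rotation \<theta> X) = \<psi> X) \<and>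
     (\<forall>v. \<forall>u :: 'n option \<Rightarrow> (real ^ 'n) \<times> real. chart_frame Q v u \<longrightarrow>
        (let R = {z. chart_point Q v u z \<in> degeneration_over_disc Q} in
           C11_on R (\<lambda>z. \<psi> (chart_point Q v u z)) \<and>
           (AE z in lebesgue. z \<in> interior R \<longrightarrow>
              (\<exists>B. has_hessian
                     (\<lambda>z. fs_potential Q (chart_vec Q v u z) + \<psi> (chart_point Q v u z)) B z \<and>
                   positive_semidefinite (complex_hessian B) \<and>
                   det (complex_hessian B) = 0)))) \<and>
     (\<forall>\<alpha> y \<theta>. 1/2 * \<psi> (cstar_action (cis \<alpha>) (fibre_embedding Q (torus_point P y \<theta>)))
        = h0 y - algebraic_ray Q K 0 y)"

definition induced_ray ::
    "(real ^ 'n) set \<Rightarrow> ((real ^ 'n) \<times> real) set \<Rightarrow> real \<Rightarrow>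
      (((real ^ 'n) \<times> real \<Rightarrow> complex) set \<Rightarrow> real) \<Rightarrow> real \<Rightarrow> real ^ 'n \<Rightarrow> real" where
  "induced_ray P Q K \<psi> t y = algebraic_ray Q K t y +
     1/2 * \<psi> (cstar_action (of_real (exp t)) (fibre_embedding Q (torus_point P y 0)))"

text \<open>
  The Legendre transform \<open>u\<close> of \<open>h\<close>: at the points \<open>x = \<partial>h/\<partial>y\<close>, which fill the interior of \<open>P\<close>,
  it is given by \<open>u x + h y = x \<bullet> y\<close>, and at the boundary of \<open>P\<close> by continuous extension.
\<close>

definition polytope_representation ::
    "'a::euclidean_space set \<Rightarrow> ('a \<Rightarrow> real) \<Rightarrow> ('a \<Rightarrow> real) \<Rightarrow> bool" where
  "polytope_representation P h u \<longleftrightarrow>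
     continuous_on P u \<and> (\<forall>x y. GDERIV h y :> x \<longrightarrow> u x + h y = x \<bullet> y)"

end

theory Submission
  imports Defs
begin

text \<open>
  On the open torus orbit of the total space, with real logarithmic coordinates \<open>Y = (y, t)\<close>, the
  degenerate form \<open>\<Omega> + \<i> \<partial> \<partial>bar \<psi>\<close> has a potential \<open>2 \<Phi>(y, t)\<close>, and the induced ray is
  \<open>h\<^sub>t(y) = \<Phi>(y, t) - K t\<close>.  Hence \<open>u\<^sub>t(x) = K t - m\<^sub>t(x)\<close> at interior points \<open>x\<close> of \<open>P\<close>, where
  \<open>m\<^sub>t(x)\<close> is the minimum of \<open>\<Phi>(y, t) - x \<bullet> y\<close> over \<open>y\<close>.  The heart of the proof is that \<open>m\<^sub>t(x)\<close> is
  affine in \<open>t\<close> with slope \<open>K - f(x)\<close> (\<open>slice_min_affine\<close>).  This gives \<open>u\<^sub>t = u\<^sub>0 + t f\<close> for every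
  \<open>t \<ge> 0\<close>, first on the interior of \<open>P\<close> and then by continuity on \<open>P\<close>.

  The slope is found as follows.  Since \<open>\<psi>\<close> is bounded over the disc, \<open>\<Phi>\<close> differs by a bounded amount
  from the support function of \<open>Q\<close>.  As \<open>K - f(x)\<close> is the height of \<open>Q\<close> above \<open>x\<close>, duality shows
  that \<open>m\<^sub>t(x) - t (K - f(x))\<close> is bounded in \<open>t\<close>.  The Monge-Ampere equation says that at almost every
  point the Hessian of \<open>\<Phi>\<close> is positive semidefinite and has a kernel.  By semidefiniteness \<open>\<Phi>\<close> is
  convex (\<open>convex_on_if_second_deriv_nonneg\<close>), hence so is \<open>t \<mapsto> m\<^sub>t(x)\<close>, and a convex function at
  bounded distance from a line of slope \<open>K - f(x)\<close> satisfies \<open>m\<^sub>t(x) \<le> m\<^sub>0(x) + t (K - f(x))\<close>.  By the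
  kernel \<open>\<Phi>(Y) - (x, c) \<bullet> Y\<close> cannot have a strict minimum in the open half space
  (\<open>min_attained_on_frontier\<close>).  For \<open>0 < c < K - f(x)\<close> the point \<open>(x, c)\<close> is interior to \<open>Q\<close>, so this
  function is proper and its minimum is attained at \<open>t = 0\<close>, that is \<open>m\<^sub>0(x) \<le> m\<^sub>t(x) - c t\<close>; letting
  \<open>c\<close> tend to \<open>K - f(x)\<close> gives the opposite inequality.

  The minimum principle and the convexity have a common source, \<open>contact_point_off_negligible\<close>.  If a
  function with Lipschitz gradient has a strict interior minimum, then its minimum after subtraction
  of any small linear function \<open>p\<close> is still interior, and the gradient there is \<open>p\<close>.  So the gradient
  maps these contact points onto a ball, and they cannot all lie in a null set, because a Lipschitz map
  preserves null sets.  Information on the Hessian that holds almost everywhere is therefore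
  available at some contact point.

  Finally \<open>\<Phi>\<close> has to be controlled from the charts.  At a point of the torus with logarithmic coordinate
  \<open>Y + \<i> \<theta>\<close> the potential depends on \<open>Y\<close> only, so its complex Hessian is a multiple of the real
  Hessian of \<open>\<Phi>\<close>, and Fubini's theorem in \<open>\<theta>\<close> turns a null set of the chart into a null set of \<open>Y\<close>
  (\<open>potential_second_derivs\<close>).  For the bound on \<open>\<psi>\<close>, a given \<open>Y\<close> with \<open>t > 0\<close> is viewed in the chart
  at the vertex of \<open>Q\<close> where \<open>p \<bullet> Y\<close> is largest: there its coordinates lie in the closed unit polydisc,
  and since that vertex is not on the bottom face of \<open>Q\<close>, the whole polydisc lies over the disc
  (\<open>polydisc_over_disc\<close>), so that compactness applies.
\<close>

section \<open>Functions with Lipschitz gradient and a minimum principle\<close>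

text \<open>
  A Lipschitz bound at the single point \<open>z\<close>, not between all pairs of nearby points.  It passes to
  products and compositions by the usual rules for derivatives, and it is enough for a map to send null
  sets to null sets.
\<close>

definition pointwise_lipschitz :: "('a::real_normed_vector \<Rightarrow> 'b::real_normed_vector) \<Rightarrow> 'a \<Rightarrow> bool" where
  "pointwise_lipschitz g z \<longleftrightarrow> (\<exists>B. \<forall>\<^sub>F w in nhds z. norm (g w - g z) \<le> B * norm (w - z))"

definition gradient_lipschitz_on :: "'a::euclidean_space set \<Rightarrow> ('a \<Rightarrow> real) \<Rightarrow> bool" where
  "gradient_lipschitz_on W \<Phi> \<longleftrightarrow>
     (\<exists>g. \<forall>z\<in>W. GDERIV \<Phi> z :> g z \<and> pointwise_lipschitz g z)"

text \<open>
  Restricted to a line, a function with Lipschitz gradient is differentiable near the base point, while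
  its derivative is only known to be differentiable at the base point itself.
\<close>

definition has_second_deriv :: "(real \<Rightarrow> real) \<Rightarrow> real \<Rightarrow> bool" where
  "has_second_deriv g q \<longleftrightarrow> (\<exists>g'. (\<forall>\<^sub>F s in nhds 0. (g has_real_derivative g' s) (at s)) \<and>
     (g' has_real_derivative q) (at 0))"

lemma pointwise_lipschitzE:
  assumes "pointwise_lipschitz g z"
  obtains B where "\<forall>\<^sub>F w in nhds z. norm (g w - g z) \<le> B * norm (w - z)"
  using assms unfolding pointwise_lipschitz_def by (elim exE)

lemma gradient_lipschitz_onE:
  assumes "gradient_lipschitz_on W \<Phi>"
  obtains g where "\<forall>z\<in>W. GDERIV \<Phi> z :> g z" "\<forall>z\<in>W. pointwise_lipschitz g z"
  using assms unfolding gradient_lipschitz_on_def by (elim exE) auto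

lemma gradient_lipschitz_onI:
  assumes "\<And>z. z \<in> W \<Longrightarrow> GDERIV \<Phi> z :> g z" "\<And>z. z \<in> W \<Longrightarrow> pointwise_lipschitz g z"
  shows "gradient_lipschitz_on W \<Phi>"
  unfolding gradient_lipschitz_on_def by (rule exI[of _ g]) (use assms in auto)

lemma has_second_derivE:
  assumes "has_second_deriv g q"
  obtains g' where "\<forall>\<^sub>F s in nhds 0. (g has_real_derivative g' s) (at s)" "(g' has_real_derivative q) (at 0)"
  using assms unfolding has_second_deriv_def by (elim exE conjE)

lemma has_second_derivI:
  assumes "\<forall>\<^sub>F s in nhds 0. (g has_real_derivative g' s) (at s)" "(g' has_real_derivative q) (at 0)"
  shows "has_second_deriv g q"
  unfolding has_second_deriv_def by (rule exI[of _ g']) (use assms in auto)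

lemma pointwise_lipschitz_add:
  assumes "pointwise_lipschitz f z" "pointwise_lipschitz g z"
  shows "pointwise_lipschitz (\<lambda>w. f w + g w) z"
proof -
  obtain B where B: "\<forall>\<^sub>F w in nhds z. norm (f w - f z) \<le> B * norm (w - z)"
    using assms(1) by (rule pointwise_lipschitzE)
  obtain C where C: "\<forall>\<^sub>F w in nhds z. norm (g w - g z) \<le> C * norm (w - z)"
    using assms(2) by (rule pointwise_lipschitzE)
  have "\<forall>\<^sub>F w in nhds z. norm ((f w + g w) - (f z + g z)) \<le> (B + C) * norm (w - z)"
    using B C
  proof eventually_elim
    case (elim w)
    have "norm ((f w + g w) - (f z + g z)) \<le> norm (f w - f z) + norm (g w - g z)"
      by (metis add_diff_add norm_triangle_ineq)
    then show ?case using elim by (simp add: distrib_right)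
  qed
  then show ?thesis unfolding pointwise_lipschitz_def by (rule exI)
qed

lemma pointwise_lipschitz_bounded_linear:
  assumes "pointwise_lipschitz f z" "bounded_linear T"
  shows "pointwise_lipschitz (\<lambda>w. T (f w)) z"
proof -
  obtain B where B: "\<forall>\<^sub>F w in nhds z. norm (f w - f z) \<le> B * norm (w - z)"
    using assms(1) by (rule pointwise_lipschitzE)
  interpret T: bounded_linear T by fact
  obtain C where C: "C \<ge> 0" "\<And>x. norm (T x) \<le> norm x * C"
    using T.nonneg_bounded by blast
  have "\<forall>\<^sub>F w in nhds z. norm (T (f w) - T (f z)) \<le> (B * C) * norm (w - z)"
    using B
  proof eventually_elim
    case (elim w)
    have "norm (T (f w) - T (f z)) \<le> norm (f w - f z) * C"
      using C(2)[of "f w - f z"] by (simp add: T.diff)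
    also have "\<dots> \<le> (B * norm (w - z)) * C"
      using elim C(1) by (rule mult_right_mono)
    finally show ?case by (simp add: mult_ac)
  qed
  then show ?thesis unfolding pointwise_lipschitz_def by (rule exI)
qed

lemma pointwise_lipschitz_sum:
  assumes "\<And>i. i \<in> I \<Longrightarrow> pointwise_lipschitz (f i) z"
  shows "pointwise_lipschitz (\<lambda>w. \<Sum>i\<in>I. f i w) z"
  using assms
proof (induction I rule: infinite_finite_induct)
  case (insert i I)
  then show ?case by (simp add: pointwise_lipschitz_add)
qed (auto simp: pointwise_lipschitz_def intro!: exI[of _ 0])

lemma differentiable_imp_pointwise_lipschitz:
  assumes "f differentiable (at z)"
  shows "pointwise_lipschitz f z"
proof -
  obtain f' where f': "(f has_derivative f') (at z)"
    using assms unfolding differentiable_def by blast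
  then interpret bounded_linear f' by (rule has_derivative_bounded_linear)
  obtain C where C: "C \<ge> 0" "\<And>x. norm (f' x) \<le> norm x * C"
    using nonneg_bounded by blast
  obtain d where d: "d > 0" "\<And>w. norm (w - z) < d \<Longrightarrow> norm (f w - f z - f' (w - z)) \<le> 1 * norm (w - z)"
    using f' unfolding has_derivative_at_alt by (metis zero_less_one)
  have "norm (f w - f z) \<le> (1 + C) * norm (w - z)" if "w \<in> ball z d" for w
  proof -
    have "norm (f w - f z) \<le> norm (f w - f z - f' (w - z)) + norm (f' (w - z))"
      using norm_triangle_ineq[of "f w - f z - f' (w - z)" "f' (w - z)"] by simp
    then show ?thesis using d(2)[of w] C(2)[of "w - z"] that
      by (simp add: dist_norm norm_minus_commute algebra_simps)
  qed
  moreover have "\<forall>\<^sub>F w in nhds z. w \<in> ball z d"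
    using d(1) by (intro eventually_nhds_in_open) auto
  ultimately have "\<forall>\<^sub>F w in nhds z. norm (f w - f z) \<le> (1 + C) * norm (w - z)"
    by (auto elim: eventually_mono)
  then show ?thesis unfolding pointwise_lipschitz_def by (rule exI)
qed

lemma gradient_lipschitz_onI_differentiable:
  assumes "\<And>z. z \<in> W \<Longrightarrow> GDERIV \<Phi> z :> g z" "\<And>z. z \<in> W \<Longrightarrow> g differentiable (at z)"
  shows "gradient_lipschitz_on W \<Phi>"
  by (rule gradient_lipschitz_onI[of _ _ g]) (use assms in \<open>auto intro: differentiable_imp_pointwise_lipschitz\<close>)

lemma gradient_lipschitz_on_add:
  assumes "gradient_lipschitz_on W \<Phi>" "gradient_lipschitz_on W \<Psi>"
  shows "gradient_lipschitz_on W (\<lambda>z. \<Phi> z + \<Psi> z)"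
proof -
  obtain f where f: "\<forall>z\<in>W. GDERIV \<Phi> z :> f z" "\<forall>z\<in>W. pointwise_lipschitz f z"
    using assms(1) by (rule gradient_lipschitz_onE)
  obtain g where g: "\<forall>z\<in>W. GDERIV \<Psi> z :> g z" "\<forall>z\<in>W. pointwise_lipschitz g z"
    using assms(2) by (rule gradient_lipschitz_onE)
  show ?thesis
    by (rule gradient_lipschitz_onI[of _ _ "\<lambda>z. f z + g z"]) (use f g in \<open>auto intro: GDERIV_add pointwise_lipschitz_add\<close>)
qed

lemma gradient_lipschitz_on_cmult:
  assumes "gradient_lipschitz_on W \<Phi>"
  shows "gradient_lipschitz_on W (\<lambda>z. (c::real) * \<Phi> z)"
proof -
  obtain f where f: "\<forall>z\<in>W. GDERIV \<Phi> z :> f z" "\<forall>z\<in>W. pointwise_lipschitz f z"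
    using assms(1) by (rule gradient_lipschitz_onE)
  have "GDERIV (\<lambda>z. c * \<Phi> z) z :> c *\<^sub>R f z" if "z \<in> W" for z
  proof -
    have "(\<Phi> has_derivative (\<lambda>h. h \<bullet> f z)) (at z)"
      using f that by (auto simp: gderiv_def)
    then have "((\<lambda>z. c * \<Phi> z) has_derivative (\<lambda>h. c * (h \<bullet> f z))) (at z)"
      by (rule has_derivative_mult_right)
    then show ?thesis by (simp add: gderiv_def)
  qed
  moreover have "pointwise_lipschitz (\<lambda>z. c *\<^sub>R f z) z" if "z \<in> W" for z
    by (rule pointwise_lipschitz_bounded_linear) (use f that in \<open>auto intro: bounded_linear_scaleR_right\<close>)
  ultimately show ?thesis by (rule gradient_lipschitz_onI)
qed

lemma gradient_lipschitz_on_subset: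
  "gradient_lipschitz_on W \<Phi> \<Longrightarrow> V \<subseteq> W \<Longrightarrow> gradient_lipschitz_on V \<Phi>"
  by (erule gradient_lipschitz_onE) (auto intro!: gradient_lipschitz_onI)

lemma gradient_lipschitz_on_imp_continuous_on:
  assumes "gradient_lipschitz_on W \<Phi>"
  shows "continuous_on W \<Phi>"
proof -
  obtain f where f: "\<forall>z\<in>W. GDERIV \<Phi> z :> f z" "\<forall>z\<in>W. pointwise_lipschitz f z"
    using assms(1) by (rule gradient_lipschitz_onE)
  show ?thesis
    by (rule has_derivative_continuous_on[of _ _ "\<lambda>z h. h \<bullet> f z"])
       (use f(1) in \<open>auto simp: gderiv_def intro: has_derivative_at_withinI\<close>)
qed

lemma has_second_deriv_add:
  assumes "has_second_deriv f p" "has_second_deriv g q"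
  shows "has_second_deriv (\<lambda>s. f s + g s) (p + q)"
proof -
  obtain f' where f: "\<forall>\<^sub>F s in nhds 0. (f has_real_derivative f' s) (at s)" "(f' has_real_derivative p) (at 0)"
    using assms(1) by (rule has_second_derivE)
  obtain g' where g: "\<forall>\<^sub>F s in nhds 0. (g has_real_derivative g' s) (at s)" "(g' has_real_derivative q) (at 0)"
    using assms(2) by (rule has_second_derivE)
  have "\<forall>\<^sub>F s in nhds 0. ((\<lambda>s. f s + g s) has_real_derivative (f' s + g' s)) (at s)"
    using f(1) g(1) by eventually_elim (rule DERIV_add)
  then show ?thesis
    using DERIV_add[OF f(2) g(2)] by (rule has_second_derivI)
qed

lemma has_second_deriv_cmult:
  assumes "has_second_deriv f p"
  shows "has_second_deriv (\<lambda>s. c * f s) (c * p)"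
proof -
  obtain f' where f: "\<forall>\<^sub>F s in nhds 0. (f has_real_derivative f' s) (at s)" "(f' has_real_derivative p) (at 0)"
    using assms(1) by (rule has_second_derivE)
  have "\<forall>\<^sub>F s in nhds 0. ((\<lambda>s. c * f s) has_real_derivative (c * f' s)) (at s)"
    using f(1) by eventually_elim (rule DERIV_cmult)
  then show ?thesis
    using DERIV_cmult[OF f(2)] by (rule has_second_derivI)
qed

lemma has_second_deriv_quadratic: "has_second_deriv (\<lambda>s. a + b * s + c * s\<^sup>2) (2 * c)"
  by (rule has_second_derivI[of _ "\<lambda>s. b + 2 * c * s"]) (auto intro!: derivative_eq_intros always_eventually)

text \<open>
  If \<open>q\<close> were negative, \<open>g'\<close> would be negative immediately to the right of \<open>0\<close>, where it vanishes.
\<close>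

lemma second_deriv_nonneg_at_local_min:
  assumes "has_second_deriv g q" and min: "\<forall>\<^sub>F s in nhds 0. g 0 \<le> g s"
  shows "0 \<le> q"
proof (rule ccontr)
  assume "\<not> 0 \<le> q"
  obtain g' where g: "\<forall>\<^sub>F s in nhds 0. (g has_real_derivative g' s) (at s)" and g': "(g' has_real_derivative q) (at 0)"
    using assms(1) by (rule has_second_derivE)
  from g min have "\<forall>\<^sub>F s in nhds 0. (g has_real_derivative g' s) (at s) \<and> g 0 \<le> g s"
    by eventually_elim simp
  then obtain d where d: "d > 0" "\<And>s. \<bar>s\<bar> < d \<Longrightarrow> (g has_real_derivative g' s) (at s)" "\<And>s. \<bar>s\<bar> < d \<Longrightarrow> g 0 \<le> g s"
    by (auto simp: eventually_nhds_metric dist_real_def)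
  have "g' 0 = 0"
    by (rule DERIV_local_min[of g "g' 0" 0 d]) (use d in auto)
  obtain e where e: "e > 0" "\<And>h. 0 < h \<Longrightarrow> h < e \<Longrightarrow> g' (0 + h) < g' 0"
    using DERIV_neg_dec_right[OF g'] \<open>\<not> 0 \<le> q\<close> by auto
  define s where "s = min d e / 2"
  have s: "0 < s" "s < d" "s < e" using d(1) e(1) by (auto simp: s_def)
  have "g s < g 0"
  proof (rule DERIV_neg_imp_decreasing_open[OF s(1)])
    show "\<exists>y. (g has_real_derivative y) (at x) \<and> y < 0" if "0 < x" "x < s" for x
      using d(2)[of x] e(2)[of x] that s \<open>g' 0 = 0\<close> by auto
    show "continuous_on {0..s} g"
      by (rule DERIV_continuous_on[of _ _ g']) (use s d(2) in \<open>auto intro: has_field_derivative_at_within\<close>)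
  qed
  then show False using d(3)[of s] s by auto
qed

lemma frontier_margin:
  fixes G :: "'a::euclidean_space \<Rightarrow> real"
  assumes "compact C" "continuous_on C G" "\<And>z. z \<in> frontier C \<Longrightarrow> m < G z"
  obtains \<delta> where "\<delta> > 0" "\<And>z. z \<in> frontier C \<Longrightarrow> m + \<delta> \<le> G z"
proof (cases "frontier C = {}")
  case True
  then show ?thesis using that[of 1] by auto
next
  case False
  have sub: "frontier C \<subseteq> C" using assms(1) by (simp add: compact_imp_closed frontier_subset_closed)
  obtain x where "x \<in> frontier C" "\<forall>y\<in>frontier C. G x \<le> G y"
    using continuous_attains_inf[OF compact_frontier[OF assms(1)] False continuous_on_subset[OF assms(2) sub]] by blast
  then show ?thesis using that[of "G x - m"] assms(3)[of x] by auto
qed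

text \<open>
  Tilting \<open>G\<close> by a small linear function \<open>p\<close> keeps its minimum in the interior, and there the gradient of
  \<open>G\<close> equals \<open>p\<close>.  If all these minimum points belonged to the null set \<open>N\<close>, the gradient would map a null
  set onto a ball.
\<close>

lemma contact_point_off_negligible:
  fixes G :: "'a::euclidean_space \<Rightarrow> real"
  assumes C: "compact C" and cont: "continuous_on C G" and C11: "gradient_lipschitz_on (interior C) G"
    and N: "negligible N" and z1: "z1 \<in> C" and less: "\<And>z. z \<in> frontier C \<Longrightarrow> G z1 < G z"
  obtains z p where "z \<in> interior C" "z \<notin> N" "\<forall>w\<in>C. G z - p \<bullet> z \<le> G w - p \<bullet> w"
proof -
  obtain g where g: "\<forall>z\<in>interior C. GDERIV G z :> g z" "\<forall>z\<in>interior C. pointwise_lipschitz g z"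
    using C11 by (rule gradient_lipschitz_onE)
  obtain \<delta> where \<delta>: "\<delta> > 0" "\<And>z. z \<in> frontier C \<Longrightarrow> G z1 + \<delta> \<le> G z"
    using frontier_margin[OF C cont less] by blast
  obtain b where b: "b > 0" "\<And>z. z \<in> C \<Longrightarrow> norm z \<le> b"
    using C bounded_pos compact_imp_bounded by metis
  \<comment> \<open>On \<open>C\<close> a tilt by \<open>p\<close> with \<open>norm p < r\<close> changes differences of values by less than \<open>\<delta>\<close>.\<close>
  define r where "r = \<delta> / (2 * b)"
  have "r > 0" using \<delta> b by (simp add: r_def)
  have ex: "\<exists>z\<in>interior C. \<forall>w\<in>C. G z - p \<bullet> z \<le> G w - p \<bullet> w" if p: "p \<in> ball 0 r" for p
  proof -
    have "continuous_on C (\<lambda>z. G z - p \<bullet> z)" by (intro continuous_intros cont)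
    then obtain z where z: "z \<in> C" "\<forall>w\<in>C. G z - p \<bullet> z \<le> G w - p \<bullet> w"
      using continuous_attains_inf[OF C] z1 by blast
    have "z \<notin> frontier C"
    proof
      assume "z \<in> frontier C"
      then have "\<delta> \<le> p \<bullet> (z - z1)" using \<delta>(2)[of z] z(2) z1 by (auto simp: inner_diff_right)
      also have "\<dots> \<le> norm p * norm (z - z1)" by (rule norm_cauchy_schwarz)
      also have "\<dots> \<le> norm p * (2 * b)"
        using b(2)[OF z(1)] b(2)[OF z1] norm_triangle_ineq4[of z z1] by (intro mult_left_mono) auto
      also have "\<dots> < r * (2 * b)" using p b(1) by (intro mult_strict_right_mono) auto
      also have "\<dots> = \<delta>" using b(1) by (simp add: r_def)
      finally show False by simp
    qed
    then have "z \<in> interior C" using z(1) by (metis DiffI frontier_def closure_subset subset_iff)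
    then show ?thesis using z by blast
  qed
  have "\<exists>z p. z \<in> interior C \<and> z \<notin> N \<and> (\<forall>w\<in>C. G z - p \<bullet> z \<le> G w - p \<bullet> w)"
  proof (rule ccontr)
    assume con: "\<not> ?thesis"
    have "ball 0 r \<subseteq> g ` (N \<inter> interior C)"
    proof
      fix p assume p: "p \<in> ball (0::'a) r"
      obtain z where z: "z \<in> interior C" "\<forall>w\<in>C. G z - p \<bullet> z \<le> G w - p \<bullet> w"
        using ex[OF p] by blast
      then have "z \<in> N" using con by blast
      have "(G has_derivative (\<lambda>h. h \<bullet> g z)) (at z)" using g(1) z(1) by (simp add: gderiv_def)
      then have der: "((\<lambda>w. G w - p \<bullet> w) has_derivative (\<lambda>h. h \<bullet> g z - p \<bullet> h)) (at z)"
        by (auto intro!: derivative_eq_intros)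
      obtain d where d: "d > 0" "ball z d \<subseteq> interior C" using z(1) by (meson open_contains_ball open_interior)
      have "(\<lambda>h. h \<bullet> g z - p \<bullet> h) = (\<lambda>h. 0)"
        by (rule differential_zero_maxmin[of z "ball z d" "\<lambda>w. G w - p \<bullet> w"])
           (use d z(2) der interior_subset in auto)
      then have "(g z - p) \<bullet> (g z - p) = 0"
        by (metis inner_commute inner_diff_left)
      then have "p = g z" by simp
      then show "p \<in> g ` (N \<inter> interior C)" using \<open>z \<in> N\<close> z(1) by blast
    qed
    moreover have "negligible (g ` (N \<inter> interior C))"
    proof (rule negligible_locally_Lipschitz_image)
      show "negligible (N \<inter> interior C)" using N by (simp add: negligible_Int)
      fix x assume "x \<in> N \<inter> interior C"
      then obtain B where "\<forall>\<^sub>F w in nhds x. norm (g w - g x) \<le> B * norm (w - x)"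
        using g(2) by (auto elim: pointwise_lipschitzE)
      then show "\<exists>T B. open T \<and> x \<in> T \<and> (\<forall>y\<in>N \<inter> interior C \<inter> T. norm (g y - g x) \<le> B * norm (y - x))"
        unfolding eventually_nhds by blast
    qed simp
    ultimately have "negligible (ball (0::'a) r)" using negligible_subset by blast
    then show False using open_not_negligible[OF open_ball, of "0::'a" r] \<open>r > 0\<close> by simp
  qed
  then show ?thesis using that by blast
qed

text \<open>
  A minimum principle of Monge-Ampere type.  A strict interior minimum would survive the subtraction of
  a small multiple of \<open>\<bar>z\<bar>\<^sup>2\<close> and of a small linear function.  At a contact point outside \<open>N\<close> the second
  derivative in the direction \<open>\<eta>\<close> would then be negative at a minimum.
\<close>

theorem min_attained_on_frontier:
  fixes G :: "'a::euclidean_space \<Rightarrow> real"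
  assumes C: "compact C" and cont: "continuous_on C G" and C11: "gradient_lipschitz_on (interior C) G"
    and N: "negligible N"
    and deg: "\<And>z. z \<in> interior C \<Longrightarrow> z \<notin> N \<Longrightarrow>
        \<exists>\<eta> q. \<eta> \<noteq> 0 \<and> q \<le> 0 \<and> has_second_deriv (\<lambda>s. G (z + s *\<^sub>R \<eta>)) q"
    and z1: "z1 \<in> C"
  shows "\<exists>z\<in>frontier C. G z \<le> G z1"
proof (rule ccontr)
  assume "\<not> ?thesis"
  then have less: "\<And>z. z \<in> frontier C \<Longrightarrow> G z1 < G z" by force
  obtain \<delta> where \<delta>: "\<delta> > 0" "\<And>z. z \<in> frontier C \<Longrightarrow> G z1 + \<delta> \<le> G z"
    using frontier_margin[OF C cont less] by blast
  obtain b where b: "b > 0" "\<And>z. z \<in> C \<Longrightarrow> norm z \<le> b"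
    using C bounded_pos compact_imp_bounded by metis
  \<comment> \<open>Small enough for \<open>z1\<close> to stay strictly below the frontier.\<close>
  define \<epsilon> where "\<epsilon> = \<delta> / (2 * b\<^sup>2)"
  have \<epsilon>: "\<epsilon> > 0" "\<epsilon> * b\<^sup>2 < \<delta>" using \<delta> b by (auto simp: \<epsilon>_def)
  define H where "H = (\<lambda>z. G z + (-\<epsilon>) * (z \<bullet> z))"
  have sq: "gradient_lipschitz_on (interior C) (\<lambda>z. z \<bullet> z)"
  proof (rule gradient_lipschitz_onI_differentiable)
    show "GDERIV (\<lambda>z. z \<bullet> z) z :> 2 *\<^sub>R z" for z :: 'a
      unfolding gderiv_def by (auto intro!: derivative_eq_intros simp: inner_commute)
    show "(*\<^sub>R) 2 differentiable at z" for z :: 'a by simp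
  qed
  obtain z p where z: "z \<in> interior C" "z \<notin> N" "\<forall>w\<in>C. H z - p \<bullet> z \<le> H w - p \<bullet> w"
  proof (rule contact_point_off_negligible[OF C _ _ N z1, of H])
    show "continuous_on C H" unfolding H_def by (intro continuous_intros cont)
    show "gradient_lipschitz_on (interior C) H"
      unfolding H_def by (intro gradient_lipschitz_on_add gradient_lipschitz_on_cmult C11 sq)
    show "H z1 < H z" if "z \<in> frontier C" for z
    proof -
      have "z \<in> C" using that C by (meson compact_imp_closed frontier_subset_closed subsetD)
      then have "z \<bullet> z \<le> b\<^sup>2" using b(2)[of z] by (simp add: dot_square_norm power_mono)
      then have "\<epsilon> * (z \<bullet> z) \<le> \<epsilon> * b\<^sup>2" using \<epsilon>(1) by (intro mult_left_mono) auto
      moreover have "0 \<le> \<epsilon> * (z1 \<bullet> z1)" using \<epsilon>(1) by simp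
      ultimately show ?thesis using \<delta>(2)[OF that] \<epsilon>(2) unfolding H_def by linarith
    qed
  qed
  obtain \<eta> q where \<eta>: "\<eta> \<noteq> 0" "q \<le> 0" "has_second_deriv (\<lambda>s. G (z + s *\<^sub>R \<eta>)) q"
    using deg[OF z(1,2)] by blast
  define c0 c1 c2 where "c0 = -\<epsilon> * (z \<bullet> z) - p \<bullet> z" and "c1 = -2 * \<epsilon> * (z \<bullet> \<eta>) - p \<bullet> \<eta>" and "c2 = -\<epsilon> * (\<eta> \<bullet> \<eta>)"
  have eq: "H (z + s *\<^sub>R \<eta>) - p \<bullet> (z + s *\<^sub>R \<eta>) = G (z + s *\<^sub>R \<eta>) + (c0 + c1 * s + c2 * s\<^sup>2)" for s
    by (simp add: H_def c0_def c1_def c2_def inner_add_left inner_add_right algebra_simps power2_eq_square inner_commute)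
  have "0 \<le> q + 2 * c2"
  proof (rule second_deriv_nonneg_at_local_min)
    show "has_second_deriv (\<lambda>s. H (z + s *\<^sub>R \<eta>) - p \<bullet> (z + s *\<^sub>R \<eta>)) (q + 2 * c2)"
      unfolding eq by (intro has_second_deriv_add \<eta>(3) has_second_deriv_quadratic)
    have "((\<lambda>s. z + s *\<^sub>R \<eta>) \<longlongrightarrow> z + 0 *\<^sub>R \<eta>) (nhds 0)"
      by (intro tendsto_intros filterlim_ident)
    then have "\<forall>\<^sub>F s in nhds 0. z + s *\<^sub>R \<eta> \<in> interior C"
      using z(1) topological_tendstoD[of _ "z" "nhds 0" "interior C"] by auto
    then show "\<forall>\<^sub>F s in nhds 0. H (z + 0 *\<^sub>R \<eta>) - p \<bullet> (z + 0 *\<^sub>R \<eta>) \<le> H (z + s *\<^sub>R \<eta>) - p \<bullet> (z + s *\<^sub>R \<eta>)"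
    proof eventually_elim
      case (elim s)
      then show ?case using z(3) interior_subset by auto
    qed
  qed
  moreover have "c2 < 0" using \<epsilon>(1) \<eta>(1) by (simp add: c2_def)
  ultimately show False using \<eta>(2) by simp
qed

text \<open>
  The chord \<open>lin\<close> over a segment from \<open>a\<close> to \<open>b\<close> is extended to a thin tube around it as a function of the
  longitudinal coordinate \<open>\<sigma>\<close>.  In the direction \<open>e = b - a\<close> the function
  \<open>lin - \<Phi> + M \<bar>w\<bar>\<^sup>2\<close>, with \<open>w\<close> the transversal component, has nonpositive second derivative almost
  everywhere, so its minimum over the tube is attained on the frontier.  If \<open>\<Phi>\<close> were above its chord
  somewhere, then for a thin tube and the right \<open>M\<close> the value at that point would be smaller than all
  values on the frontier.
\<close>

theorem convex_on_if_second_deriv_nonneg: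
  fixes \<Phi> :: "'a::euclidean_space \<Rightarrow> real"
  assumes W: "open W" "convex W" and C11: "gradient_lipschitz_on W \<Phi>" and N: "negligible N"
    and nonneg: "\<And>z \<eta>. z \<in> W \<Longrightarrow> z \<notin> N \<Longrightarrow> \<exists>q\<ge>0. has_second_deriv (\<lambda>s. \<Phi> (z + s *\<^sub>R \<eta>)) q"
  shows "convex_on W \<Phi>"
proof (rule convex_onI[OF _ W(2)], rule ccontr)
  fix t :: real and a b
  assume t: "0 < t" "t < 1" and ab: "a \<in> W" "b \<in> W"
    and not_le: "\<not> \<Phi> ((1 - t) *\<^sub>R a + t *\<^sub>R b) \<le> (1 - t) * \<Phi> a + t * \<Phi> b"
  have "a \<noteq> b"
  proof
    assume "a = b"
    moreover have "(1 - t) *\<^sub>R a + t *\<^sub>R a = a" by (simp add: algebra_simps)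
    ultimately show False using not_le by (simp add: algebra_simps)
  qed
  define e k c where "e = b - a" and "k = (1 / (e \<bullet> e)) *\<^sub>R e" and "c = a + t *\<^sub>R e"
  define \<sigma> where "\<sigma> = (\<lambda>z. (z - a) \<bullet> k)"
  define w where "w = (\<lambda>z. z - a - \<sigma> z *\<^sub>R e)"
  define \<kappa> where "\<kappa> = \<Phi> c - ((1 - t) * \<Phi> a + t * \<Phi> b)"
  have e: "e \<noteq> 0" "e \<bullet> e \<noteq> 0" "e \<bullet> k = 1" using \<open>a \<noteq> b\<close> by (auto simp: e_def k_def)
  have "c = (1 - t) *\<^sub>R a + t *\<^sub>R b" by (simp add: c_def e_def algebra_simps)
  then have \<kappa>: "\<kappa> > 0" using not_le by (simp add: \<kappa>_def)
  have z_eq: "z = a + \<sigma> z *\<^sub>R e + w z" for z by (simp add: w_def)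
  have cont\<sigma>: "continuous_on X \<sigma>" for X unfolding \<sigma>_def by (intro continuous_intros)
  have contw: "continuous_on X w" for X unfolding w_def by (intro continuous_intros cont\<sigma>)
  have seg: "a + s *\<^sub>R e \<in> closed_segment a b" if "0 \<le> s" "s \<le> 1" for s
    unfolding closed_segment_def using that by (auto simp: e_def algebra_simps intro!: exI[of _ s])
  have "closed_segment a b \<subseteq> W" using W(2) ab by (rule closed_segment_subset[rotated 2])
  then obtain r0 where r0: "r0 > 0" "(\<Union>x\<in>closed_segment a b. cball x r0) \<subseteq> W"
    using compact_subset_open_imp_cball_epsilon_subset[OF compact_segment W(1)] by metis
  have contPhi: "continuous_on W \<Phi>" using C11 by (rule gradient_lipschitz_on_imp_continuous_on)
  have near: "\<exists>r>0. \<forall>z. dist z x < r \<longrightarrow> dist (\<Phi> z) (\<Phi> x) < \<kappa> / 2" if "x \<in> W" for x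
  proof -
    have "isCont \<Phi> x" using contPhi W(1) that continuous_on_eq_continuous_at by blast
    then show ?thesis unfolding continuous_at_eps_delta using \<kappa> half_gt_zero by blast
  qed
  obtain ra where ra: "ra > 0" "\<And>z. dist z a < ra \<Longrightarrow> dist (\<Phi> z) (\<Phi> a) < \<kappa> / 2"
    using near[OF ab(1)] by auto
  obtain rb where rb: "rb > 0" "\<And>z. dist z b < rb \<Longrightarrow> dist (\<Phi> z) (\<Phi> b) < \<kappa> / 2"
    using near[OF ab(2)] by auto
  define r where "r = min r0 (min (ra / 2) (rb / 2))"
  have r: "r > 0" "r \<le> r0" "r < ra" "r < rb" using r0(1) ra(1) rb(1) by (auto simp: r_def)
  define C where "C = {z. 0 \<le> \<sigma> z \<and> \<sigma> z \<le> 1 \<and> norm (w z) \<le> r}"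
  have CW: "C \<subseteq> W"
  proof
    fix z assume z: "z \<in> C"
    then have "a + \<sigma> z *\<^sub>R e \<in> closed_segment a b" using seg by (simp add: C_def)
    moreover have "dist (a + \<sigma> z *\<^sub>R e) z \<le> r0"
    proof -
      have "a + \<sigma> z *\<^sub>R e - z = - w z" by (simp add: w_def)
      then show ?thesis using z r(2) by (simp add: C_def dist_norm)
    qed
    ultimately show "z \<in> W" using r0(2) by force
  qed
  have "closed C"
  proof -
    have "C = {z. 0 \<le> \<sigma> z} \<inter> {z. \<sigma> z \<le> 1} \<inter> {z. norm (w z) \<le> r}" by (auto simp: C_def)
    then show ?thesis by (auto intro!: closed_Int closed_Collect_le continuous_intros cont\<sigma> contw)
  qed
  moreover have "bounded C"
  proof (rule boundedI)
    fix z assume z: "z \<in> C"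
    have "norm z \<le> norm a + norm (\<sigma> z *\<^sub>R e) + norm (w z)"
      by (subst (1) z_eq) (meson norm_triangle_ineq norm_triangle_le add_mono order_refl order_trans)
    moreover have "norm (\<sigma> z *\<^sub>R e) \<le> norm e" using z by (simp add: C_def mult_left_le_one_le)
    ultimately show "norm z \<le> norm a + norm e + r" using z by (simp add: C_def)
  qed
  ultimately have C: "compact C" by (simp add: compact_eq_bounded_closed)
  define lin where "lin = (\<lambda>z. \<Phi> a + \<sigma> z * (\<Phi> b - \<Phi> a))"
  have contd: "continuous_on C (\<lambda>z. - \<Phi> z + lin z)"
    unfolding lin_def by (intro continuous_intros cont\<sigma> continuous_on_subset[OF contPhi CW])
  then have "bounded ((\<lambda>z. - \<Phi> z + lin z) ` C)"
    using C compact_continuous_image compact_imp_bounded by blast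
  then obtain D where D: "D > 0" "\<And>z. z \<in> C \<Longrightarrow> \<bar>- \<Phi> z + lin z\<bar> \<le> D"
    unfolding bounded_pos by auto
  \<comment> \<open>On the lateral boundary \<open>norm (w z) = r\<close> the penalty \<open>M \<bar>w\<bar>\<^sup>2\<close> equals \<open>D\<close>.\<close>
  define M where "M = D / r\<^sup>2"
  have M: "M \<ge> 0" "M * r\<^sup>2 = D" using D(1) r(1) by (auto simp: M_def)
  define T where "T = (\<lambda>z. lin z + M * (w z \<bullet> w z))"
  have ww: "w z \<bullet> w z = (z - a) \<bullet> (z - a) - (\<sigma> z)\<^sup>2 * (e \<bullet> e)" for z
  proof -
    have "(z - a) \<bullet> e = \<sigma> z * (e \<bullet> e)" using e by (simp add: \<sigma>_def k_def)
    then show ?thesis by (simp add: w_def inner_diff_left inner_diff_right inner_commute algebra_simps power2_eq_square)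
  qed
  have dT: "GDERIV T z :> (\<Phi> b - \<Phi> a) *\<^sub>R k + (2 * M) *\<^sub>R w z" for z
  proof -
    have "(T has_derivative (\<lambda>h. (h \<bullet> k) * (\<Phi> b - \<Phi> a) + M * (2 * (h \<bullet> (z - a)) - 2 * \<sigma> z * (h \<bullet> k) * (e \<bullet> e)))) (at z)"
      unfolding T_def ww lin_def \<sigma>_def
      by (auto intro!: derivative_eq_intros simp: inner_commute algebra_simps)
    moreover have "(h \<bullet> k) * (e \<bullet> e) = h \<bullet> e" for h using e by (simp add: k_def)
    ultimately show ?thesis unfolding gderiv_def
      by (auto simp: w_def inner_add_right inner_diff_right algebra_simps elim!: has_derivative_eq_rhs)
  qed
  have gT: "gradient_lipschitz_on X T" for X
  proof (rule gradient_lipschitz_onI_differentiable[OF dT])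
    have "w differentiable (at z)" for z unfolding w_def \<sigma>_def by (intro derivative_intros) auto
    then show "(\<lambda>z. (\<Phi> b - \<Phi> a) *\<^sub>R k + (2 * M) *\<^sub>R w z) differentiable (at z)" for z by simp
  qed
  define G where "G = (\<lambda>z. (-1) * \<Phi> z + T z)"
  have Gc: "G c = - \<kappa>"
  proof -
    have "\<sigma> c = t" "w c = 0" using e by (simp_all add: c_def w_def \<sigma>_def)
    then show ?thesis by (simp add: G_def T_def lin_def \<kappa>_def algebra_simps)
  qed
  have cC: "c \<in> C" using e t r(1) by (simp add: C_def c_def w_def \<sigma>_def)
  have "\<exists>z\<in>frontier C. G z \<le> G c"
  proof (rule min_attained_on_frontier[OF C _ _ N _ cC])
    have "continuous_on W T" using gT by (rule gradient_lipschitz_on_imp_continuous_on)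
    then show "continuous_on C G" unfolding G_def
      by (intro continuous_intros continuous_on_subset[OF contPhi CW]) (rule continuous_on_subset[OF _ CW])
    have "gradient_lipschitz_on W G" unfolding G_def
      by (intro gradient_lipschitz_on_add gradient_lipschitz_on_cmult C11 gT)
    then show "gradient_lipschitz_on (interior C) G"
      using CW interior_subset by (meson gradient_lipschitz_on_subset order_trans)
    fix z assume z: "z \<in> interior C" "z \<notin> N"
    then obtain q where q: "q \<ge> 0" "has_second_deriv (\<lambda>s. \<Phi> (z + s *\<^sub>R e)) q"
      using nonneg[of z e] CW interior_subset by blast
    have "T (z + s *\<^sub>R e) = T z + (\<Phi> b - \<Phi> a) * s + 0 * s\<^sup>2" for s
    proof -
      have "\<sigma> (z + s *\<^sub>R e) = \<sigma> z + s" using e by (simp add: \<sigma>_def inner_add_left inner_diff_left)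
      moreover from this have "w (z + s *\<^sub>R e) = w z" by (simp add: w_def algebra_simps)
      ultimately show ?thesis by (simp add: T_def lin_def algebra_simps)
    qed
    then have "has_second_deriv (\<lambda>s. G (z + s *\<^sub>R e)) ((-1) * q + 2 * 0)"
      unfolding G_def by (simp only:) (intro has_second_deriv_add has_second_deriv_cmult q(2) has_second_deriv_quadratic)
    then show "\<exists>\<eta> q. \<eta> \<noteq> 0 \<and> q \<le> 0 \<and> has_second_deriv (\<lambda>s. G (z + s *\<^sub>R \<eta>)) q"
      using q(1) e(1) by (intro exI[of _ e] exI[of _ "(-1) * q + 2 * 0"]) auto
  qed
  then obtain z where z: "z \<in> frontier C" "G z \<le> - \<kappa>" using Gc by auto
  have zC: "z \<in> C" using z(1) \<open>closed C\<close> frontier_subset_closed by blast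
  have Gz: "G z \<ge> - \<Phi> z + lin z" using M(1) by (simp add: G_def T_def)
  have "\<sigma> z = 0 \<or> \<sigma> z = 1 \<or> norm (w z) = r"
  proof (rule ccontr)
    assume "\<not> ?thesis"
    then have mem: "z \<in> {z. 0 < \<sigma> z} \<inter> {z. \<sigma> z < 1} \<inter> {z. norm (w z) < r}" (is "_ \<in> ?O")
      using zC by (auto simp: C_def)
    have "open ?O" by (auto intro!: open_Int open_Collect_less continuous_intros cont\<sigma> contw)
    moreover have "?O \<subseteq> C" by (auto simp: C_def)
    ultimately have "z \<in> interior C" using mem by (meson interiorI)
    then show False using z(1) by (simp add: frontier_def)
  qed
  then show False
  proof (elim disjE)
    assume "\<sigma> z = 0"
    then have "dist z a \<le> r" using zC z_eq[of z] by (simp add: C_def dist_norm w_def)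
    then have "dist (\<Phi> z) (\<Phi> a) < \<kappa> / 2" using ra(2) r(3) by simp
    then show False using Gz z(2) \<open>\<sigma> z = 0\<close> \<kappa> unfolding lin_def dist_real_def by (simp add: abs_if split: if_splits)
  next
    assume "\<sigma> z = 1"
    then have "dist z b \<le> r" using zC by (simp add: C_def dist_norm w_def e_def)
    then have "dist (\<Phi> z) (\<Phi> b) < \<kappa> / 2" using rb(2) r(4) by simp
    then show False using Gz z(2) \<open>\<sigma> z = 1\<close> \<kappa> unfolding lin_def dist_real_def by (simp add: abs_if split: if_splits)
  next
    assume "norm (w z) = r"
    then have "M * (w z \<bullet> w z) = D" using M(2) by (simp add: dot_square_norm)
    then show False using D(2)[OF zC] z(2) \<kappa> by (simp add: G_def T_def)
  qed
qed

section \<open>Partial Legendre transforms of degenerate convex functions\<close>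

text \<open>
  The bound is used at the point of the ball around \<open>p\<close> that is farthest in the direction \<open>y\<close>.
\<close>

lemma coercive_of_support_bound:
  fixes p :: "'a::euclidean_space"
  assumes "cball p \<delta> \<subseteq> S" "\<delta> \<ge> 0" and bound: "\<And>q. q \<in> S \<Longrightarrow> q \<bullet> y \<le> v + C"
  shows "\<delta> * norm y \<le> v - p \<bullet> y + C"
proof (cases "y = 0")
  case True
  moreover have "p \<in> S" using assms(1,2) by auto
  ultimately show ?thesis using bound[of p] by auto
next
  case False
  define q where "q = p + (\<delta> / norm y) *\<^sub>R y"
  have "q \<in> S" using assms(1,2) False by (auto simp: q_def dist_norm)
  moreover have "q \<bullet> y = p \<bullet> y + \<delta> * norm y"
    using False by (simp add: q_def inner_add_left dot_square_norm power2_eq_square)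
  ultimately show ?thesis using bound[of q] by simp
qed

lemma gradient_lipschitz_on_linear: "gradient_lipschitz_on W (\<lambda>y. p \<bullet> y)"
  by (rule gradient_lipschitz_onI_differentiable[of _ _ "\<lambda>_. p"])
     (auto simp: gderiv_def inner_commute intro!: derivative_eq_intros)

lemma convex_on_closed_halfspace:
  fixes \<Phi> :: "'a::euclidean_space \<times> real \<Rightarrow> real"
  assumes cont: "continuous_on {Y. 0 \<le> snd Y} \<Phi>" and conv: "convex_on {Y. 0 < snd Y} \<Phi>"
    and s: "0 \<le> s" "s \<le> 1" and Y: "0 \<le> snd Y" "0 < snd Z"
  shows "\<Phi> ((1 - s) *\<^sub>R Y + s *\<^sub>R Z) \<le> (1 - s) * \<Phi> Y + s * \<Phi> Z"
proof -
  define g where "g = (\<lambda>e. \<Phi> ((1 - s) *\<^sub>R (Y + (0, e)) + s *\<^sub>R Z) - ((1 - s) * \<Phi> (Y + (0, e)) + s * \<Phi> Z))"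
  have mem: "0 \<le> (1 - s) * (snd Y + e) + s * snd Z" "0 \<le> snd Y + e" if "0 \<le> e" for e
    using that s Y by (auto intro!: add_nonneg_nonneg mult_nonneg_nonneg)
  have "continuous_on {0..} g" unfolding g_def
    by (intro continuous_intros continuous_on_compose2[OF cont]) (auto simp: mem)
  moreover have "g e \<le> 0" if "e \<in> {0<..}" for e
  proof -
    have "Y + (0, e) \<in> {Y. 0 < snd Y}" "Z \<in> {Y. 0 < snd Y}" using that Y by auto
    then show ?thesis using convex_onD[OF conv, of s "Y + (0, e)" Z] s by (simp add: g_def)
  qed
  ultimately have "g 0 \<le> 0"
    using continuous_le_on_closure[of "{0<..}" g 0 0] by (simp add: closure_greaterThan)
  then show ?thesis by (simp add: g_def zero_prod_def[symmetric])
qed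

text \<open>
  What remains of the geometric problem in logarithmic coordinates \<open>Y = (y, t)\<close>, \<open>t \<ge> 0\<close>: the function
  \<open>\<Phi>\<close> is at distance at most \<open>C\<close> from the support function of \<open>Q\<close>, and outside the null set \<open>N\<close> its
  Hessian is positive semidefinite with nontrivial kernel.
\<close>

locale degenerate_potential =
  fixes P :: "'a::euclidean_space set" and f :: "'a \<Rightarrow> real" and K :: real and Q
    and \<Phi> :: "'a \<times> real \<Rightarrow> real" and N C
  assumes Q_eq: "Q = hat_polytope P f K" and convex_Q: "convex Q"
    and cont_f: "continuous_on P f" and f_less: "\<And>x. x \<in> P \<Longrightarrow> f x < K"
    and cont: "continuous_on {Y. 0 \<le> snd Y} \<Phi>"
    and C11: "gradient_lipschitz_on {Y. 0 < snd Y} \<Phi>"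
    and negl: "negligible N"
    and nonneg: "\<And>Y \<eta>. 0 < snd Y \<Longrightarrow> Y \<notin> N \<Longrightarrow> \<exists>q\<ge>0. has_second_deriv (\<lambda>s. \<Phi> (Y + s *\<^sub>R \<eta>)) q"
    and null: "\<And>Y. 0 < snd Y \<Longrightarrow> Y \<notin> N \<Longrightarrow> \<exists>\<eta>. \<eta> \<noteq> 0 \<and> has_second_deriv (\<lambda>s. \<Phi> (Y + s *\<^sub>R \<eta>)) 0"
    and lower: "\<And>Y p. 0 \<le> snd Y \<Longrightarrow> p \<in> Q \<Longrightarrow> p \<bullet> Y \<le> \<Phi> Y + C"
    and upper: "\<And>Y. 0 \<le> snd Y \<Longrightarrow> \<exists>p\<in>Q. \<Phi> Y \<le> p \<bullet> Y + C"
begin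

text \<open>
  Up to sign the Legendre transform of \<open>\<Phi>\<close> in the variable \<open>y\<close>, evaluated at \<open>x\<close>.
\<close>

definition slice_min :: "'a \<Rightarrow> real \<Rightarrow> real" where
  "slice_min x t = (INF y. \<Phi> (y, t) - x \<bullet> y)"

lemma slice_min_attained:
  assumes x: "x \<in> interior P" and t: "0 \<le> t"
  obtains y where "\<Phi> (y, t) - x \<bullet> y = slice_min x t" "\<forall>y'. slice_min x t \<le> \<Phi> (y', t) - x \<bullet> y'"
proof -
  obtain \<delta> where \<delta>: "\<delta> > 0" "cball x \<delta> \<subseteq> P" using x by (meson mem_interior_cball)
  have coer: "\<delta> * norm y \<le> \<Phi> (y, t) - x \<bullet> y + C" for y
  proof (rule coercive_of_support_bound[OF \<delta>(2)])
    show "\<delta> \<ge> 0" using \<delta>(1) by simp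
    fix d assume "d \<in> P"
    then have "(d, 0) \<in> Q" using f_less[of d] by (simp add: Q_eq hat_polytope_def)
    then show "d \<bullet> y \<le> \<Phi> (y, t) + C" using lower[of "(y, t)" "(d, 0)"] t by simp
  qed
  define R where "R = (\<bar>\<Phi> (0, t)\<bar> + \<bar>C\<bar>) / \<delta>"
  have R: "0 \<le> R" "\<delta> * R = \<bar>\<Phi> (0, t)\<bar> + \<bar>C\<bar>" using \<delta>(1) by (auto simp: R_def)
  have "continuous_on (cball 0 R) (\<lambda>y. \<Phi> (y, t) - x \<bullet> y)"
    by (intro continuous_intros continuous_on_compose2[OF cont]) (use t in auto)
  then obtain y where y: "\<forall>y'\<in>cball 0 R. \<Phi> (y, t) - x \<bullet> y \<le> \<Phi> (y', t) - x \<bullet> y'"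
    using continuous_attains_inf[OF compact_cball, of 0 R "\<lambda>y. \<Phi> (y, t) - x \<bullet> y"] R(1) by auto
  have min: "\<Phi> (y, t) - x \<bullet> y \<le> \<Phi> (y', t) - x \<bullet> y'" for y'
  proof (cases "y' \<in> cball 0 R")
    case False
    then have "\<delta> * R \<le> \<delta> * norm y'" using \<delta>(1) by auto
    then have "\<Phi> (0, t) \<le> \<Phi> (y', t) - x \<bullet> y'" using coer[of y'] R(2) by linarith
    moreover have "\<Phi> (y, t) - x \<bullet> y \<le> \<Phi> (0, t)" using y R(1) by (auto dest: bspec[of _ _ 0])
    ultimately show ?thesis by linarith
  qed (use y in auto)
  then have "slice_min x t = \<Phi> (y, t) - x \<bullet> y"
    unfolding slice_min_def by (intro cInf_eq_minimum) auto
  then show ?thesis using that[of y] min by simp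
qed

lemma slice_min_le:
  assumes "x \<in> interior P" "0 \<le> t"
  shows "slice_min x t \<le> \<Phi> (y, t) - x \<bullet> y"
  using slice_min_attained[OF assms] by metis

lemma interior_Q:
  assumes x: "x \<in> interior P" and c: "0 < c" "c < K - f x"
  shows "(x, c) \<in> interior Q"
proof -
  let ?h = "\<lambda>z. (snd z, K - f (fst z) - snd z)"
  let ?O = "(interior P \<times> (UNIV::real set)) \<inter> ?h -` ({0<..} \<times> {0<..})"
  have "open ?O"
    by (intro continuous_open_preimage open_Times continuous_intros
        continuous_on_compose2[OF continuous_on_subset[OF cont_f interior_subset]]) auto
  moreover have "?O \<subseteq> Q" using interior_subset by (fastforce simp: Q_eq hat_polytope_def)
  moreover have "(x, c) \<in> ?O" using x c by simp
  ultimately show ?thesis by (meson interiorI)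
qed

text \<open>
  By duality the support function of \<open>Q\<close> at height \<open>t\<close>, minus \<open>x \<bullet> y\<close>, has minimum \<open>t (K - f x)\<close>: it is
  attained at the multiple \<open>(y, t)\<close> of the normal of a hyperplane that supports \<open>Q\<close> at its boundary point
  \<open>(x, K - f x)\<close>.
\<close>

lemma slice_min_growth:
  assumes x: "x \<in> interior P" and t: "0 \<le> t"
  shows "slice_min x t \<le> t * (K - f x) + C"
proof -
  have xP: "x \<in> P" using x interior_subset by blast
  define p where "p = (x, K - f x)"
  have pQ: "p \<in> Q" using xP f_less[OF xP] by (simp add: p_def Q_eq hat_polytope_def)
  define q where "q = (x, (K - f x) / 2)"
  have q: "q \<in> interior Q" unfolding q_def using f_less[OF xP] by (intro interior_Q x) auto
  have "p \<notin> interior Q"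
  proof
    assume "p \<in> interior Q"
    then obtain e where e: "e > 0" "ball p e \<subseteq> Q" by (meson mem_interior)
    then have "p + (0, e / 2) \<in> Q" by (auto simp: dist_norm norm_Pair)
    then show False using e(1) by (simp add: p_def Q_eq hat_polytope_def)
  qed
  have relint: "rel_interior Q = interior Q" using q by (intro rel_interior_nonempty_interior) auto
  then have prel: "p \<notin> rel_interior Q" using \<open>p \<notin> interior Q\<close> by simp
  have "\<exists>n. (\<forall>z\<in>Q. n \<bullet> p \<le> n \<bullet> z) \<and> (\<forall>z\<in>rel_interior Q. n \<bullet> p < n \<bullet> z)"
    by (rule supporting_hyperplane_rel_boundary[OF convex_Q pQ prel]) blast
  then obtain n where n: "\<forall>z\<in>Q. n \<bullet> p \<le> n \<bullet> z" "\<forall>z\<in>rel_interior Q. n \<bullet> p < n \<bullet> z"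
    by (elim exE conjE)
  obtain a b where ab: "n = (a, b)" by (cases n)
  have "n \<bullet> p < n \<bullet> q" using n(2) q relint by simp
  then have "b * (K - f x) < b * ((K - f x) / 2)" by (simp add: p_def q_def ab)
  then have b: "b < 0" using f_less[OF xP] by (auto simp: mult_less_0_iff)
  define y where "y = (t / b) *\<^sub>R a"
  have tb: "(y, t) = (t / b) *\<^sub>R n" using b by (simp add: y_def ab)
  obtain z where z: "z \<in> Q" "\<Phi> (y, t) \<le> z \<bullet> (y, t) + C" using upper[of "(y, t)"] t by auto
  have "n \<bullet> p \<le> n \<bullet> z" using n(1) z(1) by blast
  then have "(t / b) * (n \<bullet> z) \<le> (t / b) * (n \<bullet> p)"
    using b t by (intro mult_left_mono_neg) (auto simp: divide_nonneg_neg)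
  then have "z \<bullet> (y, t) \<le> p \<bullet> (y, t)" unfolding tb by (simp add: inner_commute)
  also have "p \<bullet> (y, t) = x \<bullet> y + t * (K - f x)" by (simp add: p_def)
  finally show ?thesis using z(2) slice_min_le[OF x t, of y] by linarith
qed

text \<open>
  For \<open>c\<close> just below \<open>K - f x\<close> the function \<open>\<Phi>(Y) - (x, c) \<bullet> Y\<close> grows linearly on the half space, as \<open>(x, c)\<close>
  is interior to \<open>Q\<close>.  The minimum principle on a large half ball moves its minimum to \<open>t = 0\<close>.
\<close>

lemma slice_min_ge_affine:
  assumes x: "x \<in> interior P" and t: "0 \<le> t"
  shows "slice_min x 0 + t * (K - f x) \<le> slice_min x t"
proof (rule ccontr)
  assume not: "\<not> ?thesis"
  then have t0: "t > 0" using t by (cases "t = 0") auto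
  have xP: "x \<in> P" using x interior_subset by blast
  \<comment> \<open>The number \<open>c\<close> lies strictly between the average slope \<open>\<mu>\<close> and \<open>K - f x\<close>, and is positive.\<close>
  define \<mu> where "\<mu> = (slice_min x t - slice_min x 0) / t"
  define c where "c = (max 0 \<mu> + (K - f x)) / 2"
  have "\<mu> < K - f x"
  proof -
    have "slice_min x t - slice_min x 0 < (K - f x) * t" using not by (simp add: mult.commute)
    then show ?thesis using t0 by (simp add: \<mu>_def pos_divide_less_eq)
  qed
  then have c: "0 < c" "c < K - f x" "\<mu> < c"
    using f_less[OF xP] by (auto simp: c_def max_def)
  then have c': "slice_min x t - c * t < slice_min x 0" using t0 by (simp add: \<mu>_def field_simps)
  obtain \<delta> where \<delta>: "\<delta> > 0" "cball (x, c) \<delta> \<subseteq> Q"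
    using interior_Q[OF x c(1,2)] by (meson mem_interior_cball)
  obtain y where y: "\<Phi> (y, t) - x \<bullet> y = slice_min x t" using slice_min_attained[OF x t] by metis
  define R where "R = norm (y, t) + (\<bar>slice_min x 0\<bar> + \<bar>C\<bar>) / \<delta>"
  define D where "D = cball 0 R \<inter> {Y :: 'a \<times> real. 0 \<le> (0, 1) \<bullet> Y}"
  define n where "n = - (x, c)"
  define G where "G = (\<lambda>Y. \<Phi> Y + n \<bullet> Y)"
  have D_iff: "Y \<in> D \<longleftrightarrow> norm Y \<le> R \<and> 0 \<le> snd Y" for Y by (cases Y) (simp add: D_def)
  have "compact D" unfolding D_def by (rule compact_Int_closed[OF compact_cball closed_halfspace_ge])
  have intD: "interior D \<subseteq> {Y. 0 < snd Y}"
  proof -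
    have "interior D \<subseteq> interior {Y. (0, 1::real) \<bullet> Y \<ge> 0}" unfolding D_def by (intro interior_mono) auto
    also have "\<dots> = {Y. (0, 1::real) \<bullet> Y > 0}" by (rule interior_halfspace_ge) (simp add: zero_prod_def)
    finally show ?thesis by auto
  qed
  have "\<exists>Y\<in>frontier D. G Y \<le> G (y, t)"
  proof (rule min_attained_on_frontier[OF \<open>compact D\<close> _ _ negl])
    show "continuous_on D G" unfolding G_def
      by (intro continuous_intros continuous_on_subset[OF cont]) (auto simp: D_iff)
    show "gradient_lipschitz_on (interior D) G"
      unfolding G_def
    proof (intro gradient_lipschitz_on_add)
      show "gradient_lipschitz_on (interior D) \<Phi>" using C11 intD by (rule gradient_lipschitz_on_subset)
      show "gradient_lipschitz_on (interior D) (\<lambda>Y. n \<bullet> Y)"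
        by (rule gradient_lipschitz_on_linear)
    qed
    show "\<exists>\<eta> q. \<eta> \<noteq> 0 \<and> q \<le> 0 \<and> has_second_deriv (\<lambda>s. G (Y + s *\<^sub>R \<eta>)) q"
      if "Y \<in> interior D" "Y \<notin> N" for Y
    proof -
      have "0 < snd Y" using that(1) intD by auto
      from null[OF this that(2)] obtain \<eta> where \<eta>: "\<eta> \<noteq> 0" "has_second_deriv (\<lambda>s. \<Phi> (Y + s *\<^sub>R \<eta>)) 0"
        by (elim exE conjE)
      have "G (Y + s *\<^sub>R \<eta>) = \<Phi> (Y + s *\<^sub>R \<eta>) + (n \<bullet> Y + (n \<bullet> \<eta>) * s + 0 * s\<^sup>2)" for s
        by (simp add: G_def inner_add_right)
      then have "has_second_deriv (\<lambda>s. G (Y + s *\<^sub>R \<eta>)) (0 + 2 * 0)"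
        by (simp only:) (intro has_second_deriv_add \<eta>(2) has_second_deriv_quadratic)
      then show ?thesis using \<eta>(1) by (intro exI[of _ \<eta>] exI[of _ "0 + 2 * 0"]) auto
    qed
    show "(y, t) \<in> D" using t \<delta>(1) by (simp add: D_iff R_def)
  qed
  then obtain Y where Y: "Y \<in> frontier D" "G Y \<le> G (y, t)" by blast
  have Gyt: "G (y, t) = slice_min x t - c * t" using y by (simp add: G_def n_def)
  have YD: "Y \<in> D" using Y(1) \<open>compact D\<close> by (meson compact_imp_closed frontier_subset_closed subsetD)
  have "norm Y = R \<or> snd Y = 0"
  proof (rule ccontr)
    assume "\<not> ?thesis"
    then have mem: "Y \<in> ball 0 R \<inter> {Y. (0, 1::real) \<bullet> Y > 0}" (is "_ \<in> ?O") using YD by (cases Y) (auto simp: D_iff)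
    have "open ?O" by (intro open_Int open_ball open_halfspace_gt)
    moreover have "?O \<subseteq> D" by (auto simp: D_iff)
    ultimately have "Y \<in> interior D" using mem by (meson interiorI)
    then show False using Y(1) by (simp add: frontier_def)
  qed
  then show False
  proof
    assume R: "norm Y = R"
    have "\<delta> * norm Y \<le> \<Phi> Y - (x, c) \<bullet> Y + C"
      by (rule coercive_of_support_bound[OF \<delta>(2)]) (use \<delta>(1) YD lower in \<open>auto simp: D_iff\<close>)
    moreover have "\<delta> * R \<ge> \<bar>slice_min x 0\<bar> + \<bar>C\<bar>"
    proof -
      have "\<delta> * R = \<delta> * norm (y, t) + (\<bar>slice_min x 0\<bar> + \<bar>C\<bar>)"
        using \<delta>(1) by (simp add: R_def field_simps)
      moreover have "0 \<le> \<delta> * norm (y, t)" using \<delta>(1) by simp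
      ultimately show ?thesis by linarith
    qed
    moreover have "\<delta> * norm Y = \<delta> * R" using R by simp
    ultimately have "slice_min x 0 \<le> G Y" unfolding G_def n_def inner_minus_left by linarith
    then show False using Y(2) Gyt c' by simp
  next
    assume "snd Y = 0"
    then obtain y' where "Y = (y', 0)" by (cases Y) auto
    then have "slice_min x 0 \<le> G Y" using slice_min_le[OF x, of 0 y'] by (simp add: G_def n_def)
    then show False using Y(2) Gyt c' by simp
  qed
qed

text \<open>
  \<open>slice_min x\<close> is convex, being the partial minimum of a jointly convex function, and grows at most
  with slope \<open>K - f x\<close>.
\<close>

lemma slice_min_le_affine:
  assumes x: "x \<in> interior P" and t: "0 \<le> t"
  shows "slice_min x t \<le> slice_min x 0 + t * (K - f x)"
proof (rule ccontr)
  assume not: "\<not> ?thesis"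
  then have t0: "t > 0" using t by (cases "t = 0") auto
  have "convex {Y :: 'a \<times> real. 0 < snd Y}" "open {Y :: 'a \<times> real. 0 < snd Y}"
  proof -
    have "{Y :: 'a \<times> real. 0 < snd Y} = {Y. (0, 1::real) \<bullet> Y > 0}" by auto
    then show "convex {Y :: 'a \<times> real. 0 < snd Y}" "open {Y :: 'a \<times> real. 0 < snd Y}"
      by (auto simp only: convex_halfspace_gt open_halfspace_gt)
  qed
  then have conv: "convex_on {Y. 0 < snd Y} \<Phi>"
    by (intro convex_on_if_second_deriv_nonneg[OF _ _ C11 negl]) (use nonneg in auto)
  define \<kappa> where "\<kappa> = slice_min x t - (slice_min x 0 + t * (K - f x))"
  have \<kappa>: "\<kappa> > 0" using not by (simp add: \<kappa>_def)
  \<comment> \<open>So large that interpolating between heights \<open>0\<close> and \<open>T\<close> costs less than \<open>\<kappa>\<close> at height \<open>t\<close>.\<close>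
  define T where "T = t * (1 + \<bar>C - slice_min x 0\<bar> / \<kappa>)"
  have T: "T \<ge> t" using t0 \<kappa> by (simp add: T_def)
  have T0: "T > 0" using T t0 by simp
  define s where "s = t / T"
  have s: "0 < s" "s \<le> 1" "s * T = t" using T t0 by (auto simp: s_def)
  have sC: "s * (C - slice_min x 0) < \<kappa>"
  proof -
    have "t * (C - slice_min x 0) \<le> t * \<bar>C - slice_min x 0\<bar>" using t0 by (intro mult_left_mono) auto
    also have "\<dots> < t * \<kappa> + t * \<bar>C - slice_min x 0\<bar>" using t0 \<kappa> by simp
    also have "\<dots> = \<kappa> * T" using \<kappa> by (simp add: T_def field_simps)
    finally have "t * (C - slice_min x 0) < \<kappa> * T" .
    then show ?thesis using T0 by (simp add: s_def field_simps)
  qed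
  obtain y0 where y0: "\<Phi> (y0, 0) - x \<bullet> y0 = slice_min x 0" using slice_min_attained[OF x, of 0] by auto
  obtain y1 where y1: "\<Phi> (y1, T) - x \<bullet> y1 = slice_min x T" using slice_min_attained[OF x, of T] T0 by auto
  have "\<Phi> ((1 - s) *\<^sub>R (y0, 0) + s *\<^sub>R (y1, T)) \<le> (1 - s) * \<Phi> (y0, 0) + s * \<Phi> (y1, T)"
    by (rule convex_on_closed_halfspace[OF cont conv]) (use s T0 in auto)
  then have "\<Phi> ((1 - s) *\<^sub>R y0 + s *\<^sub>R y1, t) - x \<bullet> ((1 - s) *\<^sub>R y0 + s *\<^sub>R y1)
      \<le> (1 - s) * (\<Phi> (y0, 0) - x \<bullet> y0) + s * (\<Phi> (y1, T) - x \<bullet> y1)"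
    using s(3) by (simp add: inner_add_right algebra_simps)
  then have "slice_min x t \<le> (1 - s) * slice_min x 0 + s * slice_min x T"
    unfolding y0 y1 using slice_min_le[OF x t] order_trans by blast
  also have "\<dots> \<le> (1 - s) * slice_min x 0 + s * (T * (K - f x) + C)"
    using slice_min_growth[OF x, of T] T0 s(1) by (intro add_left_mono mult_left_mono) auto
  also have "\<dots> = slice_min x 0 + t * (K - f x) + s * (C - slice_min x 0)"
    using s(3) by (simp add: algebra_simps)
  finally show False using sC by (simp add: \<kappa>_def)
qed

theorem slice_min_affine:
  assumes "x \<in> interior P" "0 \<le> t"
  shows "slice_min x t = slice_min x 0 + t * (K - f x)"
  using slice_min_ge_affine[OF assms] slice_min_le_affine[OF assms] by simp

end

section \<open>Charts at the vertices of a Delzant polytope\<close>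

lemma lattice_diff: "x \<in> lattice \<Longrightarrow> y \<in> lattice \<Longrightarrow> x - y \<in> lattice"
  by (auto simp: lattice_def inner_diff_left)

lemma lattice_Pair_iff: "(d, k) \<in> lattice \<longleftrightarrow> d \<in> lattice \<and> (k::real) \<in> \<int>"
  by (auto simp: lattice_def Basis_prod_def)

lemma finite_lattice_points:
  assumes "bounded P"
  shows "finite (lattice_points P)"
proof -
  obtain B where B: "\<And>x. x \<in> P \<Longrightarrow> norm x \<le> B" using assms unfolding bounded_iff by blast
  let ?g = "\<lambda>x. \<lambda>b\<in>Basis. \<lfloor>x \<bullet> b\<rfloor>"
  have "inj_on ?g (lattice_points P)"
  proof (rule inj_onI)
    fix x y assume x: "x \<in> lattice_points P" and y: "y \<in> lattice_points P" and eq: "?g x = ?g y"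
    show "x = y"
    proof (rule euclidean_eqI)
      fix b :: 'a assume b: "b \<in> Basis"
      have "\<lfloor>x \<bullet> b\<rfloor> = \<lfloor>y \<bullet> b\<rfloor>" using fun_cong[OF eq, of b] b by simp
      moreover have "x \<bullet> b \<in> \<int>" "y \<bullet> b \<in> \<int>" using x y b by (auto simp: lattice_points_def lattice_def)
      ultimately show "x \<bullet> b = y \<bullet> b" by (metis of_int_floor)
    qed
  qed
  moreover have "?g ` lattice_points P \<subseteq> (\<Pi>\<^sub>E b\<in>Basis. {-\<lceil>B\<rceil> - 1..\<lceil>B\<rceil> + 1})"
  proof (clarsimp simp: lattice_points_def)
    fix x b assume x: "x \<in> P" and b: "b \<in> (Basis::'a set)"
    have "\<bar>x \<bullet> b\<bar> \<le> B" using Basis_le_norm[OF b, of x] B[OF x] by linarith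
    then show "- \<lceil>B\<rceil> - 1 \<le> \<lfloor>x \<bullet> b\<rfloor> \<and> \<lfloor>x \<bullet> b\<rfloor> \<le> \<lceil>B\<rceil> + 1"
      by linarith
  qed
  ultimately show ?thesis
    by (meson finite_PiE finite_Basis finite_atLeastAtMost_int finite_imageD finite_subset)
qed

lemma proj_class_cmult:
  assumes "a \<noteq> 0"
  shows "proj_class (\<lambda>p. a * s p) = proj_class s"
proof -
  have "\<exists>c'. c' \<noteq> 0 \<and> (\<lambda>p. c * s p) = (\<lambda>p. c' * (a * s p))" if "c \<noteq> 0" for c
    using that assms by (intro exI[of _ "c / a"]) (auto simp: fun_eq_iff)
  moreover have "\<exists>c'. c' \<noteq> 0 \<and> (\<lambda>p. c * (a * s p)) = (\<lambda>p. c' * s p)" if "c \<noteq> 0" for c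
    using that assms by (intro exI[of _ "c * a"]) (auto simp: fun_eq_iff)
  ultimately show ?thesis unfolding proj_class_def by blast
qed

lemma self_in_proj_class: "s \<in> proj_class s"
  by (auto simp: proj_class_def intro!: exI[of _ 1])

lemma small_multiple:
  fixes r n :: real
  assumes "r > 0" "n \<ge> 0"
  shows "r / (2 * (n + 1)) * n < r"
proof -
  have "n / (2 * (n + 1)) < 1" using assms by (simp add: divide_less_eq)
  then have "r * (n / (2 * (n + 1))) < r * 1" using assms(1) by (rule mult_strict_left_mono)
  then show ?thesis by simp
qed

locale vertex_chart =
  fixes Q :: "'a::euclidean_space set" and v :: 'a and u :: "'m::finite \<Rightarrow> 'a"
  assumes polytope_Q: "polytope Q" and v_lattice: "v \<in> lattice" and frame: "chart_frame Q v u"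
begin

lemma inj_u: "inj u" and extreme_v: "v extreme_point_of Q" and lattice_basis_u: "lattice_basis (range u)"
  using frame by (auto simp: chart_frame_def delzant_frame_def)

lemma v_in_Q: "v \<in> Q" using extreme_v by (simp add: extreme_point_of_def)

lemma independent_u: "independent (range u)"
  using lattice_basis_u by (simp add: lattice_basis_def)

lemma sum_range_u: "(\<Sum>a\<in>range u. c a *\<^sub>R a) = (\<Sum>i\<in>UNIV. c (u i) *\<^sub>R u i)"
  by (subst sum.reindex[OF inj_u]) simp

lemma lattice_coordinates:
  assumes "x \<in> lattice"
  obtains c :: "'m \<Rightarrow> int" where "x = (\<Sum>i\<in>UNIV. of_int (c i) *\<^sub>R u i)"
proof -
  obtain c :: "'a \<Rightarrow> int" where "x = (\<Sum>a\<in>range u. of_int (c a) *\<^sub>R a)"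
    using lattice_basis_u assms unfolding lattice_basis_def by blast
  then show ?thesis using that[of "\<lambda>i. c (u i)"] sum_range_u[of "\<lambda>a. of_int (c a)"] by simp
qed

lemma span_u: "span (range u) = UNIV"
proof -
  have "b \<in> span (range u)" if "b \<in> Basis" for b
  proof -
    have "b \<in> lattice" using that by (auto simp: lattice_def inner_Basis)
    then obtain c :: "'m \<Rightarrow> int" where "b = (\<Sum>i\<in>UNIV. of_int (c i) *\<^sub>R u i)" by (rule lattice_coordinates)
    then show ?thesis by (simp add: span_sum span_scale span_base)
  qed
  then show ?thesis by (metis span_Basis span_minimal subsetI subspace_span top.extremum_uniqueI)
qed

lemma card_eq_DIM: "CARD('m) = DIM('a)"
proof -
  have "dim (UNIV :: 'a set) = card (range u)"
    by (metis dim_span dim_eq_card_independent independent_u span_u)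
  then show ?thesis using card_image[OF inj_u] by simp
qed

lemma coordinates_unique:
  fixes a b :: "'m \<Rightarrow> real"
  assumes "(\<Sum>i\<in>UNIV. a i *\<^sub>R u i) = (\<Sum>i\<in>UNIV. b i *\<^sub>R u i)"
  shows "a = b"
proof
  fix i
  define c where "c = (\<lambda>x. a (inv u x) - b (inv u x))"
  have "(\<Sum>x\<in>range u. c x *\<^sub>R x) = (\<Sum>i\<in>UNIV. (a i - b i) *\<^sub>R u i)"
    unfolding sum_range_u by (simp add: c_def inj_u)
  also have "\<dots> = 0" using assms by (simp add: scaleR_left_diff_distrib sum_subtractf)
  finally have "c (u i) = 0" using independentD[OF independent_u _ order_refl, of c "u i"] by simp
  then show "a i = b i" by (simp add: c_def inj_u)
qed

lemma cone_near_vertex: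
  obtains r where "r > 0" and
    "\<forall>x\<in>ball v r. x \<in> Q \<longleftrightarrow> (\<exists>c::'m \<Rightarrow> real. (\<forall>i. 0 \<le> c i) \<and> x = v + (\<Sum>i\<in>UNIV. c i *\<^sub>R u i))"
proof -
  obtain r where r: "r > 0" "Q \<inter> ball v r =
      {v + (\<Sum>a\<in>range u. c a *\<^sub>R a) | c :: 'a \<Rightarrow> real. \<forall>a\<in>range u. 0 \<le> c a} \<inter> ball v r"
    using frame by (auto simp: chart_frame_def delzant_frame_def)
  have "x \<in> Q \<longleftrightarrow> (\<exists>c::'m \<Rightarrow> real. (\<forall>i. 0 \<le> c i) \<and> x = v + (\<Sum>i\<in>UNIV. c i *\<^sub>R u i))" if x: "x \<in> ball v r" for x
  proof
    assume "x \<in> Q"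
    then obtain c :: "'a \<Rightarrow> real" where "\<forall>a\<in>range u. 0 \<le> c a" "x = v + (\<Sum>a\<in>range u. c a *\<^sub>R a)"
      using r(2) x by blast
    then show "\<exists>c::'m \<Rightarrow> real. (\<forall>i. 0 \<le> c i) \<and> x = v + (\<Sum>i\<in>UNIV. c i *\<^sub>R u i)"
      by (intro exI[of _ "\<lambda>i. c (u i)"]) (auto simp: sum_range_u)
  next
    assume "\<exists>c::'m \<Rightarrow> real. (\<forall>i. 0 \<le> c i) \<and> x = v + (\<Sum>i\<in>UNIV. c i *\<^sub>R u i)"
    then obtain c :: "'m \<Rightarrow> real" where c: "\<forall>i. 0 \<le> c i" "x = v + (\<Sum>i\<in>UNIV. c i *\<^sub>R u i)" by blast
    have "x = v + (\<Sum>a\<in>range u. c (inv u a) *\<^sub>R a)" using c(2) by (simp add: sum_range_u inj_u)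
    then have "x \<in> {v + (\<Sum>a\<in>range u. c a *\<^sub>R a) | c :: 'a \<Rightarrow> real. \<forall>a\<in>range u. 0 \<le> c a} \<inter> ball v r"
      using c(1) x by (intro IntI CollectI exI[of _ "\<lambda>a. c (inv u a)"]) auto
    then show "x \<in> Q" using r(2) by blast
  qed
  then show ?thesis using that r(1) by blast
qed

text \<open>
  The coordinates of \<open>p - v\<close> in the lattice basis are integers.  They are nonnegative because a short
  segment from \<open>v\<close> towards \<open>p\<close> stays in the cone at \<open>v\<close>.
\<close>

lemma exponents_exist:
  assumes p: "p \<in> lattice_points Q"
  shows "\<exists>m :: 'm \<Rightarrow> nat. p = v + (\<Sum>i\<in>UNIV. real (m i) *\<^sub>R u i)"
proof -
  have pQ: "p \<in> Q" and "p - v \<in> lattice" using p v_lattice by (auto simp: lattice_points_def lattice_diff)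
  then obtain c :: "'m \<Rightarrow> int" where c: "p - v = (\<Sum>i\<in>UNIV. of_int (c i) *\<^sub>R u i)"
    using lattice_coordinates by blast
  obtain r where r: "r > 0"
    "\<forall>x\<in>ball v r. x \<in> Q \<longleftrightarrow> (\<exists>c::'m \<Rightarrow> real. (\<forall>i. 0 \<le> c i) \<and> x = v + (\<Sum>i\<in>UNIV. c i *\<^sub>R u i))"
    by (rule cone_near_vertex)
  define e where "e = min 1 (r / (2 * (norm (p - v) + 1)))"
  have e: "0 < e" "e \<le> 1" using r(1) by (auto simp: e_def add_nonneg_pos)
  have "e * norm (p - v) < r"
  proof -
    have "e * norm (p - v) \<le> (r / (2 * (norm (p - v) + 1))) * norm (p - v)"
      by (intro mult_right_mono) (auto simp: e_def)
    also have "\<dots> < r" by (intro small_multiple r(1)) simp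
    finally show ?thesis .
  qed
  then have ball: "v + e *\<^sub>R (p - v) \<in> ball v r" using e by (simp add: dist_norm)
  have "v + e *\<^sub>R (p - v) = (1 - e) *\<^sub>R v + e *\<^sub>R p" by (simp add: algebra_simps)
  moreover have "(1 - e) *\<^sub>R v + e *\<^sub>R p \<in> Q"
    using e by (intro convexD_alt polytope_imp_convex polytope_Q v_in_Q pQ) auto
  ultimately obtain c' :: "'m \<Rightarrow> real" where c': "\<forall>i. 0 \<le> c' i" "e *\<^sub>R (p - v) = (\<Sum>i\<in>UNIV. c' i *\<^sub>R u i)"
    using bspec[OF r(2) ball] by auto
  have "(\<lambda>i. e * of_int (c i)) = c'"
    using c'(2) unfolding c by (intro coordinates_unique) (simp add: scaleR_sum_right)
  then have "0 \<le> e * of_int (c i)" for i using c'(1) by (auto simp: fun_eq_iff)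
  then have "0 \<le> c i" for i using e(1) by (simp add: zero_le_mult_iff)
  then show ?thesis using c by (intro exI[of _ "\<lambda>i. nat (c i)"]) (simp add: algebra_simps)
qed

lemma chart_exponent_eqI:
  assumes "p = v + (\<Sum>i\<in>UNIV. real (m i) *\<^sub>R u i)"
  shows "chart_exponent v u p = m"
  unfolding chart_exponent_def
proof (rule the_equality)
  show "p = v + (\<Sum>i\<in>UNIV. real (m i) *\<^sub>R u i)" by fact
  fix m' assume "p = v + (\<Sum>i\<in>UNIV. real (m' i) *\<^sub>R u i)"
  then have "(\<lambda>i. real (m' i)) = (\<lambda>i. real (m i))" using assms by (intro coordinates_unique) simp
  then show "m' = m" by (simp add: fun_eq_iff)
qed

lemma chart_exponent:
  assumes "p \<in> lattice_points Q"
  shows "p = v + (\<Sum>i\<in>UNIV. real (chart_exponent v u p i) *\<^sub>R u i)"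
  using exponents_exist[OF assms] chart_exponent_eqI by metis

definition coords :: "'a \<Rightarrow> real ^ 'm" where "coords y = (\<chi> i. u i \<bullet> y)"

lemma linear_coords: "linear coords"
  by (rule linearI) (auto simp: coords_def vec_eq_iff inner_add_right)

lemma inj_coords: "inj coords"
proof (rule linear_injective_0[THEN iffD2, OF linear_coords, rule_format])
  fix y assume "coords y = 0"
  then have "u i \<bullet> y = 0" for i by (simp add: coords_def vec_eq_iff)
  then have "range u \<subseteq> {x. x \<bullet> y = 0}" by auto
  moreover have "subspace {x. x \<bullet> y = 0}" by (simp add: subspace_def inner_add_left)
  ultimately have "span (range u) \<subseteq> {x. x \<bullet> y = 0}" by (rule span_minimal)
  then have "y \<in> {x. x \<bullet> y = 0}" unfolding span_u by blast
  then show "y = 0" by simp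
qed

lemma surj_coords: "surj coords"
proof -
  have "dim (range coords) = DIM('a)"
    using dim_image_eq[OF linear_coords, of UNIV] inj_coords by simp
  then have "dim (range coords) = DIM(real ^ 'm)" using card_eq_DIM by simp
  then show ?thesis
    using linear_subspace_image[OF linear_coords subspace_UNIV] by (metis dim_eq_full span_eq_iff)
qed

definition uncoords :: "real ^ 'm \<Rightarrow> 'a" where "uncoords = inv coords"

lemma uncoords_coords [simp]: "uncoords (coords y) = y"
  by (simp add: uncoords_def inj_coords)

lemma coords_uncoords [simp]: "coords (uncoords c) = c"
  by (simp add: uncoords_def surj_coords surj_f_inv_f)

lemma inner_u_uncoords [simp]: "u i \<bullet> uncoords c = c $ i"
  using coords_uncoords[of c] by (simp add: coords_def vec_eq_iff)

lemma linear_uncoords: "linear uncoords"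
proof (rule linearI)
  show "uncoords (a + b) = uncoords a + uncoords b" for a b
    by (rule injD[OF inj_coords]) (simp add: linear_add[OF linear_coords])
  show "uncoords (r *\<^sub>R a) = r *\<^sub>R uncoords a" for r a
    by (rule injD[OF inj_coords]) (simp add: linear_cmul[OF linear_coords])
qed

text \<open>
  The point of the chart whose logarithmic torus coordinate is \<open>y + \<i> \<theta>\<close>.
\<close>

definition exp_point :: "'a \<Rightarrow> 'a \<Rightarrow> complex ^ 'm" where
  "exp_point y \<theta> = (\<chi> i. exp (Complex (u i \<bullet> y) (u i \<bullet> \<theta>)))"

lemma chart_vec_exp_point:
  "chart_vec Q v u (exp_point y \<theta>) = (\<lambda>p. exp (- Complex (v \<bullet> y) (v \<bullet> \<theta>)) * torus_vec Q y \<theta> p)"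
proof
  fix p
  show "chart_vec Q v u (exp_point y \<theta>) p = exp (- Complex (v \<bullet> y) (v \<bullet> \<theta>)) * torus_vec Q y \<theta> p"
  proof (cases "p \<in> lattice_points Q")
    case True
    define m where "m = chart_exponent v u p"
    have p: "p = v + (\<Sum>i\<in>UNIV. real (m i) *\<^sub>R u i)" unfolding m_def by (rule chart_exponent[OF True])
    have in_p: "p \<bullet> x = v \<bullet> x + (\<Sum>i\<in>UNIV. real (m i) * (u i \<bullet> x))" for x
      by (subst p) (simp add: inner_add_left inner_sum_left)
    have "chart_vec Q v u (exp_point y \<theta>) p = (\<Prod>i\<in>UNIV. exp (Complex (u i \<bullet> y) (u i \<bullet> \<theta>)) ^ m i)"
      using True by (simp add: chart_vec_def exp_point_def m_def)
    also have "\<dots> = exp (\<Sum>i\<in>UNIV. of_nat (m i) * Complex (u i \<bullet> y) (u i \<bullet> \<theta>))"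
      by (simp add: exp_sum exp_of_nat_mult)
    also have "(\<Sum>i\<in>UNIV. of_nat (m i) * Complex (u i \<bullet> y) (u i \<bullet> \<theta>)) = Complex (p \<bullet> y) (p \<bullet> \<theta>) - Complex (v \<bullet> y) (v \<bullet> \<theta>)"
      by (simp add: complex_eq_iff in_p)
    finally show ?thesis using True by (simp add: torus_vec_def exp_diff exp_minus field_simps)
  qed (simp add: chart_vec_def torus_vec_def)
qed

lemma chart_point_exp_point: "chart_point Q v u (exp_point y \<theta>) = torus_point Q y \<theta>"
  unfolding chart_point_def torus_point_def chart_vec_exp_point by (rule proj_class_cmult) simp

lemma finite_points: "finite (lattice_points Q)"
  by (rule finite_lattice_points) (rule polytope_imp_bounded[OF polytope_Q])

lemma v_lattice_point: "v \<in> lattice_points Q"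
  using v_lattice v_in_Q by (simp add: lattice_points_def)

lemma fs_potential_exp_point:
  "fs_potential Q (chart_vec Q v u (exp_point y \<theta>)) = ln (\<Sum>p\<in>lattice_points Q. exp (2 * (p \<bullet> y))) - 2 * (v \<bullet> y)"
proof -
  have "(cmod (chart_vec Q v u (exp_point y \<theta>) p))\<^sup>2 = exp (- 2 * (v \<bullet> y)) * exp (2 * (p \<bullet> y))"
    if "p \<in> lattice_points Q" for p
    using that by (simp add: chart_vec_exp_point torus_vec_def norm_mult power_mult_distrib flip: exp_double)
  then have "fs_potential Q (chart_vec Q v u (exp_point y \<theta>))
      = ln (exp (- 2 * (v \<bullet> y)) * (\<Sum>p\<in>lattice_points Q. exp (2 * (p \<bullet> y))))"
    unfolding fs_potential_def sum_distrib_left by (intro arg_cong[of _ _ ln] sum.cong) auto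
  moreover have "(\<Sum>p\<in>lattice_points Q. exp (2 * (p \<bullet> y))) > 0"
    using finite_points v_lattice_point by (intro sum_pos) auto
  ultimately show ?thesis by (simp add: ln_mult)
qed

lemma chart_vec_vertex: "chart_vec Q v u z v = 1"
proof -
  have "chart_exponent v u v = (\<lambda>_. 0)" by (rule chart_exponent_eqI) simp
  then show ?thesis using v_lattice_point by (simp add: chart_vec_def)
qed

lemma continuous_chart_vec: "continuous_on UNIV (chart_vec Q v u)"
proof (rule continuous_on_coordinatewise_then_product)
  fix p
  show "continuous_on UNIV (\<lambda>z. chart_vec Q v u z p)"
    by (cases "p \<in> lattice_points Q") (auto simp: chart_vec_def intro!: continuous_intros)
qed

lemma exp_point_surj:
  assumes "\<And>i. z $ i \<noteq> 0"
  obtains y \<theta> where "z = exp_point y \<theta>"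
proof -
  have "z = exp_point (uncoords (\<chi> i. Re (Ln (z $ i)))) (uncoords (\<chi> i. Im (Ln (z $ i))))"
    using assms by (simp add: exp_point_def vec_eq_iff complex.collapse del: Re_Ln)
  then show ?thesis by (rule that)
qed

text \<open>
  The chart is continuous, and the points with nonzero coordinates, which it maps into the torus orbit,
  are dense.
\<close>

lemma chart_point_in_toric_variety: "chart_point Q v u z \<in> toric_variety Q"
proof -
  let ?D = "{z :: complex ^ 'm. \<forall>i. z $ i \<noteq> 0}"
  let ?T = "{\<lambda>p. c * torus_vec Q y \<theta> p | c y \<theta>. True}"
  have "z \<in> closure ?D"
  proof (rule closure_sequential[THEN iffD2])
    define w where "w = (\<lambda>n::nat. \<chi> i. if z $ i = 0 then complex_of_real (inverse (real (Suc n))) else z $ i)"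
    have "w \<longlonglongrightarrow> z"
    proof (rule vec_tendstoI)
      fix i
      have "(\<lambda>n. complex_of_real (inverse (real (Suc n)))) \<longlonglongrightarrow> complex_of_real 0"
        by (intro tendsto_of_real LIMSEQ_inverse_real_of_nat)
      then show "(\<lambda>n. w n $ i) \<longlonglongrightarrow> z $ i" by (cases "z $ i = 0") (simp_all add: w_def)
    qed
    moreover have "w n \<in> ?D" for n by (simp add: w_def del: of_nat_Suc)
    ultimately show "\<exists>w. (\<forall>n. w n \<in> ?D) \<and> w \<longlonglongrightarrow> z" by blast
  qed
  then have "chart_vec Q v u z \<in> chart_vec Q v u ` closure ?D" by blast
  also have "\<dots> \<subseteq> closure ?T"
  proof (rule image_closure_subset)
    show "continuous_on (closure ?D) (chart_vec Q v u)" using continuous_chart_vec continuous_on_subset by blast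
    show "chart_vec Q v u ` ?D \<subseteq> closure ?T"
    proof (clarify)
      fix z :: "complex ^ 'm" assume "\<forall>i. z $ i \<noteq> 0"
      then obtain y \<theta> where "z = exp_point y \<theta>" using exp_point_surj by blast
      then have "chart_vec Q v u z = (\<lambda>p. exp (- Complex (v \<bullet> y) (v \<bullet> \<theta>)) * torus_vec Q y \<theta> p)"
        by (simp only: chart_vec_exp_point)
      then have "chart_vec Q v u z \<in> ?T" by (intro CollectI exI conjI TrueI)
      then show "chart_vec Q v u z \<in> closure ?T" by (rule subsetD[OF closure_subset])
    qed
  qed simp
  finally have "chart_vec Q v u z \<in> closure ?T" .
  moreover have "chart_vec Q v u z \<noteq> (\<lambda>_. 0)" using chart_vec_vertex[of z] by (metis zero_neq_one)
  ultimately show ?thesis unfolding toric_variety_def chart_point_def by blast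
qed

text \<open>
  Hence at a maximising vertex all chart coordinates \<open>exp (u i \<bullet> y)\<close> are at most \<open>1\<close>.
\<close>

lemma edge_nonpos_at_max:
  assumes max: "\<And>p. p \<in> Q \<Longrightarrow> p \<bullet> y \<le> v \<bullet> y"
  shows "u i \<bullet> y \<le> 0"
proof -
  obtain r where r: "r > 0"
    "\<forall>x\<in>ball v r. x \<in> Q \<longleftrightarrow> (\<exists>c::'m \<Rightarrow> real. (\<forall>i. 0 \<le> c i) \<and> x = v + (\<Sum>i\<in>UNIV. c i *\<^sub>R u i))"
    by (rule cone_near_vertex)
  define e where "e = r / (2 * (norm (u i) + 1))"
  have e: "e > 0" using r(1) by (simp add: e_def add_nonneg_pos)
  have "e * norm (u i) < r" unfolding e_def by (intro small_multiple r(1)) simp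
  then have ball: "v + e *\<^sub>R u i \<in> ball v r" using e by (simp add: dist_norm)
  have "v + e *\<^sub>R u i = v + (\<Sum>j\<in>UNIV. (if j = i then e else 0) *\<^sub>R u j)"
    by (simp add: if_distrib[of "\<lambda>c. c *\<^sub>R _"] cong: if_cong)
  moreover have "\<forall>j. 0 \<le> (if j = i then e else 0)" using e by simp
  ultimately have "\<exists>c::'m \<Rightarrow> real. (\<forall>j. 0 \<le> c j) \<and> v + e *\<^sub>R u i = v + (\<Sum>j\<in>UNIV. c j *\<^sub>R u j)"
    by (intro exI[of _ "\<lambda>j. if j = i then e else 0"] conjI)
  then have "v + e *\<^sub>R u i \<in> Q" using bspec[OF r(2) ball] by (rule iffD2[rotated])
  then show ?thesis using max e by (fastforce simp: inner_add_left mult_le_0_iff)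
qed

end

section \<open>The total space of the degeneration\<close>

lemma polytope_max_at_vertex:
  fixes Q :: "'a::euclidean_space set"
  assumes "polytope Q" "Q \<noteq> {}"
  obtains v where "v extreme_point_of Q" "\<forall>p\<in>Q. p \<bullet> Y \<le> v \<bullet> Y"
proof -
  let ?V = "{v. v extreme_point_of Q}"
  have hull: "Q = convex hull ?V" 
    by (rule Krein_Milman_Minkowski[OF polytope_imp_compact[OF assms(1)] polytope_imp_convex[OF assms(1)]])
  have fin: "finite ?V" using assms(1) by (intro finite_polyhedron_extreme_points polytope_imp_polyhedron)
  have "?V \<noteq> {}" using hull assms(2) by auto
  then have "\<exists>v\<in>?V. \<forall>w\<in>?V. w \<bullet> Y \<le> v \<bullet> Y"
    by (intro continuous_attains_sup finite_imp_compact[OF fin] continuous_intros)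
  then obtain v where v: "v \<in> ?V" "\<forall>w\<in>?V. w \<bullet> Y \<le> v \<bullet> Y" by (elim bexE)
  have "?V \<subseteq> {p. Y \<bullet> p \<le> Y \<bullet> v}" using v(2) by (auto simp: inner_commute)
  then have "convex hull ?V \<subseteq> {p. Y \<bullet> p \<le> Y \<bullet> v}" by (rule hull_minimal) (rule convex_halfspace_le)
  then have "Q \<subseteq> {p. Y \<bullet> p \<le> Y \<bullet> v}" by (simp flip: hull)
  then have "\<forall>p\<in>Q. p \<bullet> Y \<le> v \<bullet> Y" by (auto simp: inner_commute)
  then show ?thesis using that v(1) by simp
qed

text \<open>
  Half the Fubini-Study potential in logarithmic coordinates.  Up to a bounded error it is the support
  function of \<open>Q\<close>, by \<open>log_sum_bounds\<close>.
\<close>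

definition log_sum :: "'a::euclidean_space set \<Rightarrow> 'a \<Rightarrow> real" where
  "log_sum Q Y = ln (\<Sum>p\<in>lattice_points Q. exp (2 * (p \<bullet> Y))) / 2"

lemma log_sum_bounds:
  assumes Q: "integral_polytope Q" "Q \<noteq> {}"
  shows "p \<in> Q \<Longrightarrow> p \<bullet> Y \<le> log_sum Q Y"
    and "\<exists>p\<in>Q. log_sum Q Y \<le> p \<bullet> Y + ln (real (card (lattice_points Q))) / 2"
proof -
  let ?L = "lattice_points Q"
  have poly: "polytope Q" using Q(1) by (simp add: integral_polytope_def)
  obtain v where v: "v extreme_point_of Q" "\<forall>p\<in>Q. p \<bullet> Y \<le> v \<bullet> Y"
    by (rule polytope_max_at_vertex[OF poly Q(2)])
  have vQ: "v \<in> Q" using v(1) by (simp add: extreme_point_of_def)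
  have vL: "v \<in> ?L" using v(1) Q(1) vQ by (simp add: integral_polytope_def lattice_points_def)
  have fin: "finite ?L" by (rule finite_lattice_points) (rule polytope_imp_bounded[OF poly])
  let ?S = "\<Sum>p\<in>?L. exp (2 * (p \<bullet> Y))"
  have S1: "exp (2 * (v \<bullet> Y)) \<le> ?S" using fin vL by (intro member_le_sum) auto
  then have pos: "0 < ?S" by (meson exp_gt_zero less_le_trans)
  have "2 * (v \<bullet> Y) \<le> ln ?S" using S1 pos ln_ge_iff by blast
  then show "p \<bullet> Y \<le> log_sum Q Y" if "p \<in> Q" for p using v(2) that unfolding log_sum_def by fastforce
  have N: "card ?L > 0" using fin vL by (auto simp: card_gt_0_iff)
  have "?S \<le> (\<Sum>p\<in>?L. exp (2 * (v \<bullet> Y)))" using v(2) by (intro sum_mono) (auto simp: lattice_points_def)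
  also have "\<dots> = real (card ?L) * exp (2 * (v \<bullet> Y))" by simp
  finally have "ln ?S \<le> ln (real (card ?L) * exp (2 * (v \<bullet> Y)))" using pos by simp
  also have "\<dots> = ln (real (card ?L)) + 2 * (v \<bullet> Y)" using N by (simp add: ln_mult)
  finally have "log_sum Q Y \<le> v \<bullet> Y + ln (real (card ?L)) / 2" by (simp add: log_sum_def)
  then show "\<exists>p\<in>Q. log_sum Q Y \<le> p \<bullet> Y + ln (real (card ?L)) / 2" using vQ by blast
qed

lemma torus_rotation_torus_point: "torus_rotation \<theta> (torus_point Q Y 0) = torus_point Q Y \<theta>"
proof -
  have "(\<lambda>p. cis (p \<bullet> \<theta>) * (c * torus_vec Q Y 0 p)) = (\<lambda>p. c * torus_vec Q Y \<theta> p)" for c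
    by (auto simp: torus_vec_def fun_eq_iff exp_eq_polar)
  then show ?thesis unfolding torus_rotation_def torus_point_def proj_class_def by (auto simp: image_def)
qed

locale integral_hat_polytope =
  fixes P :: "'a::euclidean_space set" and f :: "'a \<Rightarrow> real" and K :: real and Q
  assumes Q_eq: "Q = hat_polytope P f K" and f_less: "\<And>x. x \<in> P \<Longrightarrow> f x < K"
    and delzant_Q: "delzant Q" and integral_Q: "integral_polytope Q"
begin

lemma polytope_Q: "polytope Q" and Q_nonempty: "Q \<noteq> {}"
  using delzant_Q by (auto simp: delzant_def)

text \<open>
  For \<open>t > 0\<close> moving upwards in \<open>Q\<close> increases \<open>p \<bullet> (y, t)\<close>, so a maximiser lies on the graph of \<open>K - f\<close>
  and not on the bottom face.
\<close>

lemma max_at_upper_vertex: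
  assumes "0 < snd Y"
  obtains v where "v extreme_point_of Q" "0 < snd v" "\<forall>p\<in>Q. p \<bullet> Y \<le> v \<bullet> Y"
proof -
  obtain v where v: "v extreme_point_of Q" "\<forall>p\<in>Q. p \<bullet> Y \<le> v \<bullet> Y"
    by (rule polytope_max_at_vertex[OF polytope_Q Q_nonempty])
  obtain d k where dk: "v = (d, k)" by (cases v)
  have "v \<in> Q" using v(1) by (simp add: extreme_point_of_def)
  then have d: "d \<in> P" "0 \<le> k" by (auto simp: dk Q_eq hat_polytope_def)
  then have "(d, K - f d) \<in> Q" using f_less[of d] by (simp add: Q_eq hat_polytope_def)
  then have "(K - f d) * snd Y \<le> k * snd Y" using v(2) by (cases Y) (auto simp: dk)
  then have "K - f d \<le> k" using assms by simp
  then have "0 < snd v" using f_less[OF d(1)] by (simp add: dk)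
  then show ?thesis using that v by blast
qed

lemma upper_vertex_below:
  assumes v: "(d, k) extreme_point_of Q" and k: "0 < k"
  shows "(d, k) \<in> lattice_points Q" "(d, k - 1) \<in> lattice_points Q"
proof -
  have Q: "(d, k) \<in> Q" using v by (simp add: extreme_point_of_def)
  have "(d, k) \<in> lattice" using v integral_Q by (simp add: integral_polytope_def)
  then show "(d, k) \<in> lattice_points Q" using Q by (simp add: lattice_points_def)
  have "k \<in> \<int>" "d \<in> lattice" using \<open>(d, k) \<in> lattice\<close> by (auto simp: lattice_Pair_iff)
  then have "k \<ge> 1" using k by (metis Ints_cases int_one_le_iff_zero_less of_int_0_less_iff of_int_1_le_iff)
  then have "(d, k - 1) \<in> Q" using Q by (auto simp: Q_eq hat_polytope_def)
  then show "(d, k - 1) \<in> lattice_points Q"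
    using \<open>k \<in> \<int>\<close> \<open>d \<in> lattice\<close> by (simp add: lattice_points_def lattice_Pair_iff)
qed

text \<open>
  The real direction of the \<open>\<complex>\<^sup>*\<close>-action is the last logarithmic coordinate.
\<close>

lemma flow_of_fibre_point:
  "cstar_action (of_real (exp t)) (fibre_embedding Q (torus_point P y 0)) = torus_point Q (y, t) 0"
proof -
  have "(case p of (d, k) \<Rightarrow> complex_of_real (exp t) ^ nat \<lfloor>k\<rfloor> * fibre_vec Q (\<lambda>p. c * torus_vec P y 0 p) (d, k))
      = c * torus_vec Q (y, t) 0 p" for c p
  proof (cases p)
    case (Pair d k)
    show ?thesis
    proof (cases "(d, k) \<in> lattice_points Q")
      case True
      then have dk: "d \<in> lattice_points P" "k \<in> \<int>" "0 \<le> k"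
        by (auto simp: lattice_points_def lattice_Pair_iff Q_eq hat_polytope_def)
      then have "real (nat \<lfloor>k\<rfloor>) = k" by (metis of_int_floor of_nat_nat zero_le_floor of_int_of_nat_eq)
      then have "exp t ^ nat \<lfloor>k\<rfloor> = exp (k * t)" by (metis exp_of_nat_mult)
      then have "complex_of_real (exp t) ^ nat \<lfloor>k\<rfloor> = exp (complex_of_real (k * t))"
        by (metis of_real_power exp_of_real)
      moreover have "Complex (d \<bullet> y + k * t) 0 = complex_of_real (k * t) + Complex (d \<bullet> y) 0"
        by (simp add: complex_eq_iff)
      then have "exp (Complex (d \<bullet> y + k * t) 0) = exp (complex_of_real (k * t)) * exp (Complex (d \<bullet> y) 0)"
        by (simp only: exp_add)
      ultimately show ?thesis using True dk by (simp add: Pair fibre_vec_def torus_vec_def)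
    qed (simp add: Pair fibre_vec_def torus_vec_def)
  qed
  then have "(\<lambda>(d, k). complex_of_real (exp t) ^ nat \<lfloor>k\<rfloor> * fibre_vec Q (\<lambda>p. c * torus_vec P y 0 p) (d, k))
      = (\<lambda>p. c * torus_vec Q (y, t) 0 p)" for c by (intro ext)
  then show ?thesis
    unfolding cstar_action_def fibre_embedding_def torus_point_def proj_class_def image_def by auto metis+
qed

lemma torus_point_over_disc:
  assumes "0 \<le> snd Y"
  shows "torus_point Q Y \<theta> \<in> degeneration_over_disc Q"
proof -
  \<comment> \<open>An upper vertex and the lattice point below it witness that the point lies over the disc.\<close>
  obtain v where "v extreme_point_of Q" "0 < snd v" "\<forall>p\<in>Q. p \<bullet> (0, 1) \<le> v \<bullet> (0, 1)"
    by (rule max_at_upper_vertex[of "(0, 1)"]) auto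
  then obtain d k where "(d, k) extreme_point_of Q" "0 < k" by (cases v) auto
  note pts = upper_vertex_below[OF this]
  have nz: "torus_vec Q Y \<theta> p \<noteq> 0" if "p \<in> lattice_points Q" for p
    using that by (simp add: torus_vec_def)
  have "torus_vec Q Y \<theta> \<in> {\<lambda>p. c * torus_vec Q y \<theta> p | c y \<theta>. True}"
    by (intro CollectI exI[of _ 1] exI[of _ Y] exI[of _ \<theta>]) simp
  then have "torus_vec Q Y \<theta> \<in> closure {\<lambda>p. c * torus_vec Q y \<theta> p | c y \<theta>. True}"
    by (rule subsetD[OF closure_subset])
  moreover have "torus_vec Q Y \<theta> \<noteq> (\<lambda>_. 0)" using nz[OF pts(1)] by auto
  ultimately have "torus_point Q Y \<theta> \<in> toric_variety Q"
    unfolding toric_variety_def torus_point_def by (intro imageI) simp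
  moreover have "\<not> lies_over Q (torus_point Q Y \<theta>) x 0" for x
  proof
    assume "lies_over Q (torus_point Q Y \<theta>) x 0"
    then obtain c d' k' where "c \<noteq> 0" "(d', k' + 1) \<in> lattice_points Q" "0 = c * torus_vec Q Y \<theta> (d', k' + 1)"
      unfolding lies_over_def torus_point_def proj_class_def by auto
    then show False using nz by auto
  qed
  moreover have "lies_over Q (torus_point Q Y \<theta>) (torus_vec Q Y \<theta> (d, k - 1)) (torus_vec Q Y \<theta> (d, k))"
    unfolding lies_over_def torus_point_def
    using nz[OF pts(1)] self_in_proj_class[of "torus_vec Q Y \<theta>"] pts
    by (auto intro!: bexI[of _ "torus_vec Q Y \<theta>"] exI[of _ d] exI[of _ "k - 1"])
  moreover have "cmod (torus_vec Q Y \<theta> (d, k - 1)) \<le> cmod (torus_vec Q Y \<theta> (d, k))"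
    using pts assms by (cases Y) (simp add: torus_vec_def algebra_simps)
  ultimately show ?thesis unfolding degeneration_over_disc_def toric_degeneration_def by blast
qed

text \<open>
  At an upper vertex the downward direction \<open>(0, -1)\<close> belongs to the cone.  Hence
  \<open>s\<^sub>(\<^sub>d\<^sub>,\<^sub>k\<^sub>) = s\<^sub>(\<^sub>d\<^sub>,\<^sub>k\<^sub>+\<^sub>1\<^sub>) z\<^sup>a\<close> for a fixed monomial \<open>z\<^sup>a\<close>, the projection is \<open>[z\<^sup>a : 1]\<close> on the whole chart, and
  \<open>\<bar>z\<^sup>a\<bar> \<le> 1\<close> on the polydisc.
\<close>

lemma polydisc_over_disc:
  assumes chart: "vertex_chart Q (d0, k0) u" and k0: "0 < k0" and z: "\<And>i. cmod (z $ i) \<le> 1"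
  shows "chart_point Q (d0, k0) u z \<in> degeneration_over_disc Q"
proof -
  interpret vertex_chart Q "(d0, k0)" u by fact
  let ?c = "chart_vec Q (d0, k0) u z"
  note pts = upper_vertex_below[OF extreme_v k0]
  have shift: "?c (d, k) = ?c (d, k + 1) * ?c (d0, k0 - 1)"
    if dk: "(d, k) \<in> lattice_points Q" "(d, k + 1) \<in> lattice_points Q" for d k
  proof -
    let ?m = "chart_exponent (d0, k0) u (d, k + 1)" and ?m' = "chart_exponent (d0, k0) u (d0, k0 - 1)"
    define A B where "A = (\<Sum>i\<in>UNIV. real (?m i) *\<^sub>R u i)" and "B = (\<Sum>i\<in>UNIV. real (?m' i) *\<^sub>R u i)"
    have "(d, k + 1) = (d0, k0) + A" "(d0, k0 - 1) = (d0, k0) + B"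
      unfolding A_def B_def by (rule chart_exponent[OF dk(2)], rule chart_exponent[OF pts(2)])
    then have "(d, k) = (d0, k0) + A + B" by (cases A; cases B) auto
    also have "\<dots> = (d0, k0) + (\<Sum>i\<in>UNIV. real (?m i + ?m' i) *\<^sub>R u i)"
      by (simp add: A_def B_def sum.distrib scaleR_add_left add.assoc)
    finally have "chart_exponent (d0, k0) u (d, k) = (\<lambda>i. ?m i + ?m' i)" by (rule chart_exponent_eqI)
    then show ?thesis using dk pts by (simp add: chart_vec_def power_add prod.distrib)
  qed
  have "\<not> lies_over Q (chart_point Q (d0, k0) u z) x 0" for x
  proof
    assume "lies_over Q (chart_point Q (d0, k0) u z) x 0"
    then obtain c d k where "x \<noteq> 0" "c \<noteq> 0" "(d, k) \<in> lattice_points Q" "(d, k + 1) \<in> lattice_points Q"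
        "x = c * ?c (d, k)" "0 = c * ?c (d, k + 1)"
      unfolding lies_over_def chart_point_def proj_class_def by auto
    then show False using shift by auto
  qed
  moreover have "lies_over Q (chart_point Q (d0, k0) u z) (?c (d0, k0 - 1)) (?c (d0, k0))"
    unfolding lies_over_def chart_point_def
    using chart_vec_vertex[of z] self_in_proj_class[of ?c] pts
    by (auto intro!: bexI[of _ ?c] exI[of _ d0] exI[of _ "k0 - 1"])
  moreover have "cmod (?c (d0, k0 - 1)) \<le> cmod (?c (d0, k0))"
    unfolding chart_vec_vertex using pts z
    by (auto simp: chart_vec_def norm_power simp flip: prod_norm intro!: prod_le_1 power_le_one)
  ultimately show ?thesis using chart_point_in_toric_variety[of z]
    unfolding degeneration_over_disc_def toric_degeneration_def by blast
qed

end

section \<open>Second derivatives and complex Hessians\<close>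

lemma pointwise_lipschitz_bilinear:
  assumes bil: "bounded_bilinear mul" and f: "pointwise_lipschitz f z" and g: "pointwise_lipschitz g z"
  shows "pointwise_lipschitz (\<lambda>w. mul (f w) (g w)) z"
proof -
  interpret bounded_bilinear mul by fact
  obtain K where K: "K > 0" "\<And>a b. norm (mul a b) \<le> norm a * norm b * K" using pos_bounded by blast
  obtain B0 where B0: "\<forall>\<^sub>F w in nhds z. norm (f w - f z) \<le> B0 * norm (w - z)"
    using f by (rule pointwise_lipschitzE)
  obtain C0 where C0: "\<forall>\<^sub>F w in nhds z. norm (g w - g z) \<le> C0 * norm (w - z)"
    using g by (rule pointwise_lipschitzE)
  define B C where "B = \<bar>B0\<bar>" and "C = \<bar>C0\<bar>"
  have "\<forall>\<^sub>F w in nhds z. w \<in> ball z 1" by (intro eventually_nhds_in_open) auto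
  then have "\<forall>\<^sub>F w in nhds z. norm (mul (f w) (g w) - mul (f z) (g z))
      \<le> ((B * (norm (g z) + C) * K) + norm (f z) * C * K) * norm (w - z)"
    using B0 C0
  proof eventually_elim
    case (elim w)
    have f': "norm (f w - f z) \<le> B * norm (w - z)"
      using elim(2) by (rule order_trans) (auto simp: B_def intro: mult_right_mono)
    have g': "norm (g w - g z) \<le> C * norm (w - z)"
      using elim(3) by (rule order_trans) (auto simp: C_def intro: mult_right_mono)
    have "norm (g w) \<le> norm (g z) + norm (g w - g z)"
      using norm_triangle_ineq[of "g z" "g w - g z"] by simp
    also have "\<dots> \<le> norm (g z) + C * 1"
    proof -
      have "C * norm (w - z) \<le> C * 1"
        using elim(1) by (intro mult_left_mono) (auto simp: C_def dist_norm norm_minus_commute)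
      then show ?thesis using g' by linarith
    qed
    finally have gw: "norm (g w) \<le> norm (g z) + C" by simp
    have "mul (f w) (g w) - mul (f z) (g z) = mul (f w - f z) (g w) + mul (f z) (g w - g z)"
      by (simp add: diff_left diff_right)
    then have "norm (mul (f w) (g w) - mul (f z) (g z))
        \<le> norm (f w - f z) * norm (g w) * K + norm (f z) * norm (g w - g z) * K"
      using norm_triangle_le[OF add_mono[OF K(2) K(2)]] by metis
    also have "\<dots> \<le> (B * norm (w - z)) * (norm (g z) + C) * K + norm (f z) * (C * norm (w - z)) * K"
      using f' g' gw K(1) by (intro add_mono mult_right_mono mult_mono mult_left_mono) (auto simp: B_def)
    finally show ?case by (simp add: algebra_simps)
  qed
  then show ?thesis unfolding pointwise_lipschitz_def by (rule exI)
qed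

lemma has_second_deriv_cong:
  assumes "has_second_deriv f q" "\<forall>\<^sub>F s in nhds 0. f s = g s"
  shows "has_second_deriv g q"
proof -
  obtain f' where f: "\<forall>\<^sub>F s in nhds 0. (f has_real_derivative f' s) (at s)" "(f' has_real_derivative q) (at 0)"
    using assms(1) by (rule has_second_derivE)
  have "\<forall>\<^sub>F s in nhds 0. \<forall>\<^sub>F t in nhds s. f t = g t" using assms(2) by (simp add: eventually_eventually)
  then have "\<forall>\<^sub>F s in nhds 0. (g has_real_derivative f' s) (at s)"
    using f(1)
  proof eventually_elim
    case (elim s)
    then show ?case using DERIV_cong_ev[OF refl elim(1) refl] by blast
  qed
  then show ?thesis using f(2) by (rule has_second_derivI)
qed

lemma has_second_deriv_unique:
  assumes "has_second_deriv f p" "has_second_deriv f q"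
  shows "p = q"
proof -
  obtain f' where f: "\<forall>\<^sub>F s in nhds 0. (f has_real_derivative f' s) (at s)" "(f' has_real_derivative p) (at 0)"
    using assms(1) by (rule has_second_derivE)
  obtain g' where g: "\<forall>\<^sub>F s in nhds 0. (f has_real_derivative g' s) (at s)" "(g' has_real_derivative q) (at 0)"
    using assms(2) by (rule has_second_derivE)
  have "\<forall>\<^sub>F s in nhds 0. f' s = g' s" using f(1) g(1) by eventually_elim (rule DERIV_unique)
  then have "(g' has_real_derivative p) (at 0)" using f(2) DERIV_cong_ev[OF refl _ refl] by blast
  then show ?thesis using g(2) by (rule DERIV_unique)
qed

lemma has_hessian_linear_left:
  assumes "has_hessian g B z"
  shows "bounded_linear (\<lambda>b. B b a)"
  using assms unfolding has_hessian_def by (auto dest: has_derivative_bounded_linear)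

lemma has_hessianE:
  assumes "has_hessian g B z"
  obtains G r where "r > 0" "\<forall>x\<in>ball z r. (g has_derivative G x) (at x)"
    "\<forall>a. ((\<lambda>x. G x a) has_derivative (\<lambda>b. B b a)) (at z)"
  using assms unfolding has_hessian_def by (elim exE conjE)

lemma has_hessian_linear_right:
  assumes "has_hessian g B z"
  shows "linear (B b)"
proof -
  obtain G r where G: "r > 0" "\<forall>x\<in>ball z r. (g has_derivative G x) (at x)"
    "\<forall>a. ((\<lambda>x. G x a) has_derivative (\<lambda>b. B b a)) (at z)"
    using assms by (rule has_hessianE)
  have lin: "linear (G x)" if "x \<in> ball z r" for x
    using G(2) that by (meson bounded_linear.linear has_derivative_bounded_linear)
  have ball: "\<forall>\<^sub>F x in nhds z. x \<in> ball z r" using G(1) by (intro eventually_nhds_in_open) auto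
  show ?thesis
  proof (rule linearI)
    fix a c
    have "((\<lambda>x. G x a + G x c) has_derivative (\<lambda>b. B b a + B b c)) (at z)"
      using G(3) by (intro has_derivative_add) auto
    moreover have "((\<lambda>x. G x (a + c)) has_derivative (\<lambda>b. B b (a + c))) (at z)" using G(3) by blast
    then have "((\<lambda>x. G x a + G x c) has_derivative (\<lambda>b. B b (a + c))) (at z)"
      by (rule has_derivative_transform_within_open[OF _ open_ball[of z r]]) (use G(1) in \<open>auto simp: linear_add lin\<close>)
    ultimately have "(\<lambda>b. B b (a + c)) = (\<lambda>b. B b a + B b c)" using has_derivative_unique by blast
    then show "B b (a + c) = B b a + B b c" by (rule fun_cong)
  next
    fix k a
    have "((\<lambda>x. k * G x a) has_derivative (\<lambda>b. k * B b a)) (at z)"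
      using G(3) by (intro has_derivative_mult_right) auto
    moreover have "((\<lambda>x. G x (k *\<^sub>R a)) has_derivative (\<lambda>b. B b (k *\<^sub>R a))) (at z)" using G(3) by blast
    then have "((\<lambda>x. k * G x a) has_derivative (\<lambda>b. B b (k *\<^sub>R a))) (at z)"
      by (rule has_derivative_transform_within_open[OF _ open_ball[of z r]]) (use G(1) in \<open>auto simp: linear_cmul lin\<close>)
    ultimately have "(\<lambda>b. B b (k *\<^sub>R a)) = (\<lambda>b. k * B b a)" using has_derivative_unique by blast
    then show "B b (k *\<^sub>R a) = k *\<^sub>R B b a" by (auto dest: fun_cong)
  qed
qed

text \<open>
  The chain rule for second derivatives.  The functional \<open>D\<close> is the first derivative of \<open>g\<close> at \<open>z\<close>.  What
  matters is that it is linear and common to all curves through \<open>z\<close>: its contributions to the curves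
  \<open>exp (s l) z\<close> and \<open>exp (s \<i> l) z\<close> are then opposite.
\<close>

lemma second_deriv_along_curve:
  fixes g :: "'v::euclidean_space \<Rightarrow> real"
  assumes hess: "has_hessian g B z"
  obtains D where "linear D" and
    "\<forall>c c' c''. c 0 = z \<longrightarrow> (\<forall>s. (c has_vector_derivative c' s) (at s)) \<longrightarrow>
       (c' has_vector_derivative c'') (at 0) \<longrightarrow> has_second_deriv (\<lambda>s. g (c s)) (B (c' 0) (c' 0) + D c'')"
proof -
  obtain G r where G: "r > 0" "\<forall>x\<in>ball z r. (g has_derivative G x) (at x)"
    "\<forall>a. ((\<lambda>x. G x a) has_derivative (\<lambda>b. B b a)) (at z)"
    using hess by (rule has_hessianE)
  have lin: "linear (G x)" if "x \<in> ball z r" for x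
    using G(2) that by (meson bounded_linear.linear has_derivative_bounded_linear)
  have linz: "linear (G z)" using lin G(1) by simp
  have "has_second_deriv (\<lambda>s. g (c s)) (B (c' 0) (c' 0) + G z c'')"
    if c: "c 0 = z" "\<forall>s. (c has_vector_derivative c' s) (at s)" "(c' has_vector_derivative c'') (at 0)" for c c' c''
  proof (rule has_second_derivI)
    define h where "h = (\<lambda>s. \<Sum>a\<in>Basis. (c' s \<bullet> a) * G (c s) a)"
    have "isCont c 0" using c(2) has_vector_derivative_continuous by blast
    then have "(c \<longlongrightarrow> z) (nhds 0)" using c(1) by (simp add: isCont_def tendsto_nhds_iff)
    then have "\<forall>\<^sub>F s in nhds 0. c s \<in> ball z r"
      by (rule topological_tendstoD) (use G(1) in auto)
    then show "\<forall>\<^sub>F s in nhds 0. ((\<lambda>s. g (c s)) has_real_derivative h s) (at s)"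
    proof eventually_elim
      case (elim s)
      have "((\<lambda>s. g (c s)) has_derivative (\<lambda>t. G (c s) (t *\<^sub>R c' s))) (at s)"
        using c(2) G(2) elim unfolding has_vector_derivative_def
        by (intro has_derivative_compose[of c _ s UNIV g]) auto
      moreover have "G (c s) (t *\<^sub>R c' s) = h s * t" for t
      proof -
        have "G (c s) (c' s) = G (c s) (\<Sum>a\<in>Basis. (c' s \<bullet> a) *\<^sub>R a)" by (simp add: euclidean_representation)
        also have "\<dots> = h s" using lin[OF elim] by (simp add: h_def linear_sum linear_cmul)
        finally show ?thesis using lin[OF elim] by (simp add: linear_cmul)
      qed
      ultimately show ?case by (simp add: has_field_derivative_def)
    qed
    have Ga: "((\<lambda>s. G (c s) a) has_real_derivative B (c' 0) a) (at 0)" for a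
    proof -
      have "((\<lambda>s. G (c s) a) has_derivative (\<lambda>t. B (t *\<^sub>R c' 0) a)) (at 0)"
        using c(1,2) G(3) unfolding has_vector_derivative_def
        by (intro has_derivative_compose[of c _ 0 UNIV "\<lambda>x. G x a"]) auto
      moreover have "B (t *\<^sub>R c' 0) a = B (c' 0) a * t" for t
        using linear_cmul[OF bounded_linear.linear[OF has_hessian_linear_left[OF hess, of a]], of t "c' 0"] by simp
      ultimately show ?thesis by (simp add: has_field_derivative_def)
    qed
    have ca: "((\<lambda>s. c' s \<bullet> a) has_real_derivative c'' \<bullet> a) (at 0)" for a
    proof -
      have "((\<lambda>s. c' s \<bullet> a) has_derivative (\<lambda>t. (t *\<^sub>R c'') \<bullet> a)) (at 0)"
        using c(3) unfolding has_vector_derivative_def by (rule has_derivative_inner_left)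
      then show ?thesis by (simp add: has_field_derivative_def mult_commute_abs)
    qed
    have "(h has_real_derivative (\<Sum>a\<in>Basis. (c' 0 \<bullet> a) * B (c' 0) a + (c'' \<bullet> a) * G (c 0) a)) (at 0)"
      unfolding h_def by (intro DERIV_sum DERIV_mult' ca Ga)
    moreover have "(\<Sum>a\<in>Basis. (c' 0 \<bullet> a) * B (c' 0) a) = B (c' 0) (\<Sum>a\<in>Basis. (c' 0 \<bullet> a) *\<^sub>R a)"
      using has_hessian_linear_right[OF hess] by (simp add: linear_sum linear_cmul)
    moreover have "(\<Sum>a\<in>Basis. (c'' \<bullet> a) * G z a) = G z (\<Sum>a\<in>Basis. (c'' \<bullet> a) *\<^sub>R a)"
      using linz by (simp add: linear_sum linear_cmul)
    ultimately show "(h has_real_derivative B (c' 0) (c' 0) + G z c'') (at 0)"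
      using c(1) by (simp add: sum.distrib euclidean_representation)
  qed
  then show ?thesis using that linz by blast
qed

lemma complex_vec_representation:
  fixes \<xi> :: "complex ^ 'm::finite"
  shows "\<xi> = (\<Sum>i\<in>UNIV. Re (\<xi> $ i) *\<^sub>R axis i 1 + Im (\<xi> $ i) *\<^sub>R axis i \<i>)"
proof -
  have "(\<Sum>i\<in>UNIV. Re (\<xi> $ i) *\<^sub>R axis i 1 + Im (\<xi> $ i) *\<^sub>R axis i \<i>) $ j
      = (\<Sum>i\<in>UNIV. if i = j then \<xi> $ j else 0)" for j
    unfolding sum_component
    by (intro sum.cong) (auto simp: axis_def complex_eq_iff)
  then show ?thesis by (simp add: vec_eq_iff)
qed

text \<open>
  Both sides are bilinear expansions in the real and imaginary parts of \<open>\<xi>\<close>: the pure terms on the right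
  add up to the real part of the complex Hessian, the mixed terms to its imaginary part.
\<close>

lemma hermitian_form_complex_hessian:
  fixes \<xi> :: "complex ^ 'm::finite"
  assumes l: "\<And>a. linear (\<lambda>b. B b a)" and r: "\<And>b. linear (B b)"
  shows "4 * hermitian_form (complex_hessian B) \<xi> = B \<xi> \<xi> + B (\<chi> i. \<i> * \<xi> $ i) (\<chi> i. \<i> * \<xi> $ i)"
proof -
  let ?a = "\<lambda>i. Re (\<xi> $ i)" and ?b = "\<lambda>i. Im (\<xi> $ i)"
  let ?e = "\<lambda>i. axis i 1 :: complex ^ 'm" and ?f = "\<lambda>i. axis i \<i> :: complex ^ 'm"
  have expand: "B (\<Sum>i\<in>UNIV. a i *\<^sub>R ?e i + b i *\<^sub>R ?f i) (\<Sum>i\<in>UNIV. a i *\<^sub>R ?e i + b i *\<^sub>R ?f i)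
      = (\<Sum>i\<in>UNIV. \<Sum>j\<in>UNIV. a i * a j * B (?e i) (?e j) + a i * b j * B (?e i) (?f j)
          + b i * a j * B (?f i) (?e j) + b i * b j * B (?f i) (?f j))" for a b :: "'m \<Rightarrow> real"
    by (subst linear_sum[OF l], intro sum.cong refl, subst linear_sum[OF r], intro sum.cong refl)
       (simp add: linear_add[OF l] linear_cmul[OF l] linear_add[OF r] linear_cmul[OF r] algebra_simps)
  have i\<xi>: "(\<chi> i. \<i> * \<xi> $ i) = (\<Sum>i\<in>UNIV. (- ?b i) *\<^sub>R ?e i + ?a i *\<^sub>R ?f i)"
    by (subst complex_vec_representation) simp
  have B\<xi>: "B \<xi> \<xi> = (\<Sum>i\<in>UNIV. \<Sum>j\<in>UNIV. ?a i * ?a j * B (?e i) (?e j) + ?a i * ?b j * B (?e i) (?f j)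
          + ?b i * ?a j * B (?f i) (?e j) + ?b i * ?b j * B (?f i) (?f j))"
    using expand[of ?a ?b] complex_vec_representation[of \<xi>, symmetric] by (simp only:)
  have "B \<xi> \<xi> + B (\<chi> i. \<i> * \<xi> $ i) (\<chi> i. \<i> * \<xi> $ i) = (\<Sum>i\<in>UNIV. \<Sum>j\<in>UNIV.
      (?a i * ?a j + ?b i * ?b j) * (B (?e i) (?e j) + B (?f i) (?f j))
      + (?a i * ?b j - ?b i * ?a j) * (B (?e i) (?f j) - B (?f i) (?e j)))"
    unfolding B\<xi> i\<xi> expand sum.distrib[symmetric] by (intro sum.cong refl) (simp add: algebra_simps)
  also have "\<dots> = (\<Sum>i\<in>UNIV. \<Sum>j\<in>UNIV. 4 * Re (\<xi> $ i * complex_hessian B $ i $ j * cnj (\<xi> $ j)))"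
    by (intro sum.cong refl) (simp add: complex_hessian_def field_simps)
  finally show ?thesis by (simp add: hermitian_form_def sum_distrib_left)
qed

text \<open>
  The form conjugates its second argument, so the conjugate of a kernel vector of \<open>H\<close> is isotropic.
\<close>

lemma degenerate_hermitian_form:
  fixes H :: "complex ^ 'm::finite ^ 'm"
  assumes "det H = 0"
  obtains \<xi> where "\<xi> \<noteq> 0" "hermitian_form H \<xi> = 0"
proof -
  have "\<not> (\<exists>B. B ** H = mat 1)" using assms invertible_det_nz invertible_left_inverse by metis
  then obtain x where x: "x \<noteq> 0" "H *v x = 0" unfolding matrix_left_invertible_ker by blast
  define \<xi> :: "complex ^ 'm" where "\<xi> = (\<chi> i. cnj (x $ i))"
  have "\<xi> \<noteq> 0" using x(1) by (auto simp: \<xi>_def vec_eq_iff)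
  moreover have "(\<Sum>i\<in>UNIV. \<Sum>j\<in>UNIV. \<xi> $ i * H $ i $ j * cnj (\<xi> $ j)) = (\<Sum>i\<in>UNIV. \<xi> $ i * (H *v x) $ i)"
    by (simp add: matrix_vector_mult_def sum_distrib_left \<xi>_def mult.assoc)
  then have "hermitian_form H \<xi> = 0" using x(2) by (simp add: hermitian_form_def)
  ultimately show ?thesis by (rule that)
qed

lemma gradient_lipschitz_on_log_sum:
  assumes "finite (lattice_points Q)" "lattice_points Q \<noteq> {}"
  shows "gradient_lipschitz_on W (log_sum Q)"
proof -
  let ?S = "\<lambda>Y. \<Sum>p\<in>lattice_points Q. exp (2 * (p \<bullet> Y))"
  let ?g = "\<lambda>Y. (1 / ?S Y) *\<^sub>R (\<Sum>p\<in>lattice_points Q. exp (2 * (p \<bullet> Y)) *\<^sub>R p)"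
  have pos: "?S Y > 0" for Y using assms by (intro sum_pos) auto
  show ?thesis
  proof (rule gradient_lipschitz_onI_differentiable[of _ _ ?g])
    fix Y
    have "(log_sum Q has_derivative (\<lambda>h. (\<Sum>p\<in>lattice_points Q. exp (2 * (p \<bullet> Y)) * (2 * (p \<bullet> h))) / ?S Y / 2)) (at Y)"
    proof -
      have "((\<lambda>Y. exp (2 * (p \<bullet> Y))) has_derivative (\<lambda>h. exp (2 * (p \<bullet> Y)) * (2 * (p \<bullet> h)))) (at Y)" for p
        by (auto intro!: derivative_eq_intros)
      then have "(?S has_derivative (\<lambda>h. \<Sum>p\<in>lattice_points Q. exp (2 * (p \<bullet> Y)) * (2 * (p \<bullet> h)))) (at Y)"
        by (intro has_derivative_sum)
      from has_derivative_ln[OF pos this]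
      have "((\<lambda>Y. ln (?S Y)) has_derivative
          (\<lambda>h. (\<Sum>p\<in>lattice_points Q. exp (2 * (p \<bullet> Y)) * (2 * (p \<bullet> h))) * inverse (?S Y))) (at Y)" .
      then show ?thesis unfolding log_sum_def divide_inverse by (rule has_derivative_mult_left)
    qed
    moreover have "(\<Sum>p\<in>lattice_points Q. exp (2 * (p \<bullet> Y)) * (2 * (p \<bullet> h))) / ?S Y / 2 = h \<bullet> ?g Y" for h
    proof -
      have "(\<Sum>p\<in>lattice_points Q. exp (2 * (p \<bullet> Y)) * (2 * (p \<bullet> h)))
          = 2 * (h \<bullet> (\<Sum>p\<in>lattice_points Q. exp (2 * (p \<bullet> Y)) *\<^sub>R p))"
        by (simp add: inner_sum_right sum_distrib_left inner_commute mult_ac)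
      then show ?thesis by simp
    qed
    ultimately show "GDERIV (log_sum Q) Y :> ?g Y" by (simp add: gderiv_def)
    have "?S Y \<noteq> 0" using pos[of Y] by simp
    moreover have "(\<lambda>x. exp (2 * (p \<bullet> x))) differentiable at Y" for p
      unfolding differentiable_def by (auto intro!: exI derivative_eq_intros)
    ultimately show "?g differentiable (at Y)" using assms(1)
      by (auto intro!: derivative_intros differentiable_sum differentiable_scaleR differentiable_divide)
  qed
qed

section \<open>Logarithmic coordinates in a chart\<close>

lemma has_derivative_vec_componentwise:
  fixes f :: "'a::real_normed_vector \<Rightarrow> ('b::euclidean_space) ^ 'm::finite"
  assumes "\<And>i. ((\<lambda>x. f x $ i) has_derivative (\<lambda>h. f' h $ i)) (at a within S)"
  shows "(f has_derivative f') (at a within S)"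
  unfolding has_derivative_componentwise_within[of f]
proof
  fix b :: "'b ^ 'm" assume "b \<in> Basis"
  then obtain i c where b: "b = axis i c" by (auto simp: Basis_vec_def)
  show "((\<lambda>x. f x \<bullet> b) has_derivative (\<lambda>x. f' x \<bullet> b)) (at a within S)"
    unfolding b inner_axis by (rule has_derivative_inner_left[OF assms])
qed

lemma has_vector_derivative_vec_componentwise:
  fixes f :: "real \<Rightarrow> ('b::euclidean_space) ^ 'm::finite"
  assumes "\<And>i. ((\<lambda>x. f x $ i) has_vector_derivative f' $ i) (at a)"
  shows "(f has_vector_derivative f') (at a)"
  using assms unfolding has_vector_derivative_def by (intro has_derivative_vec_componentwise) simp

text \<open>
  Fubini's theorem, applied to a Borel null set that contains \<open>B\<close>: for almost every \<open>y\<close>, almost every \<open>\<theta>\<close>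
  avoids \<open>B\<close>, and the open set \<open>U\<close> is not null.
\<close>

lemma negligible_slices:
  fixes B :: "('a::euclidean_space \<times> 'b::euclidean_space) set"
  assumes "negligible B" "open U" "U \<noteq> {}"
  obtains N where "negligible N" "\<forall>y. y \<notin> N \<longrightarrow> (\<exists>\<theta>\<in>U. (y, \<theta>) \<notin> B)"
proof -
  have "B \<in> null_sets lebesgue" using assms(1) by (simp add: negligible_iff_null_sets)
  then obtain B' where B': "B' \<in> null_sets lborel" "B \<subseteq> B'" unfolding null_sets_completion_iff2 by blast
  then have "B' \<in> null_sets (lborel \<Otimes>\<^sub>M lborel)" by (simp only: lborel_prod)
  then have "AE p in lborel \<Otimes>\<^sub>M lborel. p \<notin> B'" by (rule AE_not_in)
  then have "AE y in lborel. AE \<theta> in lborel. (y, \<theta>) \<notin> B'" by (rule lborel_pair.AE_pair)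
  then obtain N where N: "N \<in> null_sets lborel" "{y. \<not> (AE \<theta> in lborel. (y, \<theta>) \<notin> B')} \<subseteq> N"
    unfolding eventually_ae_filter by auto
  have "negligible N" using N(1) by (simp add: negligible_iff_null_sets null_sets_completionI)
  moreover have "\<exists>\<theta>\<in>U. (y, \<theta>) \<notin> B" if "y \<notin> N" for y
  proof (rule ccontr)
    assume no: "\<not> ?thesis"
    have "AE \<theta> in lborel. (y, \<theta>) \<notin> B'" using N(2) that by blast
    then obtain M where M: "M \<in> null_sets lborel" "{\<theta>. \<not> (y, \<theta>) \<notin> B'} \<subseteq> M"
      unfolding eventually_ae_filter by auto
    have "U \<subseteq> M" using no M(2) B'(2) by blast
    moreover have "negligible M" using M(1) by (simp add: negligible_iff_null_sets null_sets_completionI)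
    ultimately have "negligible U" by (rule negligible_subset[rotated])
    then show False using open_not_negligible[OF assms(2,3)] by simp
  qed
  ultimately show ?thesis using that by blast
qed

context vertex_chart
begin

lemma exp_point_nth [simp]: "exp_point y \<theta> $ i = exp (Complex (u i \<bullet> y) (u i \<bullet> \<theta>))"
  by (simp add: exp_point_def)

definition exp_point_deriv :: "'a \<Rightarrow> 'a \<Rightarrow> complex ^ 'm" where
  "exp_point_deriv y h = (\<chi> i. complex_of_real (exp (u i \<bullet> y) * (u i \<bullet> h)))"

lemma exp_point_real: "exp_point y 0 = (\<chi> i. complex_of_real (exp (u i \<bullet> y)))"
  by (simp add: vec_eq_iff exp_eq_polar)

lemma has_derivative_exp_point: "((\<lambda>y. exp_point y 0) has_derivative exp_point_deriv y) (at y within S)"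
proof (rule has_derivative_vec_componentwise)
  fix i
  have "((\<lambda>y. exp (u i \<bullet> y)) has_derivative (\<lambda>h. exp (u i \<bullet> y) * (u i \<bullet> h))) (at y within S)"
    by (auto intro!: derivative_eq_intros)
  then show "((\<lambda>y. exp_point y 0 $ i) has_derivative (\<lambda>h. exp_point_deriv y h $ i)) (at y within S)"
    unfolding exp_point_real exp_point_deriv_def vec_lambda_beta by (rule has_derivative_of_real)
qed

lemma differentiable_exp_point_deriv: "(\<lambda>y. exp_point_deriv y h) differentiable (at y)"
proof -
  have "((\<lambda>y. exp_point_deriv y h) has_derivative
      (\<lambda>k. \<chi> i. complex_of_real (exp (u i \<bullet> y) * (u i \<bullet> k) * (u i \<bullet> h)))) (at y)"
  proof (rule has_derivative_vec_componentwise)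
    fix i
    have "((\<lambda>y. exp (u i \<bullet> y) * (u i \<bullet> h)) has_derivative (\<lambda>k. exp (u i \<bullet> y) * (u i \<bullet> k) * (u i \<bullet> h))) (at y)"
      by (auto intro!: derivative_eq_intros)
    then show "((\<lambda>y. exp_point_deriv y h $ i) has_derivative
        (\<lambda>k. (\<chi> i. complex_of_real (exp (u i \<bullet> y) * (u i \<bullet> k) * (u i \<bullet> h))) $ i)) (at y)"
      unfolding exp_point_deriv_def vec_lambda_beta by (rule has_derivative_of_real)
  qed
  then show ?thesis unfolding differentiable_def by blast
qed

text \<open>
  A straight line in logarithmic coordinates with complex direction \<open>l\<close> is an exponential curve in the
  chart.
\<close>

lemma exp_point_line:
  fixes l :: "complex ^ 'm"
  shows "exp_point (y + s *\<^sub>R uncoords (\<chi> i. Re (l $ i))) (\<theta> + s *\<^sub>R uncoords (\<chi> i. Im (l $ i)))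
    = (\<chi> i. exp (of_real s * l $ i) * exp_point y \<theta> $ i)"
proof -
  have "Complex (u i \<bullet> y + s * Re (l $ i)) (u i \<bullet> \<theta> + s * Im (l $ i))
      = of_real s * l $ i + Complex (u i \<bullet> y) (u i \<bullet> \<theta>)" for i
    by (simp add: complex_eq_iff)
  then show ?thesis by (simp add: vec_eq_iff inner_add_right exp_add)
qed

lemma exp_curve_derivatives:
  fixes l z :: "complex ^ 'm"
  shows "((\<lambda>s. \<chi> i. exp (of_real s * l $ i) * z $ i) has_vector_derivative
      (\<chi> i. l $ i * (exp (of_real s * l $ i) * z $ i))) (at s)"
    and "((\<lambda>s. \<chi> i. l $ i * (exp (of_real s * l $ i) * z $ i)) has_vector_derivative
      (\<chi> i. l $ i * l $ i * (exp (of_real s * l $ i) * z $ i))) (at s)"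
proof -
  have 1: "((\<lambda>s. exp (of_real s * w) * c) has_vector_derivative w * (exp (of_real s * w) * c)) (at s)" for w c :: complex
  proof -
    have "((\<lambda>x. exp (x * w) * c) has_field_derivative w * (exp (of_real s * w) * c)) (at (of_real s))"
      by (auto intro!: derivative_eq_intros)
    then show ?thesis by (rule has_vector_derivative_real_field)
  qed
  then show "((\<lambda>s. \<chi> i. exp (of_real s * l $ i) * z $ i) has_vector_derivative
      (\<chi> i. l $ i * (exp (of_real s * l $ i) * z $ i))) (at s)"
    by (intro has_vector_derivative_vec_componentwise) simp
  show "((\<lambda>s. \<chi> i. l $ i * (exp (of_real s * l $ i) * z $ i)) has_vector_derivative
      (\<chi> i. l $ i * l $ i * (exp (of_real s * l $ i) * z $ i))) (at s)"
    using has_vector_derivative_mult_right[OF 1]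
    by (intro has_vector_derivative_vec_componentwise) (simp add: mult.assoc)
qed

text \<open>
  The coordinatewise logarithm is differentiable on the right half planes and inverts \<open>exp_point\<close> there,
  so the set is contained in the differentiable image of a null set.
\<close>

lemma negligible_log_preimage:
  assumes N: "negligible N"
  shows "negligible {(y, \<theta>). (\<forall>i. \<bar>u i \<bullet> \<theta>\<bar> < 1) \<and> exp_point y \<theta> \<in> N}"
proof -
  let ?H = "{z :: complex ^ 'm. \<forall>i. 0 < Re (z $ i)}"
  define L where "L = (\<lambda>z :: complex ^ 'm. (uncoords (\<chi> i. Re (Ln (z $ i))), uncoords (\<chi> i. Im (Ln (z $ i)))))"
  have bl: "bounded_linear uncoords" using linear_uncoords by (simp add: linear_conv_bounded_linear)
  have dLn: "((\<lambda>z. Ln (z $ i)) has_derivative (\<lambda>h. h $ i / z $ i)) (at z)" if "z \<in> ?H" for z i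
  proof -
    have "0 < Re (z $ i)" using that by simp
    then have "z $ i \<notin> \<real>\<^sub>\<le>\<^sub>0" by (simp add: complex_nonpos_Reals_iff)
    then have "(Ln has_derivative (*) (inverse (z $ i))) (at (z $ i))"
      using has_field_derivative_Ln by (simp add: has_field_derivative_def)
    moreover have "((\<lambda>z. z $ i) has_derivative (\<lambda>h. h $ i)) (at z)"
      by (rule bounded_linear_imp_has_derivative) (rule bounded_linear_vec_nth)
    ultimately have "((\<lambda>z. Ln (z $ i)) has_derivative (\<lambda>h. inverse (z $ i) * h $ i)) (at z)"
      by (rule has_derivative_compose[rotated])
    then show ?thesis by (simp add: divide_inverse mult.commute)
  qed
  have "L differentiable (at z)" if "z \<in> ?H" for z
  proof -
    have "((\<lambda>z. \<chi> i. Re (Ln (z $ i))) has_derivative (\<lambda>h. \<chi> i. Re (h $ i / z $ i))) (at z)"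
      by (rule has_derivative_vec_componentwise) (simp add: has_derivative_Re dLn[OF that])
    then have 1: "((\<lambda>z. uncoords (\<chi> i. Re (Ln (z $ i)))) has_derivative (\<lambda>h. uncoords (\<chi> i. Re (h $ i / z $ i)))) (at z)"
      by (rule bounded_linear.has_derivative[OF bl])
    have "((\<lambda>z. \<chi> i. Im (Ln (z $ i))) has_derivative (\<lambda>h. \<chi> i. Im (h $ i / z $ i))) (at z)"
      by (rule has_derivative_vec_componentwise) (simp add: has_derivative_Im dLn[OF that])
    then have 2: "((\<lambda>z. uncoords (\<chi> i. Im (Ln (z $ i)))) has_derivative (\<lambda>h. uncoords (\<chi> i. Im (h $ i / z $ i)))) (at z)"
      by (rule bounded_linear.has_derivative[OF bl])
    show ?thesis unfolding L_def differentiable_def using has_derivative_Pair[OF 1 2] by blast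
  qed
  then have "L differentiable_on (N \<inter> ?H)"
    unfolding differentiable_on_def by (auto intro: differentiable_at_withinI)
  then have "negligible (L ` (N \<inter> ?H))"
    by (intro negligible_differentiable_image_negligible) (use N card_eq_DIM in \<open>auto simp: negligible_Int\<close>)
  moreover have "{(y, \<theta>). (\<forall>i. \<bar>u i \<bullet> \<theta>\<bar> < 1) \<and> exp_point y \<theta> \<in> N} \<subseteq> L ` (N \<inter> ?H)"
  proof clarify
    fix y \<theta> assume \<theta>: "\<forall>i. \<bar>u i \<bullet> \<theta>\<bar> < 1" and N: "exp_point y \<theta> \<in> N"
    \<comment> \<open>The angles stay within the range of the principal branch.\<close>
    have small: "- (pi / 2) < u i \<bullet> \<theta>" "u i \<bullet> \<theta> < pi / 2" for i
      using \<theta>[rule_format, of i] pi_gt3 by auto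
    have "Ln (exp_point y \<theta> $ i) = Complex (u i \<bullet> y) (u i \<bullet> \<theta>)" for i
      using small[of i] by (simp add: Ln_exp)
    then have "(y, \<theta>) = L (exp_point y \<theta>)"
      unfolding L_def by (simp add: coords_def[symmetric])
    moreover have "exp_point y \<theta> \<in> ?H"
      using small by (auto simp: Re_exp intro!: mult_pos_pos cos_gt_zero_pi)
    ultimately show "(y, \<theta>) \<in> L ` (N \<inter> ?H)" using N by blast
  qed
  ultimately show ?thesis by (rule negligible_subset)
qed

end

section \<open>The potential of a solution of the homogeneous Monge-Ampere equation\<close>

text \<open>
  Half the local potential of \<open>\<Omega> + \<i> \<partial> \<partial>bar \<psi>\<close> on the open orbit; the induced ray is its value at
  height \<open>t\<close> minus \<open>K t\<close>.
\<close>

definition total_potential ::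
    "'a::euclidean_space set \<Rightarrow> (('a \<Rightarrow> complex) set \<Rightarrow> real) \<Rightarrow> 'a \<Rightarrow> real" where
  "total_potential Q \<psi> Y = log_sum Q Y + \<psi> (torus_point Q Y 0) / 2"

locale degenerate_chart = integral_hat_polytope P f K Q + chart: vertex_chart Q v u
  for P :: "'a::euclidean_space set" and f K Q and v :: "'a \<times> real" and u :: "'m::finite \<Rightarrow> 'a \<times> real" +
  fixes \<psi> :: "('a \<times> real \<Rightarrow> complex) set \<Rightarrow> real"
  assumes invariant: "\<And>X \<theta>. X \<in> degeneration_over_disc Q \<Longrightarrow> \<psi> (torus_rotation \<theta> X) = \<psi> X"
    and C11: "C11_on {z. chart_point Q v u z \<in> degeneration_over_disc Q} (\<lambda>z. \<psi> (chart_point Q v u z))"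
    and hcma: "AE z in lebesgue. z \<in> interior {z. chart_point Q v u z \<in> degeneration_over_disc Q} \<longrightarrow>
      (\<exists>B. has_hessian (\<lambda>z. fs_potential Q (chart_vec Q v u z) + \<psi> (chart_point Q v u z)) B z \<and>
        positive_semidefinite (complex_hessian B) \<and> det (complex_hessian B) = 0)"
begin

abbreviation "chart_domain \<equiv> {z. chart_point Q v u z \<in> degeneration_over_disc Q}"

abbreviation "\<Phi> \<equiv> total_potential Q \<psi>"

definition local_potential :: "complex ^ 'm \<Rightarrow> real" where
  "local_potential z = fs_potential Q (chart_vec Q v u z) + \<psi> (chart_point Q v u z)"

lemma exp_point_in_domain: "0 \<le> snd Y \<Longrightarrow> chart.exp_point Y \<theta> \<in> chart_domain"
  by (simp add: chart.chart_point_exp_point torus_point_over_disc)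

lemma exp_point_in_interior_domain:
  assumes "0 < snd Y"
  shows "chart.exp_point Y \<theta> \<in> interior chart_domain"
proof (rule interiorI)
  let ?l = "\<lambda>z :: complex ^ 'm. snd (chart.uncoords (\<chi> i. ln (cmod (z $ i))))"
  let ?D = "{z :: complex ^ 'm. \<forall>i. z $ i \<noteq> 0}"
  let ?O = "?D \<inter> ?l -` {0<..}"
  have "?D = (\<Inter>i. {z. z $ i \<noteq> 0})" by auto
  moreover have "open {z :: complex ^ 'm. z $ i \<noteq> 0}" for i
    by (intro open_Collect_neq continuous_intros)
  ultimately have openD: "open ?D" by (simp add: open_INT)
  have "bounded_linear chart.uncoords"
    using chart.linear_uncoords by (simp add: linear_conv_bounded_linear)
  then have "continuous_on ?D ?l"
    by (intro continuous_on_snd bounded_linear.continuous_on[of chart.uncoords] continuous_on_vec_lambda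
        continuous_on_ln continuous_intros) auto
  then show "open ?O" using openD by (rule continuous_open_preimage) simp
  have ln_cmod: "chart.uncoords (\<chi> i. ln (cmod (chart.exp_point y \<theta> $ i))) = y" for y \<theta>
  proof -
    have "(\<chi> i. ln (cmod (chart.exp_point y \<theta> $ i))) = chart.coords y"
      by (simp add: chart.coords_def vec_eq_iff)
    then show ?thesis by simp
  qed
  show "chart.exp_point Y \<theta> \<in> ?O" using assms by (simp add: ln_cmod del: chart.exp_point_nth) simp
  show "?O \<subseteq> chart_domain"
  proof
    fix z assume z: "z \<in> ?O"
    then have "z $ i \<noteq> 0" for i by blast
    then obtain y \<theta> where "z = chart.exp_point y \<theta>" by (rule chart.exp_point_surj)
    moreover have "0 < snd y" using z unfolding calculation by (simp add: ln_cmod del: chart.exp_point_nth)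
    ultimately show "z \<in> chart_domain" using exp_point_in_domain[of y] by simp
  qed
qed

lemma psi_torus_point: "\<psi> (torus_point Q Y 0) = \<psi> (chart_point Q v u (chart.exp_point Y 0))"
  by (simp add: chart.chart_point_exp_point)

text \<open>
  By torus invariance the potential does not depend on the angular coordinate.
\<close>

lemma local_potential_exp_point:
  assumes "0 \<le> snd Y"
  shows "local_potential (chart.exp_point Y \<theta>) = 2 * \<Phi> Y - 2 * (v \<bullet> Y)"
proof -
  have "\<psi> (torus_point Q Y \<theta>) = \<psi> (torus_point Q Y 0)"
    using invariant[OF torus_point_over_disc[OF assms], of \<theta> 0] by (simp add: torus_rotation_torus_point)
  then show ?thesis
    by (simp add: local_potential_def chart.fs_potential_exp_point chart.chart_point_exp_point
        total_potential_def log_sum_def)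
qed

text \<open>
  The \<open>C\<^sup>1\<^sup>,\<^sup>1\<close> regularity in the chart, pulled back to logarithmic coordinates.  The derivative exists up to
  the boundary \<open>t = 0\<close>.
\<close>

lemma psi_derivative:
  obtains G :: "complex ^ 'm \<Rightarrow> (complex ^ 'm) \<Rightarrow>\<^sub>L real" where
    "\<forall>Y. 0 \<le> snd Y \<longrightarrow> ((\<lambda>Y. \<psi> (torus_point Q Y 0)) has_derivative
        (\<lambda>h. blinfun_apply (G (chart.exp_point Y 0)) (chart.exp_point_deriv Y h))) (at Y within {Y. 0 \<le> snd Y})"
    "\<forall>Y. 0 < snd Y \<longrightarrow> pointwise_lipschitz (\<lambda>Y. G (chart.exp_point Y 0)) Y"
proof -
  obtain G :: "complex ^ 'm \<Rightarrow> (complex ^ 'm) \<Rightarrow>\<^sub>L real" where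
    G: "\<forall>z\<in>chart_domain. ((\<lambda>z. \<psi> (chart_point Q v u z)) has_derivative blinfun_apply (G z)) (at z within chart_domain)"
    and L: "\<forall>z\<in>chart_domain. \<exists>r>0. \<exists>L. L-lipschitz_on (chart_domain \<inter> ball z r) G"
    using C11 unfolding C11_on_def by (elim exE conjE)
  have 1: "((\<lambda>Y. \<psi> (torus_point Q Y 0)) has_derivative
        (\<lambda>h. blinfun_apply (G (chart.exp_point Y 0)) (chart.exp_point_deriv Y h))) (at Y within {Y. 0 \<le> snd Y})"
    if "0 \<le> snd Y" for Y
    unfolding psi_torus_point
  proof (rule has_derivative_in_compose2[of chart_domain "\<lambda>z. \<psi> (chart_point Q v u z)"])
    show "((\<lambda>z. \<psi> (chart_point Q v u z)) has_derivative blinfun_apply (G z)) (at z within chart_domain)" if "z \<in> chart_domain" for z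
      using G that by blast
    show "(\<lambda>Y. chart.exp_point Y 0) ` {Y. 0 \<le> snd Y} \<subseteq> chart_domain" using exp_point_in_domain by blast
    show "Y \<in> {Y. 0 \<le> snd Y}" using that by simp
    show "((\<lambda>Y. chart.exp_point Y 0) has_derivative chart.exp_point_deriv Y) (at Y within {Y. 0 \<le> snd Y})"
      by (rule chart.has_derivative_exp_point)
  qed
  have 2: "pointwise_lipschitz (\<lambda>Y. G (chart.exp_point Y 0)) Y" if Y: "0 < snd Y" for Y
  proof -
    have YR: "chart.exp_point Y 0 \<in> chart_domain" using exp_point_in_domain[of Y 0] Y by simp
    then obtain r l where r: "r > 0" "l-lipschitz_on (chart_domain \<inter> ball (chart.exp_point Y 0) r) G" using L by blast
    have diff: "(\<lambda>Y. chart.exp_point Y 0) differentiable (at Y)"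
      using chart.has_derivative_exp_point differentiable_def by blast
    then have "isCont (\<lambda>Y. chart.exp_point Y 0) Y" by (rule differentiable_imp_continuous_within)
    then have "((\<lambda>Y. chart.exp_point Y 0) \<longlongrightarrow> chart.exp_point Y 0) (nhds Y)"
      by (simp add: isCont_def tendsto_nhds_iff)
    then have near: "\<forall>\<^sub>F W in nhds Y. chart.exp_point W 0 \<in> ball (chart.exp_point Y 0) r"
      by (rule topological_tendstoD) (use r(1) in auto)
    have "open {Y :: 'a \<times> real. 0 < snd Y}" by (intro open_Collect_less continuous_intros)
    then have pos: "\<forall>\<^sub>F W in nhds Y. 0 < snd W"
      using Y eventually_nhds_in_open[of "{Y :: 'a \<times> real. 0 < snd Y}" Y] by simp
    obtain B where "\<forall>\<^sub>F W in nhds Y. norm (chart.exp_point W 0 - chart.exp_point Y 0) \<le> B * norm (W - Y)"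
      using differentiable_imp_pointwise_lipschitz[OF diff] by (rule pointwise_lipschitzE)
    with near pos have "\<forall>\<^sub>F W in nhds Y. norm (G (chart.exp_point W 0) - G (chart.exp_point Y 0)) \<le> (l * B) * norm (W - Y)"
    proof eventually_elim
      case (elim W)
      have "dist (G (chart.exp_point W 0)) (G (chart.exp_point Y 0))
          \<le> l * dist (chart.exp_point W 0) (chart.exp_point Y 0)"
        using elim(1,2) exp_point_in_domain[of W 0] YR r(1) by (intro lipschitz_onD[OF r(2)]) auto
      also have "\<dots> \<le> l * (B * norm (W - Y))"
        using elim(3) lipschitz_on_nonneg[OF r(2)] by (intro mult_left_mono) (auto simp: dist_norm)
      finally show ?case by (simp add: dist_norm mult.assoc)
    qed
    then show ?thesis unfolding pointwise_lipschitz_def by (rule exI)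
  qed
  show ?thesis by (rule that[of G]) (use 1 2 in blast)+
qed

lemma log_sum_C11: "gradient_lipschitz_on W (log_sum Q)"
  by (rule gradient_lipschitz_on_log_sum) (use chart.finite_points chart.v_lattice_point in auto)

lemma potential_differentiable:
  assumes "0 \<le> snd Y"
  shows "\<Phi> differentiable (at Y within {Y. 0 \<le> snd Y})"
proof -
  obtain G where G: "\<forall>Y. 0 \<le> snd Y \<longrightarrow> ((\<lambda>Y. \<psi> (torus_point Q Y 0)) has_derivative
        (\<lambda>h. blinfun_apply (G (chart.exp_point Y 0)) (chart.exp_point_deriv Y h))) (at Y within {Y. 0 \<le> snd Y})"
    by (rule psi_derivative)
  obtain g where g: "\<forall>Y\<in>UNIV. GDERIV (log_sum Q) Y :> g Y" "\<forall>Y\<in>UNIV. pointwise_lipschitz g Y"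
    using log_sum_C11[of UNIV] by (rule gradient_lipschitz_onE)
  have "(log_sum Q has_derivative (\<lambda>h. h \<bullet> g Y)) (at Y within {Y. 0 \<le> snd Y})"
    using bspec[OF g(1) UNIV_I, of Y] unfolding gderiv_def by (rule has_derivative_at_withinI)
  then have "log_sum Q differentiable (at Y within {Y. 0 \<le> snd Y})" by (rule differentiableI)
  moreover have "(\<lambda>Y. \<psi> (torus_point Q Y 0)) differentiable (at Y within {Y. 0 \<le> snd Y})"
    using G[rule_format, OF assms] by (rule differentiableI)
  ultimately show ?thesis unfolding total_potential_def[abs_def] by (intro derivative_intros) auto
qed

lemma potential_continuous: "continuous_on {Y. 0 \<le> snd Y} \<Phi>"
  by (rule differentiable_imp_continuous_on)
     (auto simp: differentiable_on_def intro: potential_differentiable)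

lemma slice_differentiable:
  assumes "0 \<le> t"
  shows "(\<lambda>y. \<Phi> (y, t)) differentiable (at y)"
proof -
  have "\<Phi> differentiable (at (y, t) within (\<lambda>y. (y, t)) ` UNIV)"
    by (rule differentiable_within_subset[OF potential_differentiable]) (use assms in auto)
  moreover have "(\<lambda>y. (y, t)) differentiable (at y)" 
    unfolding differentiable_def by (auto intro!: exI derivative_eq_intros)
  ultimately show ?thesis
    unfolding differentiable_def by (metis has_derivative_in_compose)
qed

lemma potential_C11: "gradient_lipschitz_on {Y. 0 < snd Y} \<Phi>"
proof -
  obtain G where G: "\<forall>Y. 0 \<le> snd Y \<longrightarrow> ((\<lambda>Y. \<psi> (torus_point Q Y 0)) has_derivative
        (\<lambda>h. blinfun_apply (G (chart.exp_point Y 0)) (chart.exp_point_deriv Y h))) (at Y within {Y. 0 \<le> snd Y})"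
    and lip: "\<forall>Y. 0 < snd Y \<longrightarrow> pointwise_lipschitz (\<lambda>Y. G (chart.exp_point Y 0)) Y"
    by (rule psi_derivative)
  let ?g = "\<lambda>Y. \<Sum>b\<in>Basis. blinfun_apply (G (chart.exp_point Y 0)) (chart.exp_point_deriv Y b) *\<^sub>R b"
  have "gradient_lipschitz_on {Y. 0 < snd Y} (\<lambda>Y. \<psi> (torus_point Q Y 0))"
  proof (rule gradient_lipschitz_onI[of _ _ ?g])
    fix Y :: "'a \<times> real" assume Y: "Y \<in> {Y. 0 < snd Y}"
    have op: "open {Y :: 'a \<times> real. 0 < snd Y}" by (intro open_Collect_less continuous_intros)
    have "((\<lambda>Y. \<psi> (torus_point Q Y 0)) has_derivative
        (\<lambda>h. blinfun_apply (G (chart.exp_point Y 0)) (chart.exp_point_deriv Y h))) (at Y within {Y. 0 < snd Y})"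
      by (rule has_derivative_subset[OF G[rule_format]]) (use Y in auto)
    then have der: "((\<lambda>Y. \<psi> (torus_point Q Y 0)) has_derivative
        (\<lambda>h. blinfun_apply (G (chart.exp_point Y 0)) (chart.exp_point_deriv Y h))) (at Y)"
      using at_within_open[OF Y op] by simp
    have lin: "linear (\<lambda>h. blinfun_apply (G (chart.exp_point Y 0)) (chart.exp_point_deriv Y h))"
      using has_derivative_bounded_linear[OF der] by (rule bounded_linear.linear)
    define T where "T = (\<lambda>h. blinfun_apply (G (chart.exp_point Y 0)) (chart.exp_point_deriv Y h))"
    have "T h = h \<bullet> (\<Sum>b\<in>Basis. T b *\<^sub>R b)" for h
    proof -
      have "T h = T (\<Sum>b\<in>Basis. (h \<bullet> b) *\<^sub>R b)" by (simp only: euclidean_representation)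
      also have "\<dots> = (\<Sum>b\<in>Basis. (h \<bullet> b) * T b)"
        using linear_sum[OF lin[folded T_def], of "\<lambda>b. (h \<bullet> b) *\<^sub>R b" Basis]
          linear_cmul[OF lin[folded T_def]] by (simp del: euclidean_representation)
      finally show ?thesis by (simp add: inner_sum_right mult.commute)
    qed
    then have "T = (\<lambda>h. h \<bullet> ?g Y)" unfolding T_def by (rule ext)
    then show "GDERIV (\<lambda>Y. \<psi> (torus_point Q Y 0)) Y :> ?g Y"
      using der[folded T_def] unfolding gderiv_def by (simp only:)
    show "pointwise_lipschitz ?g Y"
    proof (rule pointwise_lipschitz_sum)
      fix b :: "'a \<times> real"
      have "pointwise_lipschitz (\<lambda>Y. blinfun_apply (G (chart.exp_point Y 0)) (chart.exp_point_deriv Y b)) Y"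
        using Y by (intro pointwise_lipschitz_bilinear[OF bounded_bilinear_blinfun_apply] lip[rule_format]
            differentiable_imp_pointwise_lipschitz chart.differentiable_exp_point_deriv) auto
      then show "pointwise_lipschitz (\<lambda>Y. blinfun_apply (G (chart.exp_point Y 0)) (chart.exp_point_deriv Y b) *\<^sub>R b) Y"
        by (rule pointwise_lipschitz_bounded_linear) (rule bounded_linear_scaleR_left)
    qed
  qed
  from gradient_lipschitz_on_add[OF log_sum_C11 gradient_lipschitz_on_cmult[OF this, of "1/2"]]
  show ?thesis unfolding total_potential_def[abs_def] by simp
qed

text \<open>
  Let \<open>S l\<close> be the second derivative of \<open>\<Phi>\<close> along the real part of a complex direction \<open>l\<close>.  Along
  the curves \<open>exp (s l) z\<close> and \<open>exp (s \<i> l) z\<close> the first derivative terms cancel, and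
  \<open>S l + S (\<i> l)\<close> becomes twice the Hermitian form of the complex Hessian at \<open>l z\<close>.  For real \<open>l\<close> the
  second summand vanishes, which gives the sign.  A kernel vector \<open>l z\<close> gives \<open>S l = S (\<i> l) = 0\<close>, and
  the real parts of \<open>l\<close> and \<open>\<i> l\<close> are not both zero.
\<close>

lemma second_derivs_of_degenerate_hessian:
  assumes Y: "0 < snd Y" and hess: "has_hessian local_potential B (chart.exp_point Y \<theta>)"
    and psd: "positive_semidefinite (complex_hessian B)" and det: "det (complex_hessian B) = 0"
  shows "\<exists>q\<ge>0. has_second_deriv (\<lambda>s. \<Phi> (Y + s *\<^sub>R \<eta>)) q"
    and "\<exists>\<eta>. \<eta> \<noteq> 0 \<and> has_second_deriv (\<lambda>s. \<Phi> (Y + s *\<^sub>R \<eta>)) 0"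
proof -
  let ?z = "chart.exp_point Y \<theta>"
  let ?re = "\<lambda>l :: complex ^ 'm. chart.uncoords (\<chi> i. Re (l $ i))"
  let ?im = "\<lambda>l :: complex ^ 'm. chart.uncoords (\<chi> i. Im (l $ i))"
  let ?\<xi> = "\<lambda>l :: complex ^ 'm. \<chi> i. l $ i * ?z $ i"
  let ?h = "\<lambda>l. hermitian_form (complex_hessian B) (?\<xi> l)"
  obtain D where D: "linear D" and curve:
    "\<forall>c c' c''. c 0 = ?z \<longrightarrow> (\<forall>s. (c has_vector_derivative c' s) (at s)) \<longrightarrow>
       (c' has_vector_derivative c'') (at 0) \<longrightarrow> has_second_deriv (\<lambda>s. local_potential (c s)) (B (c' 0) (c' 0) + D c'')"
    by (rule second_deriv_along_curve[OF hess])
  define S where "S = (\<lambda>l. (B (?\<xi> l) (?\<xi> l) + D (\<chi> i. l $ i * l $ i * ?z $ i)) / 2)"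
  have along: "has_second_deriv (\<lambda>s. \<Phi> (Y + s *\<^sub>R ?re l)) (S l)" for l
  proof -
    let ?c = "\<lambda>s. \<chi> i. exp (of_real s * l $ i) * ?z $ i"
    let ?c' = "\<lambda>s. \<chi> i. l $ i * (exp (of_real s * l $ i) * ?z $ i)"
    have "has_second_deriv (\<lambda>s. local_potential (?c s)) (B (?c' 0) (?c' 0) + D (\<chi> i. l $ i * l $ i * (exp (of_real 0 * l $ i) * ?z $ i)))"
    proof (rule curve[rule_format])
      show "?c 0 = ?z" by (simp add: vec_eq_iff)
      show "(?c has_vector_derivative ?c' s) (at s)" for s by (rule chart.exp_curve_derivatives)
      show "(?c' has_vector_derivative (\<chi> i. l $ i * l $ i * (exp (of_real 0 * l $ i) * ?z $ i))) (at 0)"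
        by (rule chart.exp_curve_derivatives)
    qed
    then have "has_second_deriv (\<lambda>s. local_potential (?c s)) (B (?\<xi> l) (?\<xi> l) + D (\<chi> i. l $ i * l $ i * ?z $ i))"
      by (simp del: chart.exp_point_nth)
    moreover have "2 * S l = B (?\<xi> l) (?\<xi> l) + D (\<chi> i. l $ i * l $ i * ?z $ i)"
    proof -
      have "2 * (x / 2) = x" for x :: real by simp
      then show ?thesis unfolding S_def .
    qed
    ultimately have 1: "has_second_deriv (\<lambda>s. local_potential (?c s)) (2 * S l)" by (simp only:)
    have "((\<lambda>s. Y + s *\<^sub>R ?re l) \<longlongrightarrow> Y + 0 *\<^sub>R ?re l) (nhds 0)"
      by (intro tendsto_intros filterlim_ident)
    moreover have "open {Y :: 'a \<times> real. 0 < snd Y}" by (intro open_Collect_less continuous_intros)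
    ultimately have "\<forall>\<^sub>F s in nhds 0. Y + s *\<^sub>R ?re l \<in> {Y. 0 < snd Y}"
      using Y by (intro topological_tendstoD[where l = "Y + 0 *\<^sub>R ?re l"]) auto
    then have ev: "\<forall>\<^sub>F s in nhds 0. local_potential (?c s) + (2 * (v \<bullet> Y) + (2 * (v \<bullet> ?re l)) * s + 0 * s\<^sup>2) = 2 * \<Phi> (Y + s *\<^sub>R ?re l)"
    proof eventually_elim
      case (elim s)
      have "?c s = chart.exp_point (Y + s *\<^sub>R ?re l) (\<theta> + s *\<^sub>R ?im l)"
        by (simp only: chart.exp_point_line)
      then show ?case using elim
        by (simp add: local_potential_exp_point inner_add_right del: chart.exp_point_nth)
    qed
    have "has_second_deriv (\<lambda>s. 2 * \<Phi> (Y + s *\<^sub>R ?re l)) (2 * S l + 2 * 0)"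
      by (rule has_second_deriv_cong[OF has_second_deriv_add[OF 1 has_second_deriv_quadratic] ev])
    from has_second_deriv_cmult[OF this, of "1/2"] show ?thesis by simp
  qed
  have lin: "linear (\<lambda>b. B b a)" "linear (B b)" for a b
    using has_hessian_linear_left[OF hess] has_hessian_linear_right[OF hess] bounded_linear.linear by auto
  have S_sum: "S l + S (\<chi> i. \<i> * l $ i) = 2 * ?h l" for l
  proof -
    have "(\<chi> i. \<i> * ?\<xi> l $ i) = ?\<xi> (\<chi> i. \<i> * l $ i)" by (simp add: vec_eq_iff mult.assoc)
    then have "4 * ?h l = B (?\<xi> l) (?\<xi> l) + B (?\<xi> (\<chi> i. \<i> * l $ i)) (?\<xi> (\<chi> i. \<i> * l $ i))"
      using hermitian_form_complex_hessian[OF lin, of "?\<xi> l"] by simp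
    moreover have "(\<chi> i. (\<chi> i. \<i> * l $ i) $ i * (\<chi> i. \<i> * l $ i) $ i * ?z $ i) = - (\<chi> i. l $ i * l $ i * ?z $ i)"
      by (simp add: vec_eq_iff algebra_simps del: chart.exp_point_nth)
    then have "D (\<chi> i. (\<chi> i. \<i> * l $ i) $ i * (\<chi> i. \<i> * l $ i) $ i * ?z $ i) = - D (\<chi> i. l $ i * l $ i * ?z $ i)"
      by (simp only: linear_neg[OF D])
    moreover have "(a + d) / 2 + (b + e) / 2 = 2 * h" if "4 * h = a + b" "e = - d" for a b d e h :: real
      using that by (simp add: field_simps)
    ultimately show ?thesis unfolding S_def by blast
  qed
  have nonneg: "S l \<ge> 0" for l
  proof -
    \<comment> \<open>Only the real part of \<open>l\<close> enters the second derivative of a function of \<open>Y\<close>.\<close>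
    define r where "r = (\<chi> i. complex_of_real (Re (l $ i)))"
    have "S l = S r"
      using along[of l] along[of r] by (intro has_second_deriv_unique) (simp_all add: r_def)
    moreover have "S (\<chi> i. \<i> * r $ i) = 0"
    proof -
      have "(\<chi> i. Re ((\<chi> i. \<i> * r $ i) $ i)) = (0 :: real ^ 'm)" by (simp add: r_def vec_eq_iff)
      then have "?re (\<chi> i. \<i> * r $ i) = 0" using linear_0[OF chart.linear_uncoords] by simp
      then have "has_second_deriv (\<lambda>s. \<Phi> Y) (S (\<chi> i. \<i> * r $ i))" using along[of "\<chi> i. \<i> * r $ i"] by simp
      moreover have "has_second_deriv (\<lambda>s. \<Phi> Y) (2 * 0)"
        using has_second_deriv_quadratic[of "\<Phi> Y" 0 0] by simp
      ultimately show ?thesis using has_second_deriv_unique by fastforce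
    qed
    ultimately have "S l = 2 * ?h r" using S_sum[of r] by simp
    then show ?thesis using psd by (simp add: positive_semidefinite_def)
  qed
  show "\<exists>q\<ge>0. has_second_deriv (\<lambda>s. \<Phi> (Y + s *\<^sub>R \<eta>)) q"
  proof -
    define l where "l = (\<chi> i. complex_of_real (u i \<bullet> \<eta>))"
    have "(\<chi> i. Re (l $ i)) = chart.coords \<eta>" by (simp add: l_def chart.coords_def vec_eq_iff)
    then have "?re l = \<eta>" by simp
    then show ?thesis using along[of l] nonneg[of l] by auto
  qed
  obtain \<xi> where \<xi>: "\<xi> \<noteq> 0" "hermitian_form (complex_hessian B) \<xi> = 0"
    by (rule degenerate_hermitian_form[OF det])
  define l where "l = (\<chi> i. \<xi> $ i / ?z $ i)"
  have "?\<xi> l = \<xi>" by (simp add: l_def vec_eq_iff)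
  then have "S l + S (\<chi> i. \<i> * l $ i) = 0" using S_sum[of l] \<xi>(2) by simp
  then have S0: "S l = 0" "S (\<chi> i. \<i> * l $ i) = 0" using nonneg[of l] nonneg[of "\<chi> i. \<i> * l $ i"] by linarith+
  have re0: "(\<chi> i. Re (w $ i)) = 0" if "?re w = 0" for w :: "complex ^ 'm"
  proof -
    have "(\<chi> i. Re (w $ i)) = chart.coords (?re w)" by simp
    also have "\<dots> = 0" using that linear_0[OF chart.linear_coords] by simp
    finally show ?thesis .
  qed
  have "?re l \<noteq> 0 \<or> ?re (\<chi> i. \<i> * l $ i) \<noteq> 0"
  proof (rule ccontr)
    assume "\<not> ?thesis"
    then have "Re (l $ i) = 0" "Im (l $ i) = 0" for i
      using re0[of l] re0[of "\<chi> i. \<i> * l $ i"] by (auto simp: vec_eq_iff)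
    then have "l $ i = 0" for i by (simp add: complex_eq_iff)
    then have "\<xi> = 0" by (simp add: l_def vec_eq_iff)
    then show False using \<xi>(1) by simp
  qed
  then show "\<exists>\<eta>. \<eta> \<noteq> 0 \<and> has_second_deriv (\<lambda>s. \<Phi> (Y + s *\<^sub>R \<eta>)) 0"
    using along[of l, unfolded S0(1)] along[of "\<chi> i. \<i> * l $ i", unfolded S0(2)] by blast
qed

lemma potential_second_derivs:
  obtains N where "negligible N"
    "\<forall>Y \<eta>. 0 < snd Y \<longrightarrow> Y \<notin> N \<longrightarrow> (\<exists>q\<ge>0. has_second_deriv (\<lambda>s. \<Phi> (Y + s *\<^sub>R \<eta>)) q)"
    "\<forall>Y. 0 < snd Y \<longrightarrow> Y \<notin> N \<longrightarrow> (\<exists>\<eta>. \<eta> \<noteq> 0 \<and> has_second_deriv (\<lambda>s. \<Phi> (Y + s *\<^sub>R \<eta>)) 0)"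
proof -
  obtain M where M: "negligible M" and good: "\<forall>z. z \<in> interior chart_domain \<longrightarrow> z \<notin> M \<longrightarrow>
      (\<exists>B. has_hessian local_potential B z \<and>
        positive_semidefinite (complex_hessian B) \<and> det (complex_hessian B) = 0)"
  proof -
    have "local_potential = (\<lambda>z. fs_potential Q (chart_vec Q v u z) + \<psi> (chart_point Q v u z))"
      by (simp add: local_potential_def fun_eq_iff)
    from hcma[folded this] obtain M where "negligible M" "{z. \<not> (z \<in> interior chart_domain \<longrightarrow>
      (\<exists>B. has_hessian local_potential B z \<and>
        positive_semidefinite (complex_hessian B) \<and> det (complex_hessian B) = 0))} \<subseteq> M"
      unfolding eventually_ae_filter_negligible by (elim exE conjE)
    then show ?thesis by (intro that[of M]) blast+
  qed
  \<comment> \<open>One open set of angles suffices, and a small one avoids the branch cut of the logarithm.\<close>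
  let ?U = "{\<theta> :: 'a \<times> real. \<forall>i. \<bar>u i \<bullet> \<theta>\<bar> < 1}"
  have "?U = (\<Inter>i. {\<theta>. \<bar>u i \<bullet> \<theta>\<bar> < 1})" by auto
  moreover have "open {\<theta>. \<bar>u i \<bullet> \<theta>\<bar> < 1}" for i by (intro open_Collect_less continuous_intros)
  ultimately have "open ?U" by (simp add: open_INT)
  moreover have "0 \<in> ?U" by simp
  then have "?U \<noteq> {}" by blast
  ultimately obtain N where N: "negligible N"
    "\<forall>y. y \<notin> N \<longrightarrow> (\<exists>\<theta>\<in>?U. (y, \<theta>) \<notin> {(y, \<theta>). (\<forall>i. \<bar>u i \<bullet> \<theta>\<bar> < 1) \<and> chart.exp_point y \<theta> \<in> M})"
    by (rule negligible_slices[OF chart.negligible_log_preimage[OF M]])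
  have ex: "\<exists>\<theta> B. has_hessian local_potential B (chart.exp_point Y \<theta>) \<and>
      positive_semidefinite (complex_hessian B) \<and> det (complex_hessian B) = 0" if "0 < snd Y" "Y \<notin> N" for Y
  proof -
    have "\<exists>\<theta>. chart.exp_point Y \<theta> \<notin> M" using N(2) that(2) by blast
    then show ?thesis using good exp_point_in_interior_domain[OF that(1)] by blast
  qed
  show ?thesis
  proof (rule that[OF N(1)])
    show "\<forall>Y \<eta>. 0 < snd Y \<longrightarrow> Y \<notin> N \<longrightarrow> (\<exists>q\<ge>0. has_second_deriv (\<lambda>s. \<Phi> (Y + s *\<^sub>R \<eta>)) q)"
    proof (intro allI impI)
      fix Y \<eta> assume Y: "0 < snd Y" "Y \<notin> N"
      obtain \<theta> B where "has_hessian local_potential B (chart.exp_point Y \<theta>)"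
        "positive_semidefinite (complex_hessian B)" "det (complex_hessian B) = 0"
        using ex[OF Y] by (elim exE conjE)
      then show "\<exists>q\<ge>0. has_second_deriv (\<lambda>s. \<Phi> (Y + s *\<^sub>R \<eta>)) q"
        by (rule second_derivs_of_degenerate_hessian(1)[OF Y(1)])
    qed
    show "\<forall>Y. 0 < snd Y \<longrightarrow> Y \<notin> N \<longrightarrow> (\<exists>\<eta>. \<eta> \<noteq> 0 \<and> has_second_deriv (\<lambda>s. \<Phi> (Y + s *\<^sub>R \<eta>)) 0)"
    proof (intro allI impI)
      fix Y assume Y: "0 < snd Y" "Y \<notin> N"
      obtain \<theta> B where "has_hessian local_potential B (chart.exp_point Y \<theta>)"
        "positive_semidefinite (complex_hessian B)" "det (complex_hessian B) = 0"
        using ex[OF Y] by (elim exE conjE)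
      then show "\<exists>\<eta>. \<eta> \<noteq> 0 \<and> has_second_deriv (\<lambda>s. \<Phi> (Y + s *\<^sub>R \<eta>)) 0"
        by (rule second_derivs_of_degenerate_hessian(2)[OF Y(1)])
    qed
  qed
qed

text \<open>
  The points in question have real chart coordinates in \<open>[0, 1]\<close>, and the cube lies in the domain where \<open>\<psi>\<close>
  is continuous, including its faces outside the torus.
\<close>

lemma psi_bounded_at_upper_vertex:
  assumes "0 < snd v"
  obtains C where "\<forall>Y. (\<forall>p\<in>Q. p \<bullet> Y \<le> v \<bullet> Y) \<longrightarrow> \<bar>\<psi> (torus_point Q Y 0)\<bar> \<le> C"
proof -
  let ?rc = "\<lambda>x :: real ^ 'm. \<chi> i. complex_of_real (x $ i)"
  have "vertex_chart Q (fst v, snd v) u" using chart.vertex_chart_axioms by simp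
  then have poly: "z \<in> chart_domain" if "\<And>i. cmod (z $ i) \<le> 1" for z
    using polydisc_over_disc[of "fst v" "snd v" u z] assms that by simp
  obtain G :: "complex ^ 'm \<Rightarrow> (complex ^ 'm) \<Rightarrow>\<^sub>L real" where
    "\<forall>z\<in>chart_domain. ((\<lambda>z. \<psi> (chart_point Q v u z)) has_derivative blinfun_apply (G z)) (at z within chart_domain)"
    using C11 unfolding C11_on_def by (elim exE conjE)
  then have cont: "continuous_on chart_domain (\<lambda>z. \<psi> (chart_point Q v u z))"
    by (intro has_derivative_continuous_on) blast
  have cmod_le: "cmod (?rc x $ i) \<le> 1" if "x \<in> cbox 0 1" for x i
    using that by (auto simp: mem_box_cart)
  have "continuous_on (cbox 0 1) (\<lambda>x. \<psi> (chart_point Q v u (?rc x)))"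
  proof (rule continuous_on_compose2[OF cont])
    show "continuous_on (cbox 0 1) ?rc" by (intro continuous_intros)
    show "?rc ` cbox 0 1 \<subseteq> chart_domain" using poly cmod_le by blast
  qed
  then have "bounded ((\<lambda>x. \<psi> (chart_point Q v u (?rc x))) ` cbox 0 1)"
    by (intro compact_imp_bounded compact_continuous_image compact_cbox)
  then obtain C where C: "\<And>x. x \<in> cbox 0 1 \<Longrightarrow> \<bar>\<psi> (chart_point Q v u (?rc x))\<bar> \<le> C"
    unfolding bounded_iff by auto
  have "\<bar>\<psi> (torus_point Q Y 0)\<bar> \<le> C" if Y: "\<forall>p\<in>Q. p \<bullet> Y \<le> v \<bullet> Y" for Y
  proof -
    have "chart.exp_point Y 0 = ?rc (\<chi> i. exp (u i \<bullet> Y))" by (simp add: chart.exp_point_real vec_eq_iff)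
    moreover have "(\<chi> i. exp (u i \<bullet> Y)) \<in> cbox 0 (1 :: real ^ 'm)"
      using chart.edge_nonpos_at_max[of Y] Y by (simp add: mem_box_cart)
    ultimately show ?thesis using C[of "\<chi> i. exp (u i \<bullet> Y)"] unfolding psi_torus_point by simp
  qed
  then show ?thesis using that by blast
qed

end

section \<open>The initial direction of the induced ray\<close>

context vertex_chart
begin

text \<open>
  A polytope without interior lies in a hyperplane, whose normal would be orthogonal to all edges at \<open>v\<close>.
\<close>

lemma interior_nonempty: "interior Q \<noteq> {}"
proof
  assume "interior Q = {}"
  then obtain a b where a: "a \<noteq> 0" "Q \<subseteq> {x. a \<bullet> x = b}"
    using empty_interior_subset_hyperplane[OF polytope_imp_convex[OF polytope_Q]] by blast
  have eq: "p \<bullet> a = v \<bullet> a" if "p \<in> Q" for p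
    using a(2) that v_in_Q by (metis (mono_tags, lifting) inner_commute mem_Collect_eq subsetD)
  have "u i \<bullet> a \<le> 0" "u i \<bullet> (- a) \<le> 0" for i
    by (rule edge_nonpos_at_max, simp add: eq)+
  then have "u i \<bullet> a = 0" for i by (simp add: order_antisym)
  then have "coords a = coords 0" by (simp add: coords_def)
  then show False using inj_coords a(1) by (simp add: inj_eq)
qed

end

lemma continuous_on_rational_piecewise_linear:
  assumes "rational_piecewise_linear_on P f"
  shows "continuous_on P f"
proof -
  obtain \<C> where C: "finite \<C>" "\<forall>C\<in>\<C>. polytope C" "\<Union>\<C> = P"
    "\<forall>C\<in>\<C>. \<exists>a b. (\<forall>i\<in>Basis. a \<bullet> i \<in> \<rat>) \<and> b \<in> \<rat> \<and> (\<forall>x\<in>C. f x = a \<bullet> x + b)"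
    using assms unfolding rational_piecewise_linear_on_def by blast
  have "continuous_on (\<Union>C\<in>\<C>. C) f"
  proof (rule continuous_on_closed_Union[OF C(1)])
    fix C assume C': "C \<in> \<C>"
    show "closed C" using C(2) C' by (simp add: polytope_imp_closed)
    obtain a b where "\<forall>x\<in>C. f x = a \<bullet> x + b" using C(4) C' by blast
    moreover have "continuous_on C (\<lambda>x. a \<bullet> x + b)" by (intro continuous_intros)
    ultimately show "continuous_on C f" by (simp cong: continuous_on_cong)
  qed
  then show ?thesis using C(3) by simp
qed

lemma algebraic_ray_eq_log_sum: "algebraic_ray Q K t y = log_sum Q (y, t) - K * t"
proof -
  have "(\<Sum>(d, k)\<in>lattice_points Q. exp (2 * k * t) * exp (2 * (d \<bullet> y)))
      = (\<Sum>p\<in>lattice_points Q. exp (2 * (p \<bullet> (y, t))))"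
    by (intro sum.cong) (auto simp: exp_add[symmetric] algebra_simps)
  then show ?thesis by (simp add: algebraic_ray_def log_sum_def)
qed

lemma vertex_chart_exists:
  fixes Q :: "'a::euclidean_space set"
  assumes "delzant Q" "integral_polytope Q" "v extreme_point_of Q" "CARD('m::finite) = DIM('a)"
  shows "\<exists>u :: 'm \<Rightarrow> 'a. vertex_chart Q v u"
proof -
  obtain U where U: "delzant_frame Q v U" using assms(1,3) by (auto simp: delzant_def)
  then have basis: "lattice_basis U" by (simp add: delzant_frame_def)
  then have fin: "finite U" and indep: "independent U" by (auto simp: lattice_basis_def)
  have "b \<in> span U" if "b \<in> Basis" for b
  proof -
    have "b \<in> lattice" using that by (auto simp: lattice_def inner_Basis)
    then obtain c :: "'a \<Rightarrow> int" where "b = (\<Sum>a\<in>U. of_int (c a) *\<^sub>R a)"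
      using basis unfolding lattice_basis_def by blast
    then show ?thesis by (simp add: span_sum span_scale span_base)
  qed
  then have "span U = UNIV" by (metis span_Basis span_minimal subsetI subspace_span top.extremum_uniqueI)
  then have "card U = DIM('a)" using indep by (metis dim_span dim_eq_card_independent dim_UNIV)
  then obtain u :: "'m \<Rightarrow> 'a" where "bij_betw u UNIV U"
    using finite_same_card_bij[of "UNIV :: 'm set" U] fin assms(4) by auto
  then have "chart_frame Q v u" using U by (auto simp: chart_frame_def bij_betw_def)
  then show ?thesis using assms by (intro exI[of _ u]) (auto simp: vertex_chart_def integral_polytope_def)
qed

lemma closure_positive_halfspace: "closure {Y :: 'a::euclidean_space \<times> real. 0 < snd Y} = {Y. 0 \<le> snd Y}"
proof -
  have "{Y :: 'a \<times> real. 0 < snd Y} = {Y. (0, 1::real) \<bullet> Y > 0}" "{Y :: 'a \<times> real. 0 \<le> snd Y} = {Y. (0, 1::real) \<bullet> Y \<ge> 0}"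
    by auto
  then show ?thesis using closure_halfspace_gt[of "(0, 1) :: 'a \<times> real" 0] by (simp add: zero_prod_def)
qed

lemma induced_ray_eq:
  fixes P :: "(real ^ 'n) set"
  assumes "integral_hat_polytope P f K Q"
  shows "induced_ray P Q K \<psi> t = (\<lambda>y. total_potential Q \<psi> (y, t) - K * t)"
  by (simp add: induced_ray_def integral_hat_polytope.flow_of_fibre_point[OF assms] fun_eq_iff
      algebraic_ray_eq_log_sum total_potential_def)

lemma hcma_solution_imp_degenerate_chart:
  fixes P :: "(real ^ 'n) set" and u :: "'n option \<Rightarrow> (real ^ 'n) \<times> real"
  assumes "integral_hat_polytope P f K Q" "vertex_chart Q v u" and sol: "hcma_solution P Q K h0 \<psi>"
  shows "degenerate_chart P f K Q v u \<psi>"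
proof -
  have frame: "chart_frame Q v u" using assms(2) by (simp add: vertex_chart_def)
  show ?thesis
    unfolding degenerate_chart_def degenerate_chart_axioms_def
    using sol[unfolded hcma_solution_def Let_def] frame assms(1,2) by blast
qed

context integral_hat_polytope
begin

lemma interior_P_nonempty:
  assumes "interior Q \<noteq> {}"
  shows "interior P \<noteq> {}"
proof -
  obtain x c r where r: "r > 0" "ball (x, c) r \<subseteq> Q"
    using assms by (metis all_not_in_conv mem_interior surj_pair)
  have "ball x r \<subseteq> P"
  proof
    fix x' assume "x' \<in> ball x r"
    then have "(x', c) \<in> ball (x, c) r" by (simp add: dist_Pair_Pair)
    then show "x' \<in> P" using r(2) by (auto simp: Q_eq hat_polytope_def)
  qed
  then show ?thesis using r(1) by (metis centre_in_ball empty_iff mem_interior)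
qed

text \<open>
  For \<open>t > 0\<close> a maximising vertex provides the bound, and there are finitely many vertices.  The bound
  extends to \<open>t = 0\<close> by continuity, where a maximising vertex may lie on the bottom face.
\<close>

lemma psi_bounded:
  assumes charts: "\<And>v. v extreme_point_of Q \<Longrightarrow> \<exists>u :: 'm::finite \<Rightarrow> 'a \<times> real. degenerate_chart P f K Q v u \<psi>"
  obtains C where "\<forall>Y. 0 \<le> snd Y \<longrightarrow> \<bar>\<psi> (torus_point Q Y 0)\<bar> \<le> C"
proof -
  let ?V = "{v. v extreme_point_of Q}"
  have "\<exists>C. 0 < snd v \<longrightarrow> (\<forall>Y. (\<forall>p\<in>Q. p \<bullet> Y \<le> v \<bullet> Y) \<longrightarrow> \<bar>\<psi> (torus_point Q Y 0)\<bar> \<le> C)" if v: "v \<in> ?V" for v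
  proof (cases "0 < snd v")
    case True
    obtain u :: "'m \<Rightarrow> 'a \<times> real" where "degenerate_chart P f K Q v u \<psi>" using charts v by blast
    then interpret degenerate_chart P f K Q v u \<psi> .
    show ?thesis using psi_bounded_at_upper_vertex[OF True] by metis
  qed simp
  then obtain C where C: "\<forall>v\<in>?V. 0 < snd v \<longrightarrow> (\<forall>Y. (\<forall>p\<in>Q. p \<bullet> Y \<le> v \<bullet> Y) \<longrightarrow> \<bar>\<psi> (torus_point Q Y 0)\<bar> \<le> C v)"
    by metis
  have fin: "finite ?V" by (intro finite_polyhedron_extreme_points polytope_imp_polyhedron polytope_Q)
  define B where "B = (\<Sum>v\<in>?V. \<bar>C v\<bar>)"
  have pos: "\<bar>\<psi> (torus_point Q Y 0)\<bar> \<le> B" if Y: "0 < snd Y" for Y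
  proof -
    obtain v where v: "v extreme_point_of Q" "0 < snd v" "\<forall>p\<in>Q. p \<bullet> Y \<le> v \<bullet> Y"
      by (rule max_at_upper_vertex[OF Y])
    then have "\<bar>\<psi> (torus_point Q Y 0)\<bar> \<le> C v" using C by blast
    also have "\<dots> \<le> \<bar>C v\<bar>" by simp
    also have "\<dots> \<le> B" unfolding B_def using fin v(1) by (intro member_le_sum) auto
    finally show ?thesis .
  qed
  obtain v where v: "v extreme_point_of Q" by (rule polytope_max_at_vertex[OF polytope_Q Q_nonempty])
  obtain u :: "'m \<Rightarrow> 'a \<times> real" where "degenerate_chart P f K Q v u \<psi>" using charts[OF v] by blast
  then interpret degenerate_chart P f K Q v u \<psi> .
  have "continuous_on {Y. 0 \<le> snd Y} (\<lambda>Y. \<bar>2 * (\<Phi> Y - log_sum Q Y)\<bar>)"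
    using log_sum_C11 by (intro continuous_intros potential_continuous gradient_lipschitz_on_imp_continuous_on)
  then have "continuous_on {Y. 0 \<le> snd Y} (\<lambda>Y. \<bar>\<psi> (torus_point Q Y 0)\<bar>)"
    by (simp add: total_potential_def)
  then have "\<bar>\<psi> (torus_point Q Y 0)\<bar> \<le> B" if "0 \<le> snd Y" for Y
    using continuous_le_on_closure[of "{Y. 0 < snd Y}" "\<lambda>Y. \<bar>\<psi> (torus_point Q Y 0)\<bar>" Y B] pos that
    by (simp add: closure_positive_halfspace)
  then show ?thesis using that by blast
qed

end

theorem theorem1p5:
  fixes P :: "(real ^ 'n) set"
    and f :: "real ^ 'n \<Rightarrow> real"
    and K :: real
    and Q :: "((real ^ 'n) \<times> real) set"
    and h0 :: "real ^ 'n \<Rightarrow> real"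
    and \<psi> :: "((real ^ 'n) \<times> real \<Rightarrow> complex) set \<Rightarrow> real"
    and u :: "real \<Rightarrow> real ^ 'n \<Rightarrow> real"
  assumes "Q = hat_polytope P f K"
    and "delzant P"
    and "rational_piecewise_linear_on P f" and "convex_on P f"
    and "\<forall>x\<in>P. f x < K"
    and "delzant Q" and "integral_polytope Q"
    and "toric_kaehler_potential P Q K h0"
    and "hcma_solution P Q K h0 \<psi>"
    and "\<forall>t\<ge>0. polytope_representation P (induced_ray P Q K \<psi> t) (u t)"
  shows "\<forall>x\<in>P. ((\<lambda>t. u t x) has_real_derivative f x) (at 0 within {0..})"
proof -
  interpret hat: integral_hat_polytope P f K Q
    using assms(1,5,6,7) by unfold_locales auto
  have charts: "\<exists>w :: 'n option \<Rightarrow> (real ^ 'n) \<times> real. degenerate_chart P f K Q v w \<psi>"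
    if v: "v extreme_point_of Q" for v
  proof -
    have "CARD('n option) = DIM((real ^ 'n) \<times> real)" by simp
    then obtain w :: "'n option \<Rightarrow> (real ^ 'n) \<times> real" where "vertex_chart Q v w"
      using vertex_chart_exists[OF assms(6,7) v] by blast
    then show ?thesis
      using hcma_solution_imp_degenerate_chart[OF hat.integral_hat_polytope_axioms _ assms(9)] by blast
  qed
  obtain C where C: "\<forall>Y. 0 \<le> snd Y \<longrightarrow> \<bar>\<psi> (torus_point Q Y 0)\<bar> \<le> C"
    by (rule hat.psi_bounded[OF charts])
  obtain v where "v extreme_point_of Q"
    by (rule polytope_max_at_vertex[OF hat.polytope_Q hat.Q_nonempty])
  then obtain w :: "'n option \<Rightarrow> (real ^ 'n) \<times> real" where "degenerate_chart P f K Q v w \<psi>"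
    using charts by blast
  then interpret degenerate_chart P f K Q v w \<psi> .
  obtain N where N: "negligible N"
    "\<forall>Y \<eta>. 0 < snd Y \<longrightarrow> Y \<notin> N \<longrightarrow> (\<exists>q\<ge>0. has_second_deriv (\<lambda>s. \<Phi> (Y + s *\<^sub>R \<eta>)) q)"
    "\<forall>Y. 0 < snd Y \<longrightarrow> Y \<notin> N \<longrightarrow> (\<exists>\<eta>. \<eta> \<noteq> 0 \<and> has_second_deriv (\<lambda>s. \<Phi> (Y + s *\<^sub>R \<eta>)) 0)"
    by (rule potential_second_derivs)
  define L where "L = ln (real (card (lattice_points Q)))"
  have cont_f: "continuous_on P f" using assms(3) by (rule continuous_on_rational_piecewise_linear)
  interpret degenerate_potential P f K Q \<Phi> N "\<bar>C\<bar> + \<bar>L\<bar>"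
  proof unfold_locales
    show "Q = hat_polytope P f K" by fact
    show "convex Q" by (rule polytope_imp_convex[OF hat.polytope_Q])
    show "continuous_on P f" by fact
    show "continuous_on {Y. 0 \<le> snd Y} \<Phi>" by (rule potential_continuous)
    show "gradient_lipschitz_on {Y. 0 < snd Y} \<Phi>" by (rule potential_C11)
    show "negligible N" by fact
    show "f x < K" if "x \<in> P" for x using that assms(5) by blast
    show "\<exists>q\<ge>0. has_second_deriv (\<lambda>s. \<Phi> (Y + s *\<^sub>R \<eta>)) q" if "0 < snd Y" "Y \<notin> N" for Y \<eta>
      using N(2) that by blast
    show "\<exists>\<eta>. \<eta> \<noteq> 0 \<and> has_second_deriv (\<lambda>s. \<Phi> (Y + s *\<^sub>R \<eta>)) 0" if "0 < snd Y" "Y \<notin> N" for Y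
      using N(3) that by blast
    show "p \<bullet> Y \<le> \<Phi> Y + (\<bar>C\<bar> + \<bar>L\<bar>)" if "0 \<le> snd Y" "p \<in> Q" for Y p
      using log_sum_bounds(1)[OF assms(7) hat.Q_nonempty that(2), of Y] C[rule_format, OF that(1)]
      by (simp add: total_potential_def)
    show "\<exists>p\<in>Q. \<Phi> Y \<le> p \<bullet> Y + (\<bar>C\<bar> + \<bar>L\<bar>)" if Y: "0 \<le> snd Y" for Y
    proof -
      obtain p where "p \<in> Q" "log_sum Q Y \<le> p \<bullet> Y + L / 2"
        using log_sum_bounds(2)[OF assms(7) hat.Q_nonempty, of Y] unfolding L_def by blast
      then show ?thesis using C[rule_format, OF Y]
        by (intro bexI[of _ p]) (simp_all add: total_potential_def)
    qed
  qed
  have rep: "continuous_on P (u t)" "GDERIV (induced_ray P Q K \<psi> t) y :> x \<Longrightarrow> u t x + induced_ray P Q K \<psi> t y = x \<bullet> y"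
    if "0 \<le> t" for t x y
    using assms(10) that unfolding polytope_representation_def by blast+
  have legendre: "u t x = K * t - slice_min x t" if x: "x \<in> interior P" and t: "0 \<le> t" for x t
  proof -
    obtain y where y: "\<Phi> (y, t) - x \<bullet> y = slice_min x t" "\<forall>y'. slice_min x t \<le> \<Phi> (y', t) - x \<bullet> y'"
      by (rule slice_min_attained[OF x t])
    obtain D where D: "((\<lambda>y. \<Phi> (y, t)) has_derivative D) (at y)"
      using slice_differentiable[OF t] unfolding differentiable_def by blast
    then have der: "((\<lambda>y. \<Phi> (y, t) - x \<bullet> y) has_derivative (\<lambda>h. D h - x \<bullet> h)) (at y)"
      by (auto intro!: derivative_eq_intros)
    have "(\<lambda>h. D h - x \<bullet> h) = (\<lambda>h. 0)"
      by (rule differential_zero_maxmin[OF _ _ der, of UNIV]) (use y in auto)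
    then have "D = (\<lambda>h. h \<bullet> x)" by (auto simp: fun_eq_iff inner_commute)
    then have "((\<lambda>y. \<Phi> (y, t) - K * t) has_derivative (\<lambda>h. h \<bullet> x)) (at y)"
      using D by (auto intro!: derivative_eq_intros)
    then have "GDERIV (induced_ray P Q K \<psi> t) y :> x"
      unfolding gderiv_def induced_ray_eq[OF hat.integral_hat_polytope_axioms] .
    from rep(2)[OF t this] show ?thesis using y(1) by (simp add: induced_ray_eq[OF hat.integral_hat_polytope_axioms])
  qed
  have affine_interior: "u t x - u 0 x - t * f x = 0" if "x \<in> interior P" "0 \<le> t" for x t
    using legendre[OF that] legendre[OF that(1), of 0] slice_min_affine[OF that] by (simp add: algebra_simps)
  have "polytope P" using assms(2) by (simp add: delzant_def)
  then have P: "closure (interior P) = P"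
    using convex_closure_interior[of P] hat.interior_P_nonempty[OF chart.interior_nonempty]
    by (simp add: polytope_imp_convex polytope_imp_closed)
  have affine: "u t x = u 0 x + t * f x" if "x \<in> P" "0 \<le> t" for x t
  proof -
    have "continuous_on (closure (interior P)) (\<lambda>x. u t x - u 0 x - t * f x)"
      unfolding P using that(2) by (intro continuous_intros rep(1) cont_f) auto
    then have "u t x - u 0 x - t * f x = 0"
      by (rule continuous_constant_on_closure) (use that affine_interior P in auto)
    then show ?thesis by simp
  qed
  show ?thesis
  proof
    fix x assume x: "x \<in> P"
    have der: "((\<lambda>t. u 0 x + t * f x) has_derivative (*) (f x)) (at 0 within {0..})"
      by (auto intro!: derivative_eq_intros)
    show "((\<lambda>t. u t x) has_real_derivative f x) (at 0 within {0..})"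
      unfolding has_field_derivative_def
    proof (rule has_derivative_transform[OF _ _ der])
      show "u t x = u 0 x + t * f x" if "t \<in> {0..}" for t by (rule affine[OF x]) (use that in simp)
    qed simp
  qed
qed

end
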